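(* The monoidal functor $\Phi\colon\mathcal T_{7/3,26}\to\mathfrak g\text{-mod}$ (over $\mathbb k=\mathbb C$) determined by $\Phi(\mathsf I)=V$, $\Phi(\mu)(a\otimes b)=\pi(a\circ b)$, $\Phi(\chi)(a\otimes b)=b\otimes a$, $\Phi(\eta)(1)=\sum_{b\in\mathbf B_V}b\otimes b^\vee$, $\Phi(\varepsilon)(a\otimes b)=\operatorname{tr}(a\circ b)$ is full.
   Context: The category $\mathcal T_{\alpha,\delta}$. Let $\mathbb k$ be a field of characteristic zero, $\alpha\in\mathbb k^\times$, $\delta\in\mathbb k$. $\mathcal T=\mathcal T_{\alpha,\delta}$ is the strict $\mathbb k$-linear monoidal category with unit object $\mathbf 1$ generated by one object $\mathsf I$ and morphisms $\mu\colon\mathsf I\otimes\mathsf I\to\mathsf I$, $\chi\colon\mathsf I\otimes\mathsf I\to\mathsf I\otimes\mathsf I$, $\eta\colon\mathbf 1\to\mathsf I\otimes\mathsf I$, $\varepsilon\colon\mathsf I\otimes\mathsf I\to\mathbf 1$, subject to the following relations (composition is written right to left, $1$ denotes $1_{\mathsf I}$ and $\nu:=(1\otimes\mu)(\eta\otimes1)\colon\mathsf I\to\mathsf I\otimes\mathsf I$): (i) $(\varepsilon\otimes1)(1\otimes\eta)=1=(1\otimes\varepsilon)(\eta\otimes1)$; $(1\otimes\mu)(\eta\otimes1)=(\mu\otimes1)(1\otimes\eta)$; $(1\otimes\varepsilon)(\chi\otimes1)=(\varepsilon\otimes1)(1\otimes\chi)$; (ii) $\chi^2=1_{\mathsf I\otimes\mathsf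 I}$; $(\chi\otimes1)(1\otimes\chi)(\chi\otimes1)=(1\otimes\chi)(\chi\otimes1)(1\otimes\chi)$; $(1\otimes\mu)(\chi\otimes1)(1\otimes\chi)=\chi(\mu\otimes1)$; $(1\otimes\chi)(\chi\otimes1)(1\otimes\nu)=(\nu\otimes1)\chi$; (iii) $\varepsilon\chi=\varepsilon$; $\mu\chi=\mu$; $\mu\nu=\alpha1$; $\varepsilon\eta=\delta1_{\mathbf 1}$; $\mu\eta=0$. The Lie algebra side. Let $\mathbb O$ be the (real, division) octonions and $A$ the $27$-dimensional real vector space of self-adjoint $3\times3$ matrices over $\mathbb O$, with product $a\circ b=\frac12(ab+ba)$ ($ab$ being matrix multiplication) and trace $\operatorname{tr}\colon A\to\mathbb R$ the sum of the (real) diagonal entries. Let $G$ be the group of algebra automorphisms of $A$ (the compact connected real Lie group of type $F_4$), $\mathfrak g$ the complexification of its Lie algebra (the complex simple Lie algebra of type $F_4$), and $\mathfrak g$-mod the category of finite-dimensional $\mathfrak g$-modules. Let $V_{\mathbb R}=\ker(\operatorname{tr})\subset A$, a $26$-dimensional irreducible $G$-module, and $V=\mathbb C\otimes_{\mathbb R}V_{\mathbb R}$ the corresponding $\mathfrak g$-module. The maps $\circ$, $\operatorname{tr}$ and $\pi\colon A\to V_{\mathbb R}$, $\pi(a)=a-\frac13\operatorname{tr}(a)1_A$, are extended $\mathbb C$-linearly. $\mathbf B_V$ is a basis of $V_{\mathbb R}$ (hence a $\mathbb C$-basis of $V$) and $\{b^\vee:b\in\mathbf B_V\}$ is the dual basis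 defined by $\operatorname{tr}(a^\vee\circ b)=\delta_{a,b}$ for $a,b\in\mathbf B_V$. The assignments in the claim are known to define a unique monoidal functor $\Phi$. *)

theory Defs
  imports "HOL-Analysis.Analysis" "HOL-Library.Function_Algebras"
begin

text \<open>
  The category \<open>\<T>\<close> with parameters \<open>\<alpha>\<close>, \<open>\<delta>\<close>. The objects of the strict monoidal category
  generated by one object \<open>I\<close> are the
  tensor powers of \<open>I\<close>; the object \<open>I\<^sup>\<otimes>\<^sup>n\<close> is represented by the natural number \<open>n\<close>.
  Morphisms are classes of formal expressions. \<open>Comp s t\<close> is \<open>s\<close> after \<open>t\<close>.
\<close>

datatype 'k diag =
    Id nat | Mu | Chi | Eta | Eps
  | Zero nat nat
  | Comp "'k diag" "'k diag"
  | Tens "'k diag" "'k diag"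
  | Add "'k diag" "'k diag"
  | Scale 'k "'k diag"

inductive arr :: "'k diag \<Rightarrow> nat \<Rightarrow> nat \<Rightarrow> bool" where
  "arr (Id n) n n"
| "arr Mu 2 1"
| "arr Chi 2 2"
| "arr Eta 0 2"
| "arr Eps 2 0"
| "arr (Zero m n) m n"
| "arr s n p \<Longrightarrow> arr t m n \<Longrightarrow> arr (Comp s t) m p"
| "arr s m n \<Longrightarrow> arr t p q \<Longrightarrow> arr (Tens s t) (m + p) (n + q)"
| "arr s m n \<Longrightarrow> arr t m n \<Longrightarrow> arr (Add s t) m n"
| "arr s m n \<Longrightarrow> arr (Scale c s) m n"

abbreviation I1 :: "'k diag" where "I1 \<equiv> Id 1"

definition Nu :: "'k diag" where
  "Nu = Comp (Tens I1 Mu) (Tens Eta I1)"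

text \<open>
  \<open>diag_eq \<alpha> \<delta> m n s t\<close>: the expressions \<open>s, t : I\<^sup>\<otimes>\<^sup>m \<rightarrow> I\<^sup>\<otimes>\<^sup>n\<close> denote the same morphism.
  The rules up to \<open>interchange\<close> are the axioms of a strict \<open>k\<close>-linear monoidal category.
\<close>

inductive diag_eq :: "'k::field_char_0 \<Rightarrow> 'k \<Rightarrow> nat \<Rightarrow> nat \<Rightarrow> 'k diag \<Rightarrow> 'k diag \<Rightarrow> bool"
  for \<alpha> \<delta> :: 'k where
  refl: "arr t m n \<Longrightarrow> diag_eq \<alpha> \<delta> m n t t"
| sym: "diag_eq \<alpha> \<delta> m n s t \<Longrightarrow> diag_eq \<alpha> \<delta> m n t s"
| trans: "diag_eq \<alpha> \<delta> m n s t \<Longrightarrow> diag_eq \<alpha> \<delta> m n t u \<Longrightarrow> diag_eq \<alpha> \<delta> m n s u"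
| cong_Comp: "diag_eq \<alpha> \<delta> n p s s' \<Longrightarrow> diag_eq \<alpha> \<delta> m n t t'
    \<Longrightarrow> diag_eq \<alpha> \<delta> m p (Comp s t) (Comp s' t')"
| cong_Tens: "diag_eq \<alpha> \<delta> m n s s' \<Longrightarrow> diag_eq \<alpha> \<delta> p q t t'
    \<Longrightarrow> diag_eq \<alpha> \<delta> (m + p) (n + q) (Tens s t) (Tens s' t')"
| cong_Add: "diag_eq \<alpha> \<delta> m n s s' \<Longrightarrow> diag_eq \<alpha> \<delta> m n t t'
    \<Longrightarrow> diag_eq \<alpha> \<delta> m n (Add s t) (Add s' t')"
| cong_Scale: "diag_eq \<alpha> \<delta> m n s s' \<Longrightarrow> diag_eq \<alpha> \<delta> m n (Scale c s) (Scale c s')"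
| Comp_assoc: "arr s p q \<Longrightarrow> arr t n p \<Longrightarrow> arr u m n
    \<Longrightarrow> diag_eq \<alpha> \<delta> m q (Comp (Comp s t) u) (Comp s (Comp t u))"
| Id_left: "arr t m n \<Longrightarrow> diag_eq \<alpha> \<delta> m n (Comp (Id n) t) t"
| Id_right: "arr t m n \<Longrightarrow> diag_eq \<alpha> \<delta> m n (Comp t (Id m)) t"
| Add_assoc: "arr s m n \<Longrightarrow> arr t m n \<Longrightarrow> arr u m n
    \<Longrightarrow> diag_eq \<alpha> \<delta> m n (Add (Add s t) u) (Add s (Add t u))"
| Add_commute: "arr s m n \<Longrightarrow> arr t m n \<Longrightarrow> diag_eq \<alpha> \<delta> m n (Add s t) (Add t s)"
| Add_Zero: "arr t m n \<Longrightarrow> diag_eq \<alpha> \<delta> m n (Add t (Zero m n)) t"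
| Add_minus: "arr t m n \<Longrightarrow> diag_eq \<alpha> \<delta> m n (Add t (Scale (- 1) t)) (Zero m n)"
| Scale_Add: "arr s m n \<Longrightarrow> arr t m n
    \<Longrightarrow> diag_eq \<alpha> \<delta> m n (Scale c (Add s t)) (Add (Scale c s) (Scale c t))"
| Scale_plus: "arr t m n
    \<Longrightarrow> diag_eq \<alpha> \<delta> m n (Scale (c + d) t) (Add (Scale c t) (Scale d t))"
| Scale_times: "arr t m n \<Longrightarrow> diag_eq \<alpha> \<delta> m n (Scale (c * d) t) (Scale c (Scale d t))"
| Scale_one: "arr t m n \<Longrightarrow> diag_eq \<alpha> \<delta> m n (Scale 1 t) t"
| Comp_Add_left: "arr s n p \<Longrightarrow> arr s' n p \<Longrightarrow> arr t m n
    \<Longrightarrow> diag_eq \<alpha> \<delta> m p (Comp (Add s s') t) (Add (Comp s t) (Comp s' t))"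
| Comp_Add_right: "arr s n p \<Longrightarrow> arr t m n \<Longrightarrow> arr t' m n
    \<Longrightarrow> diag_eq \<alpha> \<delta> m p (Comp s (Add t t')) (Add (Comp s t) (Comp s t'))"
| Comp_Scale_left: "arr s n p \<Longrightarrow> arr t m n
    \<Longrightarrow> diag_eq \<alpha> \<delta> m p (Comp (Scale c s) t) (Scale c (Comp s t))"
| Comp_Scale_right: "arr s n p \<Longrightarrow> arr t m n
    \<Longrightarrow> diag_eq \<alpha> \<delta> m p (Comp s (Scale c t)) (Scale c (Comp s t))"
| Tens_Add_left: "arr s m n \<Longrightarrow> arr s' m n \<Longrightarrow> arr t p q
    \<Longrightarrow> diag_eq \<alpha> \<delta> (m + p) (n + q) (Tens (Add s s') t) (Add (Tens s t) (Tens s' t))"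
| Tens_Add_right: "arr s m n \<Longrightarrow> arr t p q \<Longrightarrow> arr t' p q
    \<Longrightarrow> diag_eq \<alpha> \<delta> (m + p) (n + q) (Tens s (Add t t')) (Add (Tens s t) (Tens s t'))"
| Tens_Scale_left: "arr s m n \<Longrightarrow> arr t p q
    \<Longrightarrow> diag_eq \<alpha> \<delta> (m + p) (n + q) (Tens (Scale c s) t) (Scale c (Tens s t))"
| Tens_Scale_right: "arr s m n \<Longrightarrow> arr t p q
    \<Longrightarrow> diag_eq \<alpha> \<delta> (m + p) (n + q) (Tens s (Scale c t)) (Scale c (Tens s t))"
| Tens_assoc: "arr s m n \<Longrightarrow> arr t p q \<Longrightarrow> arr u k l
    \<Longrightarrow> diag_eq \<alpha> \<delta> (m + p + k) (n + q + l) (Tens (Tens s t) u) (Tens s (Tens t u))"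
| Tens_unit_left: "arr t m n \<Longrightarrow> diag_eq \<alpha> \<delta> m n (Tens (Id 0) t) t"
| Tens_unit_right: "arr t m n \<Longrightarrow> diag_eq \<alpha> \<delta> m n (Tens t (Id 0)) t"
| Tens_Id: "diag_eq \<alpha> \<delta> (m + n) (m + n) (Tens (Id m) (Id n)) (Id (m + n))"
| interchange: "arr s n p \<Longrightarrow> arr t m n \<Longrightarrow> arr s' n' p' \<Longrightarrow> arr t' m' n'
    \<Longrightarrow> diag_eq \<alpha> \<delta> (m + m') (p + p')
          (Tens (Comp s t) (Comp s' t')) (Comp (Tens s s') (Tens t t'))"
| zigzag_left: "diag_eq \<alpha> \<delta> 1 1 (Comp (Tens Eps I1) (Tens I1 Eta)) I1"
| zigzag_right: "diag_eq \<alpha> \<delta> 1 1 (Comp (Tens I1 Eps) (Tens Eta I1)) I1"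
| Mu_Eta: "diag_eq \<alpha> \<delta> 1 2 (Comp (Tens I1 Mu) (Tens Eta I1)) (Comp (Tens Mu I1) (Tens I1 Eta))"
| Eps_Chi_slide: "diag_eq \<alpha> \<delta> 3 1
    (Comp (Tens I1 Eps) (Tens Chi I1)) (Comp (Tens Eps I1) (Tens I1 Chi))"
| Chi_Chi: "diag_eq \<alpha> \<delta> 2 2 (Comp Chi Chi) (Id 2)"
| braid: "diag_eq \<alpha> \<delta> 3 3
    (Comp (Tens Chi I1) (Comp (Tens I1 Chi) (Tens Chi I1)))
    (Comp (Tens I1 Chi) (Comp (Tens Chi I1) (Tens I1 Chi)))"
| Mu_Chi_slide: "diag_eq \<alpha> \<delta> 3 2
    (Comp (Tens I1 Mu) (Comp (Tens Chi I1) (Tens I1 Chi))) (Comp Chi (Tens Mu I1))"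
| Nu_Chi_slide: "diag_eq \<alpha> \<delta> 2 3
    (Comp (Tens I1 Chi) (Comp (Tens Chi I1) (Tens I1 Nu))) (Comp (Tens Nu I1) Chi)"
| Eps_Chi: "diag_eq \<alpha> \<delta> 2 0 (Comp Eps Chi) Eps"
| Mu_Chi: "diag_eq \<alpha> \<delta> 2 1 (Comp Mu Chi) Mu"
| Mu_Nu: "diag_eq \<alpha> \<delta> 1 1 (Comp Mu Nu) (Scale \<alpha> I1)"
| Eps_Eta: "diag_eq \<alpha> \<delta> 0 0 (Comp Eps Eta) (Scale \<delta> (Id 0))"
| Mu_Eta_zero: "diag_eq \<alpha> \<delta> 0 1 (Comp Mu Eta) (Zero 0 1)"

definition T_mor :: "'k::field_char_0 \<Rightarrow> 'k \<Rightarrow> nat \<Rightarrow> nat \<Rightarrow> 'k diag \<Rightarrow> 'k diag set" where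
  "T_mor \<alpha> \<delta> m n t = {s. diag_eq \<alpha> \<delta> m n s t}"

definition T_Hom :: "'k::field_char_0 \<Rightarrow> 'k \<Rightarrow> nat \<Rightarrow> nat \<Rightarrow> 'k diag set set" where
  "T_Hom \<alpha> \<delta> m n = {T_mor \<alpha> \<delta> m n t | t. arr t m n}"

lemma diag_eq_arr: "diag_eq \<alpha> \<delta> m n s t \<Longrightarrow> arr s m n \<and> arr t m n"
proof -
  have T: "arr s m n \<Longrightarrow> arr t p q \<Longrightarrow> k = m + p \<Longrightarrow> l = n + q \<Longrightarrow> arr (Tens s t) k l"
    for s t :: "'a diag" and m n p q k l
    using arr.intros(8) by blast
  have I: "arr (Tens I1 (t :: 'a diag)) (Suc m) (Suc n)" "arr (Tens t I1) (Suc m) (Suc n)"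
    if "arr t m n" for t m n
    by (rule T[OF arr.intros(1) that] T[OF that arr.intros(1)]; simp)+
  note g = arr.intros(1) arr.intros(2-5)[unfolded numeral_eq_Suc One_nat_def, simplified]
  have nu: "arr (Nu :: 'a diag) (Suc 0) (Suc (Suc 0))"
    unfolding Nu_def by (rule arr.intros(7)[OF I(1)[OF g(2)] I(2)[OF g(4)]])
  assume "diag_eq \<alpha> \<delta> m n s t"
  then show ?thesis
    by induction (auto simp: numeral_eq_Suc add.assoc
      intro: T arr.intros(6,7,9,10) g I[unfolded One_nat_def] nu)
qed

text \<open>
  Two Cayley-Dickson doublings of the complex numbers, each with
  \<open>(p, q) (r, s) = (p r - s\<^sup>* q, s p + q r\<^sup>*)\<close> and \<open>(p, q)\<^sup>* = (p\<^sup>*, - q)\<close>.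
\<close>

fun quat_mult :: "complex \<times> complex \<Rightarrow> complex \<times> complex \<Rightarrow> complex \<times> complex" where
  "quat_mult (p, q) (r, s) = (p * r - cnj s * q, s * p + q * cnj r)"

fun quat_cnj :: "complex \<times> complex \<Rightarrow> complex \<times> complex" where
  "quat_cnj (p, q) = (cnj p, - q)"

fun oct_pair_mult ::
  "(complex \<times> complex) \<times> (complex \<times> complex) \<Rightarrow> (complex \<times> complex) \<times> (complex \<times> complex)
    \<Rightarrow> (complex \<times> complex) \<times> (complex \<times> complex)" where
  "oct_pair_mult (p, q) (r, s) =
     (quat_mult p r - quat_mult (quat_cnj s) q, quat_mult s p + quat_mult q (quat_cnj r))"

fun oct_pair_cnj ::
  "(complex \<times> complex) \<times> (complex \<times> complex) \<Rightarrow> (complex \<times> complex) \<times> (complex \<times> complex)" where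
  "oct_pair_cnj (p, q) = (quat_cnj p, - q)"

typedef octonion = "UNIV :: ((complex \<times> complex) \<times> (complex \<times> complex)) set"
  by simp

setup_lifting type_definition_octonion

instantiation octonion :: real_normed_vector
begin
lift_definition zero_octonion :: octonion is 0 .
lift_definition plus_octonion :: "octonion \<Rightarrow> octonion \<Rightarrow> octonion" is "(+)" .
lift_definition minus_octonion :: "octonion \<Rightarrow> octonion \<Rightarrow> octonion" is "(-)" .
lift_definition uminus_octonion :: "octonion \<Rightarrow> octonion" is uminus .
lift_definition scaleR_octonion :: "real \<Rightarrow> octonion \<Rightarrow> octonion" is scaleR .
lift_definition norm_octonion :: "octonion \<Rightarrow> real" is norm .
definition sgn_octonion :: "octonion \<Rightarrow> octonion" where
  "sgn_octonion x = inverse (norm x) *\<^sub>R x"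
definition dist_octonion :: "octonion \<Rightarrow> octonion \<Rightarrow> real" where
  "dist_octonion x y = norm (x - y)"
definition uniformity_octonion :: "(octonion \<times> octonion) filter" where
  "uniformity_octonion = (INF e\<in>{0<..}. principal {(x, y). dist x y < e})"
definition open_octonion :: "octonion set \<Rightarrow> bool" where
  "open_octonion U \<longleftrightarrow> (\<forall>x\<in>U. eventually (\<lambda>(x', y). x' = x \<longrightarrow> y \<in> U) uniformity)"
instance
proof
  fix x y z :: octonion and a b :: real
  show "x + y + z = x + (y + z)" "x + y = y + x" "0 + x = x" "- x + x = 0" "x - y = x + - y"
    by (transfer; simp)+
  show "a *\<^sub>R (x + y) = a *\<^sub>R x + a *\<^sub>R y" "(a + b) *\<^sub>R x = a *\<^sub>R x + b *\<^sub>R x"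
    "a *\<^sub>R b *\<^sub>R x = (a * b) *\<^sub>R x" "1 *\<^sub>R x = x"
    by (transfer; simp add: scaleR_add_right scaleR_add_left)+
  show "norm x = 0 \<longleftrightarrow> x = 0" "norm (x + y) \<le> norm x + norm y"
    "norm (a *\<^sub>R x) = \<bar>a\<bar> * norm x"
    by (transfer; simp add: norm_triangle_ineq)+
qed (simp_all add: sgn_octonion_def dist_octonion_def uniformity_octonion_def open_octonion_def)
end

instantiation octonion :: "{one, times}"
begin
lift_definition one_octonion :: octonion is "((1, 0), (0, 0))" .
lift_definition times_octonion :: "octonion \<Rightarrow> octonion \<Rightarrow> octonion" is oct_pair_mult .
instance ..
end

lift_definition ocnj :: "octonion \<Rightarrow> octonion" is oct_pair_cnj .

lift_definition oRe :: "octonion \<Rightarrow> real" is "\<lambda>x. Re (fst (fst x))" .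

lemma octonion_distrib:
  "(x + y) * z = x * z + y * z" "z * (x + y) = z * x + z * y" for x y z :: octonion
  by (transfer; auto simp: algebra_simps)+

lemma octonion_norm_mult: "norm (x * y) = norm x * norm y" for x y :: octonion
proof (transfer, goal_cases)
  case (1 x y)
  obtain a b c d where x: "x = ((a, b), (c, d))" by (metis prod.exhaust)
  obtain p q r s where y: "y = ((p, q), (r, s))" by (metis prod.exhaust)
  have "(norm (oct_pair_mult x y))\<^sup>2 = (norm x)\<^sup>2 * (norm y)\<^sup>2"
    unfolding x y by (simp add: norm_Pair cmod_power2) (simp add: power2_eq_square algebra_simps)
  then show ?case
    by (metis mult_nonneg_nonneg norm_ge_zero power2_eq_imp_eq power_mult_distrib)
qed

lemma ocnj_mult: "ocnj (x * y) = ocnj y * ocnj x"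
  by (transfer; auto simp: algebra_simps)

lemma ocnj_linear [simp]:
  "ocnj (x + y) = ocnj x + ocnj y" "ocnj (x - y) = ocnj x - ocnj y" "ocnj (- x) = - ocnj x"
  "ocnj (c *\<^sub>R x) = c *\<^sub>R ocnj x" "ocnj 0 = 0" "ocnj 1 = 1" "ocnj (ocnj x) = x"
proof -
  have q: "quat_cnj p = (cnj (fst p), - snd p)" for p by (cases p) simp
  have c: "oct_pair_cnj p = (quat_cnj (fst p), - snd p)" for p by (cases p) simp
  note rep = Rep_octonion_inject[symmetric] ocnj.rep_eq zero_octonion.rep_eq one_octonion.rep_eq
    plus_octonion.rep_eq minus_octonion.rep_eq uminus_octonion.rep_eq scaleR_octonion.rep_eq c q
  show "ocnj (x + y) = ocnj x + ocnj y" "ocnj (x - y) = ocnj x - ocnj y" "ocnj (- x) = - ocnj x"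
    "ocnj (c *\<^sub>R x) = c *\<^sub>R ocnj x" "ocnj 0 = 0" "ocnj 1 = 1" "ocnj (ocnj x) = x"
    by (simp_all add: rep prod_eq_iff)
qed

lemma ocnj_sum: "ocnj (sum f S) = (\<Sum>i\<in>S. ocnj (f i))"
  by (induction S rule: infinite_finite_induct) auto

definition omat_mult :: "octonion^3^3 \<Rightarrow> octonion^3^3 \<Rightarrow> octonion^3^3" where
  "omat_mult a b = (\<chi> i j. \<Sum>k\<in>UNIV. a $ i $ k * b $ k $ j)"

definition omat_adjoint :: "octonion^3^3 \<Rightarrow> octonion^3^3" where
  "omat_adjoint a = (\<chi> i j. ocnj (a $ j $ i))"

lemma omat_adjoint_linear [simp]:
  "omat_adjoint 0 = 0" "omat_adjoint (a + b) = omat_adjoint a + omat_adjoint b"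
  "omat_adjoint (a - b) = omat_adjoint a - omat_adjoint b"
  "omat_adjoint (- a) = - omat_adjoint a" "omat_adjoint (c *\<^sub>R a) = c *\<^sub>R omat_adjoint a"
  by (simp_all add: omat_adjoint_def vec_eq_iff)

lemma omat_adjoint_mult: "omat_adjoint (omat_mult a b) = omat_mult (omat_adjoint b) (omat_adjoint a)"
  by (simp add: omat_adjoint_def omat_mult_def vec_eq_iff ocnj_sum ocnj_mult)

typedef albert = "{a :: octonion^3^3. omat_adjoint a = a}"
  by (rule exI[of _ 0]) simp

setup_lifting type_definition_albert

instantiation albert :: real_normed_vector
begin
lift_definition zero_albert :: albert is 0 by simp
lift_definition plus_albert :: "albert \<Rightarrow> albert \<Rightarrow> albert" is "(+)" by simp
lift_definition minus_albert :: "albert \<Rightarrow> albert \<Rightarrow> albert" is "(-)" by simp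
lift_definition uminus_albert :: "albert \<Rightarrow> albert" is uminus by simp
lift_definition scaleR_albert :: "real \<Rightarrow> albert \<Rightarrow> albert" is scaleR by simp
lift_definition norm_albert :: "albert \<Rightarrow> real" is norm .
definition sgn_albert :: "albert \<Rightarrow> albert" where
  "sgn_albert x = inverse (norm x) *\<^sub>R x"
definition dist_albert :: "albert \<Rightarrow> albert \<Rightarrow> real" where
  "dist_albert x y = norm (x - y)"
definition uniformity_albert :: "(albert \<times> albert) filter" where
  "uniformity_albert = (INF e\<in>{0<..}. principal {(x, y). dist x y < e})"
definition open_albert :: "albert set \<Rightarrow> bool" where
  "open_albert U \<longleftrightarrow> (\<forall>x\<in>U. eventually (\<lambda>(x', y). x' = x \<longrightarrow> y \<in> U) uniformity)"
instance
proof
  fix x y z :: albert and a b :: real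
  note rep = Rep_albert_inject[symmetric] zero_albert.rep_eq plus_albert.rep_eq
    minus_albert.rep_eq uminus_albert.rep_eq scaleR_albert.rep_eq norm_albert.rep_eq
  show "x + y + z = x + (y + z)" "x + y = y + x" "0 + x = x" "- x + x = 0" "x - y = x + - y"
    by (simp_all only: rep) (simp_all add: algebra_simps)
  show "a *\<^sub>R (x + y) = a *\<^sub>R x + a *\<^sub>R y" "(a + b) *\<^sub>R x = a *\<^sub>R x + b *\<^sub>R x"
    "a *\<^sub>R b *\<^sub>R x = (a * b) *\<^sub>R x" "1 *\<^sub>R x = x"
    by (simp_all only: rep) (simp_all add: scaleR_add_right scaleR_add_left)
  show "norm x = 0 \<longleftrightarrow> x = 0" "norm (x + y) \<le> norm x + norm y"
    "norm (a *\<^sub>R x) = \<bar>a\<bar> * norm x"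
    by (simp_all only: rep) (simp_all add: norm_triangle_ineq)
qed (simp_all add: sgn_albert_def dist_albert_def uniformity_albert_def open_albert_def)
end

instantiation albert :: one
begin
lift_definition one_albert :: albert is "\<chi> i j. if i = j then 1 else 0"
  by (simp add: omat_adjoint_def vec_eq_iff)
instance ..
end

lift_definition jordan :: "albert \<Rightarrow> albert \<Rightarrow> albert" (infixl "\<circ>\<^sub>J" 70) is
  "\<lambda>a b. (1 / 2) *\<^sub>R (omat_mult a b + omat_mult b a)"
  by (simp add: omat_adjoint_mult add.commute)

lift_definition tr :: "albert \<Rightarrow> real" is "\<lambda>a. \<Sum>i\<in>UNIV. oRe (a $ i $ i)" .

definition V_R :: "albert set" where
  "V_R = {a. tr a = 0}"

definition proj :: "albert \<Rightarrow> albert" where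
  "proj a = a - (1 / 3 * tr a) *\<^sub>R 1"

definition G :: "(albert \<Rightarrow> albert) set" where
  "G = {f. linear f \<and> bij f \<and> (\<forall>a b. f (a \<circ>\<^sub>J b) = f a \<circ>\<^sub>J f b)}"

definition exp_end :: "(albert \<Rightarrow> albert) \<Rightarrow> albert \<Rightarrow> albert" where
  "exp_end D a = (\<Sum>n. (D ^^ n) a /\<^sub>R fact n)"

text \<open>The Lie algebra of the closed linear group \<open>G\<close>: generators of its one-parameter subgroups.\<close>

definition Lie_G :: "(albert \<Rightarrow> albert) set" where
  "Lie_G = {D. linear D \<and> (\<forall>t::real. exp_end (\<lambda>a. t *\<^sub>R D a) \<in> G)}"

text \<open>\<open>Cx x y\<close> is \<open>1 \<otimes> x + \<i> \<otimes> y\<close> in \<open>\<complex> \<otimes>\<^sub>\<real> W\<close>.\<close>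

datatype 'a complexification = Cx (cxRe: 'a) (cxIm: 'a)

instantiation complexification :: (ab_group_add) ab_group_add
begin
definition zero_complexification :: "'a complexification" where
  "0 = Cx 0 0"
definition plus_complexification ::
    "'a complexification \<Rightarrow> 'a complexification \<Rightarrow> 'a complexification" where
  "u + v = Cx (cxRe u + cxRe v) (cxIm u + cxIm v)"
definition minus_complexification ::
    "'a complexification \<Rightarrow> 'a complexification \<Rightarrow> 'a complexification" where
  "u - v = Cx (cxRe u - cxRe v) (cxIm u - cxIm v)"
definition uminus_complexification :: "'a complexification \<Rightarrow> 'a complexification" where
  "- u = Cx (- cxRe u) (- cxIm u)"
instance
  by standard (auto simp: zero_complexification_def plus_complexification_def
      minus_complexification_def uminus_complexification_def algebra_simps
      intro: complexification.expand)
end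

definition scaleC :: "complex \<Rightarrow> 'a::real_vector complexification \<Rightarrow> 'a complexification" where
  "scaleC c u = Cx (Re c *\<^sub>R cxRe u - Im c *\<^sub>R cxIm u) (Re c *\<^sub>R cxIm u + Im c *\<^sub>R cxRe u)"

interpretation cx: vector_space "scaleC :: complex \<Rightarrow> 'a::real_vector complexification \<Rightarrow> _"
  by standard (auto simp: scaleC_def plus_complexification_def algebra_simps
      intro: complexification.expand)

definition cx_set :: "'a set \<Rightarrow> 'a complexification set" where
  "cx_set S = {Cx x y | x y. x \<in> S \<and> y \<in> S}"

abbreviation cx_of :: "'a::zero \<Rightarrow> 'a complexification" where
  "cx_of x \<equiv> Cx x 0"

text \<open>The \<open>\<complex>\<close>-bilinear extension of an \<open>\<real>\<close>-bilinear map.\<close>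

definition cx_bilin :: "('a \<Rightarrow> 'b \<Rightarrow> 'c::ab_group_add)
    \<Rightarrow> 'a complexification \<Rightarrow> 'b complexification \<Rightarrow> 'c complexification" where
  "cx_bilin f u v = Cx (f (cxRe u) (cxRe v) - f (cxIm u) (cxIm v))
                       (f (cxRe u) (cxIm v) + f (cxIm u) (cxRe v))"

definition V :: "albert complexification set" where
  "V = cx_set V_R"

definition jordanC ::
    "albert complexification \<Rightarrow> albert complexification \<Rightarrow> albert complexification" where
  "jordanC = cx_bilin (\<circ>\<^sub>J)"

definition trC :: "albert complexification \<Rightarrow> complex" where
  "trC u = Complex (tr (cxRe u)) (tr (cxIm u))"

definition projC :: "albert complexification \<Rightarrow> albert complexification" where
  "projC u = Cx (proj (cxRe u)) (proj (cxIm u))"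

text \<open>
  The Lie algebra \<open>\<g> = \<complex> \<otimes>\<^sub>\<real> Lie(G)\<close> and its action on \<open>\<complex> \<otimes>\<^sub>\<real> A\<close>; the module \<open>V\<close> is the restriction
  of this action.
\<close>

definition \<g> :: "(albert \<Rightarrow> albert) complexification set" where
  "\<g> = cx_set Lie_G"

definition g_act :: "(albert \<Rightarrow> albert) complexification
    \<Rightarrow> albert complexification \<Rightarrow> albert complexification" where
  "g_act = cx_bilin (\<lambda>D a. D a)"

text \<open>
  With \<open>A\<^sub>\<complex> = \<complex> \<otimes>\<^sub>\<real> A\<close>, an element of the \<open>n\<close>-th tensor power of \<open>A\<^sub>\<complex>\<close> is represented by the
  multilinear form it induces on \<open>n\<close>-tuples of linear functionals on \<open>A\<^sub>\<complex>\<close>: the tensor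
  \<open>v\<^sub>1 \<otimes> \<dots> \<otimes> v\<^sub>n\<close> is \<open>(\<phi>\<^sub>1, \<dots>, \<phi>\<^sub>n) \<mapsto> \<phi>\<^sub>1(v\<^sub>1) \<dots> \<phi>\<^sub>n(v\<^sub>n)\<close>. The value is \<open>0\<close> on lists of any
  other length and on lists with an entry that is not linear. The \<open>n\<close>-th tensor power of \<open>V\<close> is the
  span of the tensors \<open>v\<^sub>1 \<otimes> \<dots> \<otimes> v\<^sub>n\<close> with all \<open>v\<^sub>i\<close> in \<open>V\<close>. Tensor powers with \<open>n = 0\<close> and \<open>n = 1\<close>
  are copies of \<open>\<complex>\<close> and \<open>V\<close>, via \<open>c \<mapsto> c \<sqdot> pure []\<close> and \<open>v \<mapsto> pure [v]\<close>, and the canonical isomorphism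
  of the tensor product of the \<open>m\<close>-th and \<open>n\<close>-th powers with the \<open>(m + n)\<close>-th is the identity.
\<close>

type_synonym functional = "albert complexification \<Rightarrow> complex"
type_synonym tensor = "functional list \<Rightarrow> complex"

definition functionals :: "functional list \<Rightarrow> bool" where
  "functionals \<phi>s \<longleftrightarrow> (\<forall>\<phi>\<in>set \<phi>s. Vector_Spaces.linear scaleC (*) \<phi>)"

definition tscale :: "complex \<Rightarrow> tensor \<Rightarrow> tensor" where
  "tscale c x = (\<lambda>\<phi>s. c * x \<phi>s)"

interpretation tens: vector_space tscale
  by standard (auto simp: tscale_def algebra_simps)

definition pure :: "albert complexification list \<Rightarrow> tensor" where
  "pure vs = (\<lambda>\<phi>s. if length \<phi>s = length vs \<and> functionals \<phi>s
                   then \<Prod>i<length vs. (\<phi>s ! i) (vs ! i) else 0)"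

definition Vpow :: "nat \<Rightarrow> tensor set" where
  "Vpow n = tens.span {pure vs | vs. length vs = n \<and> set vs \<subseteq> V}"

text \<open>
  The product of the tensor algebra: for \<open>x\<close> of degree \<open>m\<close> and \<open>y\<close> of degree \<open>n\<close> only the
  summand \<open>k = m\<close> can be nonzero, and only on lists of length \<open>m + n\<close>.
\<close>

definition tens_mult :: "tensor \<Rightarrow> tensor \<Rightarrow> tensor" (infixr "\<otimes>\<^sub>T" 75) where
  "x \<otimes>\<^sub>T y = (\<lambda>\<phi>s. \<Sum>k\<le>length \<phi>s. x (take k \<phi>s) * y (drop k \<phi>s))"

lemma pure_append: "pure us \<otimes>\<^sub>T pure vs = pure (us @ vs)"
proof
  fix \<phi>s
  have fn: "functionals \<phi>s \<longleftrightarrow> functionals (take k \<phi>s) \<and> functionals (drop k \<phi>s)" for k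
    by (metis append_take_drop_id functionals_def set_append Un_iff)
  show "(pure us \<otimes>\<^sub>T pure vs) \<phi>s = pure (us @ vs) \<phi>s"
  proof (cases "length \<phi>s = length us + length vs")
    case False
    then show ?thesis
      by (auto simp: tens_mult_def pure_def intro!: sum.neutral)
  next
    case True
    have "(pure us \<otimes>\<^sub>T pure vs) \<phi>s
        = (\<Sum>k\<in>{length us}. pure us (take k \<phi>s) * pure vs (drop k \<phi>s))"
      unfolding tens_mult_def using True
      by (intro sum.mono_neutral_right) (auto simp: pure_def)
    also have "\<dots> = pure (us @ vs) \<phi>s"
      using True fn[of "length us"]
      by (auto simp: pure_def prod.nat_group nth_append atLeast0LessThan[symmetric]
          prod.atLeastLessThan_concat[of 0 "length us" "length us + length vs", symmetric]
          prod.atLeastLessThan_shift_0[of _ "length us" "length us + length vs"] add.commute)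
    finally show ?thesis .
  qed
qed

text \<open>
  The action \<open>X (v\<^sub>1 \<otimes> \<dots> \<otimes> v\<^sub>n) = \<Sum>\<^sub>i v\<^sub>1 \<otimes> \<dots> \<otimes> X v\<^sub>i \<otimes> \<dots> \<otimes> v\<^sub>n\<close>, transposed to the
  functionals; see \<open>tens_act_pure\<close>.
\<close>

definition tens_act :: "(albert \<Rightarrow> albert) complexification \<Rightarrow> tensor \<Rightarrow> tensor" where
  "tens_act X x = (\<lambda>\<phi>s. if functionals \<phi>s
                        then \<Sum>i<length \<phi>s. x (\<phi>s[i := (\<phi>s ! i) \<circ> g_act X]) else 0)"

lemma g_act_linear:
  assumes "X \<in> \<g>"
  shows "Vector_Spaces.linear scaleC scaleC (g_act X)"
proof -
  obtain D E where X: "X = Cx D E" and "linear D" "linear E"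
    using assms by (auto simp: \<g>_def cx_set_def Lie_G_def)
  then interpret D: linear D + E: linear E by simp_all
  show ?thesis
    by (intro Vector_Spaces.linear.intro module_hom.intro module_hom_axioms.intro)
      (auto simp: X g_act_def cx_bilin_def scaleC_def plus_complexification_def
        D.add E.add D.diff E.diff D.scaleR E.scaleR algebra_simps
        intro: cx.vector_space_axioms cx.module_axioms)
qed

lemma tens_act_pure:
  assumes "X \<in> \<g>"
  shows "tens_act X (pure vs) = (\<Sum>i<length vs. pure (vs[i := g_act X (vs ! i)]))"
proof
  fix \<phi>s
  have lin: "functionals (\<phi>s[i := \<phi>s ! i \<circ> g_act X])" if "functionals \<phi>s" "i < length \<phi>s" for i
  proof -
    have "Vector_Spaces.linear scaleC (*) (\<phi>s ! i)"
      using that by (auto simp: functionals_def)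
    then have "Vector_Spaces.linear scaleC (*) (\<phi>s ! i \<circ> g_act X)"
      by (rule Vector_Spaces.linear_compose[OF g_act_linear[OF assms]])
    then show ?thesis
      using that set_update_subset_insert by (fastforce simp: functionals_def)
  qed
  have sum_app: "(\<Sum>i<n. f i) \<phi>s = (\<Sum>i<n. f i \<phi>s)" for n and f :: "nat \<Rightarrow> tensor"
    by (induction n) auto
  show "tens_act X (pure vs) \<phi>s = (\<Sum>i<length vs. pure (vs[i := g_act X (vs ! i)])) \<phi>s"
    unfolding sum_app using lin
    by (cases "length \<phi>s = length vs")
      (auto simp: tens_act_def pure_def nth_list_update intro!: sum.cong prod.cong sum.neutral)
qed

text \<open>
  Morphisms of \<open>\<g>\<close>-modules between submodules \<open>M\<close>, \<open>N\<close> of the tensor algebra, represented by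
  functions that are \<open>0\<close> outside \<open>M\<close> so that equal morphisms are equal functions.
\<close>

definition g_Hom :: "tensor set \<Rightarrow> tensor set \<Rightarrow> (tensor \<Rightarrow> tensor) set" where
  "g_Hom M N = {f. (\<forall>x\<in>M. f x \<in> N) \<and> (\<forall>x. x \<notin> M \<longrightarrow> f x = 0)
     \<and> (\<forall>x\<in>M. \<forall>y\<in>M. f (x + y) = f x + f y)
     \<and> (\<forall>c. \<forall>x\<in>M. f (tscale c x) = tscale c (f x))
     \<and> (\<forall>X\<in>\<g>. \<forall>x\<in>M. f (tens_act X x) = tens_act X (f x))}"

text \<open>
  \<open>\<complex>\<close>-linear strict monoidal functors sending \<open>I\<close> to \<open>V\<close>, hence the object \<open>n\<close> to \<open>Vpow n\<close>;
  \<open>\<Phi> m n\<close> is the map on morphisms from \<open>m\<close> to \<open>n\<close>.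
\<close>

definition monoidal_functor ::
    "complex \<Rightarrow> complex \<Rightarrow> (nat \<Rightarrow> nat \<Rightarrow> complex diag set \<Rightarrow> tensor \<Rightarrow> tensor) \<Rightarrow> bool" where
  "monoidal_functor \<alpha> \<delta> \<Phi> \<longleftrightarrow>
     (\<forall>m n. \<forall>f\<in>T_Hom \<alpha> \<delta> m n. \<Phi> m n f \<in> g_Hom (Vpow m) (Vpow n))
   \<and> (\<forall>n. \<forall>x\<in>Vpow n. \<Phi> n n (T_mor \<alpha> \<delta> n n (Id n)) x = x)
   \<and> (\<forall>m n p s t. arr s n p \<longrightarrow> arr t m n \<longrightarrow> (\<forall>x\<in>Vpow m.
        \<Phi> m p (T_mor \<alpha> \<delta> m p (Comp s t)) x
          = \<Phi> n p (T_mor \<alpha> \<delta> n p s) (\<Phi> m n (T_mor \<alpha> \<delta> m n t) x)))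
   \<and> (\<forall>m n s t. arr s m n \<longrightarrow> arr t m n \<longrightarrow> (\<forall>x\<in>Vpow m.
        \<Phi> m n (T_mor \<alpha> \<delta> m n (Add s t)) x
          = \<Phi> m n (T_mor \<alpha> \<delta> m n s) x + \<Phi> m n (T_mor \<alpha> \<delta> m n t) x))
   \<and> (\<forall>m n c t. arr t m n \<longrightarrow> (\<forall>x\<in>Vpow m.
        \<Phi> m n (T_mor \<alpha> \<delta> m n (Scale c t)) x = tscale c (\<Phi> m n (T_mor \<alpha> \<delta> m n t) x)))
   \<and> (\<forall>m n p q s t. arr s m n \<longrightarrow> arr t p q \<longrightarrow> (\<forall>x\<in>Vpow m. \<forall>y\<in>Vpow p.
        \<Phi> (m + p) (n + q) (T_mor \<alpha> \<delta> (m + p) (n + q) (Tens s t)) (x \<otimes>\<^sub>T y)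
          = \<Phi> m n (T_mor \<alpha> \<delta> m n s) x \<otimes>\<^sub>T \<Phi> p q (T_mor \<alpha> \<delta> p q t) y))"

definition full_functor ::
    "complex \<Rightarrow> complex \<Rightarrow> (nat \<Rightarrow> nat \<Rightarrow> complex diag set \<Rightarrow> tensor \<Rightarrow> tensor) \<Rightarrow> bool" where
  "full_functor \<alpha> \<delta> \<Phi> \<longleftrightarrow>
     (\<forall>m n. \<forall>h\<in>g_Hom (Vpow m) (Vpow n). \<exists>f\<in>T_Hom \<alpha> \<delta> m n. \<Phi> m n f = h)"

end

theory Submission
  imports Defs
begin

text \<open>
  Bending identifies the homomorphisms between tensor powers with invariant arrays, and diagrams bend
  as well, so it suffices to realise every \<open>\<g>\<close>-invariant array of order \<open>N\<close> by a diagram from \<open>0\<close>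
  to \<open>N\<close>. The arrays of diagrams are closed under tensor products, contractions and permutations,
  and include the metric and the cubic form \<open>tr ((a \<circ> b) \<circ> c)\<close>.

  Invariance under \<open>\<g>\<close> gives invariance under the stabiliser of metric and cubic form, the group of
  trace-preserving automorphisms: its rotations and octonion reflections lie on one-parameter groups
  and generate it, since they diagonalise the image of \<open>diag(0, 1, 2)\<close> and then move the off-diagonal
  imaginary units back into place.

  Suppose an invariant array \<open>f\<close> is not in the family, and separate it by some \<open>g\<close> orthogonal to the
  family. Up to powers of the determinant, \<open>f\<close> transformed by the transposed inverse of a matrix \<open>M\<close>
  depends only on the Gram matrix of \<open>M\<close> and the transformed cubic form, hence is a limit of
  polynomials in these by Stone--Weierstrass. Integrating such a polynomial against \<open>g\<close> transformed by
  \<open>M\<close> over the unit ball pairs \<open>g\<close> with contractions of arrays in the family and gives \<open>0\<close>; for \<open>f\<close>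
  itself it gives a nonzero multiple of the pairing of \<open>g\<close> with \<open>f\<close>.
\<close>

section \<open>Contractions and orthogonal invariants\<close>

text \<open>Averaging over the compact group would call for its Haar measure. Lebesgue measure on
  the space of all square matrices takes its place: left multiplication by an orthogonal matrix
  preserves the Gram matrix, and the transformed cubic form tells which of these multiplications fix
  the cubic form, so the two data together separate the orbits of the stabiliser on invertible
  matrices. Singular matrices are the obstacle, since there equal data need not come from the
  stabiliser; a positive power of the determinant makes the function vanish on them. The weight is a
  truncated power of \<open>1 - M \<bullet> M\<close> and not a Gaussian: uniform approximation on a
  cube then controls the whole integral, and integration by parts still reduces every moment to
  Kronecker deltas. On the Lie algebra side neither the dimension nor the full structure of
  \<open>Lie_G\<close> is determined. It is enough to exhibit elements of it, because only the
  conditions that they impose on invariant arrays are used.\<close>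

lemma integral_unit_support:
  fixes h :: "'a::euclidean_space \<Rightarrow> real"
  assumes "\<And>x. 1 < norm x \<Longrightarrow> h x = 0" "cball 0 1 \<subseteq> S"
  shows "integral S h = integral UNIV h"
proof -
  have "(\<lambda>x. if x \<in> S then h x else 0) = h"
    using assms by (force simp: dist_norm)
  then show ?thesis
    using integral_restrict_UNIV[of S h] by simp
qed

lemma cball_subset_cbox_One: "cball 0 1 \<subseteq> cbox (- One) (One :: 'a::euclidean_space)"
proof
  fix x :: 'a assume "x \<in> cball 0 1"
  then have "\<bar>x \<bullet> i\<bar> \<le> 1" if "i \<in> Basis" for i
    using Basis_le_norm[OF that, of x] by simp
  then show "x \<in> cbox (- One) One"
    by (force simp: mem_box abs_le_iff)
qed

text \<open>Translating \<open>h\<close> by \<open>s\<close> times \<open>v\<close> with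
  \<open>s\<close> between -1 and 1 keeps its support inside one fixed box, so the integral over
  that box does not depend on \<open>s\<close>; differentiating under the integral sign at
  \<open>s = 0\<close> gives the claim.\<close>

lemma integral_directional_derivative_0:
  fixes h h' :: "'a::euclidean_space \<Rightarrow> real"
  assumes der: "\<And>x. ((\<lambda>s. h (x + s *\<^sub>R v)) has_real_derivative h' x) (at 0)"
    and cont: "continuous_on UNIV h" "continuous_on UNIV h'"
    and supp: "\<And>x. 1 < norm x \<Longrightarrow> h x = 0" "\<And>x. 1 < norm x \<Longrightarrow> h' x = 0"
  shows "integral UNIV h' = 0"
proof -
  \<comment> \<open>This half-width leaves room for the unit ball after any shift by a vector of
    norm at most \<open>norm v\<close>.\<close>
  define c where "c = 1 + norm v"
  define K where "K = cbox (- (c *\<^sub>R One)) (c *\<^sub>R One :: 'a)"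
  have sub: "cball 0 1 \<subseteq> cbox (w - c *\<^sub>R One) (w + c *\<^sub>R One)" if "norm w \<le> norm v" for w :: 'a
  proof
    fix x :: 'a assume "x \<in> cball 0 1"
    then have "norm (x - w) \<le> c"
      using that norm_triangle_ineq4[of x w] by (simp add: c_def)
    then have "\<bar>(x - w) \<bullet> i\<bar> \<le> c" if "i \<in> Basis" for i
      using Basis_le_norm[OF that] order_trans by blast
    then show "x \<in> cbox (w - c *\<^sub>R One) (w + c *\<^sub>R One)"
      by (force simp: mem_box algebra_simps abs_le_iff)
  qed
  have ders: "((\<lambda>s. h (x + s *\<^sub>R v)) has_real_derivative h' (x + t *\<^sub>R v)) (at t)" for x t
    using der[of "x + t *\<^sub>R v"] DERIV_shift[of "\<lambda>s. h (x + s *\<^sub>R v)" _ 0 t]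
    by (simp add: algebra_simps)
  have int: "integral K (\<lambda>x. h (x + s *\<^sub>R v)) = integral UNIV h"
    and intg: "(\<lambda>x. h (x + s *\<^sub>R v)) integrable_on K" if "s \<in> {-1..1}" for s
  proof -
    have "integral K (h \<circ> (+) (s *\<^sub>R v)) = integral (cbox (- (c *\<^sub>R One) + s *\<^sub>R v) (c *\<^sub>R One + s *\<^sub>R v)) h"
      unfolding K_def by (rule integral_shift_cbox_plus)
    also have "\<dots> = integral UNIV h"
      using sub[of "s *\<^sub>R v"] that supp
      by (intro integral_unit_support) (auto simp: add.commute abs_le_iff mult_left_le_one_le)
    finally show "integral K (\<lambda>x. h (x + s *\<^sub>R v)) = integral UNIV h"
      by (simp add: o_def add.commute)
    show "(\<lambda>x. h (x + s *\<^sub>R v)) integrable_on K"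
      unfolding K_def by (intro integrable_continuous continuous_on_compose2[OF cont(1)] continuous_intros) auto
  qed
  have "((\<lambda>s. integral K (\<lambda>x. h (x + s *\<^sub>R v))) has_field_derivative integral K (\<lambda>x. h' (x + 0 *\<^sub>R v)))
      (at 0 within {-1..1})"
    unfolding K_def
  proof (rule leibniz_rule_field_derivative)
    show "continuous_on ({-1..1} \<times> cbox (- (c *\<^sub>R One)) (c *\<^sub>R One)) (\<lambda>(s, x). h' (x + s *\<^sub>R v))"
      by (auto simp: split_def intro!: continuous_intros continuous_on_compose2[OF cont(2)])
  qed (use intg ders in \<open>auto simp: K_def intro: has_field_derivative_at_within\<close>)
  moreover have "((\<lambda>s. integral K (\<lambda>x. h (x + s *\<^sub>R v))) has_field_derivative 0) (at 0 within {-1..1})"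
    by (rule has_field_derivative_transform_within[of "\<lambda>_. integral UNIV h" _ _ _ 1])
      (auto simp: int)
  moreover have "at (0::real) within {-1..1} = at 0"
    by (rule at_within_interior) auto
  ultimately have "integral K (\<lambda>x. h' (x + 0 *\<^sub>R v)) = 0"
    using DERIV_unique by fastforce
  moreover have "cball 0 1 \<subseteq> K"
    using sub[of 0] by (simp add: K_def)
  ultimately show ?thesis
    using integral_unit_support[of h' K] supp by simp
qed

text \<open>The truncated power vanishes outside the unit ball, and its directional derivative is
  the next lower power times a linear function, so integration by parts stays within these
  weights.\<close>

definition moment :: "nat \<Rightarrow> 'a::euclidean_space list \<Rightarrow> real" where
  "moment k bs = integral UNIV (\<lambda>x. prod_list (map ((\<bullet>) x) bs) * max 0 (1 - x \<bullet> x) ^ k)"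

text \<open>Only the point 0 needs an argument: the difference quotient there is bounded by the
  power \<open>k\<close> of the absolute value, which tends to 0 as \<open>k\<close> is
  positive.\<close>

lemma DERIV_max_0_power:
  fixes f :: "real \<Rightarrow> real"
  assumes "(f has_real_derivative f') (at s)" "k \<ge> 1"
  shows "((\<lambda>s. max 0 (f s) ^ Suc k) has_real_derivative (Suc k * max 0 (f s) ^ k * f')) (at s)"
proof -
  have "((\<lambda>y::real. max 0 y ^ Suc k) has_real_derivative (Suc k * max 0 y ^ k)) (at y)" for y :: real
  proof (cases y "0::real" rule: linorder_cases)
    case less
    have "((\<lambda>y::real. 0) has_real_derivative (Suc k * max 0 y ^ k)) (at y)"
      using less assms(2) by (simp add: max_def power_0_left)
    then show ?thesis
      by (rule DERIV_cong_ev[THEN iffD1, rotated -1])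
        (use less eventually_nhds_in_open[of "{..<0}" y] in \<open>auto elim!: eventually_mono\<close>)
  next
    case greater
    have "((\<lambda>y::real. y ^ Suc k) has_real_derivative (Suc k * max 0 y ^ k)) (at y)"
      by (rule derivative_eq_intros HOL.refl | use greater in simp)+
    then show ?thesis
      by (rule DERIV_cong_ev[THEN iffD1, rotated -1])
        (use greater eventually_nhds_in_open[of "{0<..}" y] in \<open>auto elim!: eventually_mono\<close>)
  next
    case equal
    have "((\<lambda>y::real. max 0 y ^ Suc k / y) \<longlongrightarrow> 0) (at 0)"
    proof (rule tendsto_rabs_zero_cancel[OF Lim_null_comparison])
      show "\<forall>\<^sub>F y in at 0. norm \<bar>max 0 y ^ Suc k / y\<bar> \<le> \<bar>y\<bar> ^ k"
        by (intro always_eventually) (auto simp: max_def power_abs abs_mult)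
      show "((\<lambda>y::real. \<bar>y\<bar> ^ k) \<longlongrightarrow> 0) (at 0)"
        using assms(2) by (intro tendsto_eq_intros) auto
    qed
    then show ?thesis
      using equal assms(2) by (simp add: has_field_derivative_iff power_0_left)
  qed
  from DERIV_chain2[OF this assms(1)] show ?thesis by simp
qed

abbreviation delete_nth :: "nat \<Rightarrow> 'a list \<Rightarrow> 'a list" where
  "delete_nth i xs \<equiv> take i xs @ drop (Suc i) xs"

lemma DERIV_prod_list_inner:
  "((\<lambda>s. prod_list (map ((\<bullet>) (x + s *\<^sub>R v)) bs)) has_real_derivative
     (\<Sum>i<length bs. (v \<bullet> bs ! i) * prod_list (map ((\<bullet>) x) (delete_nth i bs)))) (at 0)"
proof (induction bs)
  case (Cons b bs)
  have "((\<lambda>s. (x + s *\<^sub>R v) \<bullet> b) has_real_derivative v \<bullet> b) (at 0)"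
    by (simp add: inner_add_left) (rule derivative_eq_intros HOL.refl | simp)+
  from DERIV_mult[OF this Cons.IH] show ?case
    by (simp add: sum.lessThan_Suc_shift sum_distrib_left sum_distrib_right algebra_simps del: sum.lessThan_Suc)
qed auto

lemma continuous_on_prod_list_inner [continuous_intros]:
  "continuous_on S (\<lambda>x. prod_list (map ((\<bullet>) x) bs))"
  by (induction bs) (auto intro!: continuous_intros)

lemma weight_integrable:
  fixes f :: "'a::euclidean_space \<Rightarrow> real"
  assumes "continuous_on UNIV f" "k \<ge> 1"
  shows "(\<lambda>x. f x * max 0 (1 - x \<bullet> x) ^ k) integrable_on UNIV" (is "?f integrable_on _")
proof -
  have "?f integrable_on cbox (- One) One"
    by (intro integrable_continuous continuous_intros continuous_on_subset[OF assms(1)]) auto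
  moreover have "(\<lambda>x. if x \<in> cbox (- One) One then ?f x else 0) = ?f"
    using cball_subset_cbox_One assms(2)
    by (force simp: fun_eq_iff dist_norm max_def norm_eq_sqrt_inner subset_iff)
  ultimately show ?thesis
    using integrable_restrict_UNIV[of "cbox (- One) One" ?f] by simp
qed

text \<open>Integration by parts in the direction \<open>b\<close>.\<close>

lemma moment_Cons:
  assumes "k \<ge> 1"
  shows "2 * Suc k * moment k (b # bs) = (\<Sum>i<length bs. (b \<bullet> bs ! i) * moment (Suc k) (delete_nth i bs))"
proof -
  define q where "q bs x = prod_list (map ((\<bullet>) x) bs)" for bs and x :: 'a
  define w :: "'a \<Rightarrow> real" where "w x = max 0 (1 - x \<bullet> x)" for x
  define h where "h x = q bs x * w x ^ Suc k" for x
  define h' where "h' x = (\<Sum>i<length bs. (b \<bullet> bs ! i) * (q (delete_nth i bs) x * w x ^ Suc k))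
      - 2 * Suc k * (q (b # bs) x * w x ^ k)" for x
  have int: "(\<lambda>x. q cs x * w x ^ l) integrable_on UNIV" if "l \<ge> 1" for cs l
    using weight_integrable[OF continuous_on_prod_list_inner that] by (simp add: q_def w_def)
  have "integral UNIV h' = 0"
  proof (rule integral_directional_derivative_0)
    fix x :: 'a
    have "((\<lambda>s. (x + s *\<^sub>R b) \<bullet> (x + s *\<^sub>R b)) has_real_derivative 2 * (x \<bullet> b)) (at 0)"
      by (simp add: inner_add_left inner_add_right inner_commute)
        (rule derivative_eq_intros HOL.refl | simp)+
    then have "((\<lambda>s. w (x + s *\<^sub>R b) ^ Suc k) has_real_derivative Suc k * w x ^ k * (- (2 * (x \<bullet> b)))) (at 0)"
      unfolding w_def using DERIV_max_0_power[OF DERIV_diff[OF DERIV_const[of 1]] assms] by fastforce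
    from DERIV_mult[OF DERIV_prod_list_inner[of x b bs] this]
    show "((\<lambda>s. h (x + s *\<^sub>R b)) has_real_derivative h' x) (at 0)"
      unfolding h_def h'_def q_def by (simp add: sum_distrib_left sum_distrib_right algebra_simps)
    assume "1 < norm x"
    then have "w x = 0"
      by (auto simp: w_def norm_eq_sqrt_inner)
    then show "h x = 0" "h' x = 0"
      using assms by (simp_all add: h_def h'_def)
  qed (auto simp: h_def h'_def q_def w_def intro!: continuous_intros)
  moreover have hi: "(h' has_integral (\<Sum>i<length bs. (b \<bullet> bs ! i) * moment (Suc k) (delete_nth i bs))
      - 2 * Suc k * moment k (b # bs)) UNIV"
  proof -
    have I: "((\<lambda>x. q cs x * w x ^ l) has_integral moment l cs) UNIV" if "l \<ge> 1" for cs l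
      using integrable_integral[OF int[OF that, of cs]] by (simp add: moment_def q_def w_def)
    have "((\<lambda>x. \<Sum>i<length bs. (b \<bullet> bs ! i) * (q (delete_nth i bs) x * w x ^ Suc k)) has_integral
        (\<Sum>i<length bs. (b \<bullet> bs ! i) * moment (Suc k) (delete_nth i bs))) UNIV"
      by (rule has_integral_sum[OF finite_lessThan], rule has_integral_mult_right, rule I) simp
    from has_integral_diff[OF this has_integral_mult_right[OF I[OF assms, of "b # bs"], of "2 * Suc k"]]
    show ?thesis
      unfolding h'_def .
  qed
  ultimately show ?thesis
    using integral_unique[OF hi] by simp
qed

section \<open>Tensor powers of a matrix and their action on arrays\<close>

definition mon :: "real^'n^'n \<Rightarrow> 'n list \<Rightarrow> 'n list \<Rightarrow> real" where
  "mon M i c = prod_list (map2 (\<lambda>a b. M $ a $ b) i c)"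

abbreviation Ls :: "nat \<Rightarrow> 'n list set" where
  "Ls n \<equiv> {i. length i = n}"

text \<open>Two readings are used. As \<open>mon M i c\<close> is an entry of a tensor power of
  \<open>M\<close>, this is the coordinate at \<open>c\<close> of the array \<open>a\<close>
  transformed by the transpose of \<open>M\<close>; for fixed \<open>c\<close> it is also a
  homogeneous polynomial in the entries of \<open>M\<close>, to which moments apply.\<close>

definition peval :: "('n::finite list \<Rightarrow> real) \<Rightarrow> real^'n^'n \<Rightarrow> 'n list \<Rightarrow> real" where
  "peval a M c = (\<Sum>i\<in>Ls (length c). a i * mon M i c)"

lemma finite_Ls [simp]: "finite (Ls n :: 'n::finite list set)"
  using finite_lists_length_eq[of "UNIV :: 'n set" n] by simp

lemma sum_Ls_Suc:
  fixes F :: "'n::finite list \<Rightarrow> 'b::comm_monoid_add"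
  shows "(\<Sum>i\<in>Ls (Suc n). F i) = (\<Sum>x\<in>UNIV. \<Sum>i\<in>Ls n. F (x # i))"
proof -
  have "Ls (Suc n) = (\<lambda>(x, i). x # i) ` (UNIV \<times> Ls n)"
    by (auto simp: length_Suc_conv image_def)
  then show ?thesis
    by (simp only: sum.reindex[of "\<lambda>(x, i). x # i"] inj_on_def sum.cartesian_product)
      (auto intro!: sum.reindex_cong[of "\<lambda>(x, i). x # i"] simp: inj_on_def)
qed

lemma sum_Ls_add:
  fixes F :: "'n::finite list \<Rightarrow> 'b::comm_monoid_add"
  shows "(\<Sum>i\<in>Ls (m + n). F i) = (\<Sum>i\<in>Ls m. \<Sum>j\<in>Ls n. F (i @ j))"
  by (induction m arbitrary: F) (simp_all add: sum_Ls_Suc)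

lemma sum_Ls_rev:
  fixes F :: "'n::finite list \<Rightarrow> 'b::comm_monoid_add"
  shows "(\<Sum>i\<in>Ls n. F (rev i)) = (\<Sum>i\<in>Ls n. F i)"
  by (rule sum.reindex_bij_witness[of _ rev rev]) auto

lemma mon_Nil [simp]: "mon M [] [] = 1"
  by (simp add: mon_def)

lemma mon_Cons [simp]: "mon M (a # i) (b # c) = M $ a $ b * mon M i c"
  by (simp add: mon_def)

lemma mon_append: "length i = length c \<Longrightarrow> mon M (i @ j) (c @ d) = mon M i c * mon M j d"
  by (simp add: mon_def)

lemma mon_rev: "length i = length c \<Longrightarrow> mon M (rev i) (rev c) = mon M i c"
  by (induction i c rule: list_induct2) (simp_all add: mon_append)

lemma mon_mult:
  "length i = length c \<Longrightarrow> mon (A ** B) i c = (\<Sum>j\<in>Ls (length c). mon A i j * mon B j c)"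
proof (induction i c rule: list_induct2)
  case (Cons a i b c)
  have "mon (A ** B) (a # i) (b # c)
      = (\<Sum>x\<in>UNIV. A $ a $ x * B $ x $ b) * (\<Sum>j\<in>Ls (length c). mon A i j * mon B j c)"
    using Cons by (simp add: matrix_matrix_mult_def)
  also have "\<dots> = (\<Sum>x\<in>UNIV. \<Sum>j\<in>Ls (length c). (A $ a $ x * mon A i j) * (B $ x $ b * mon B j c))"
    by (simp add: sum_product mult_ac)
  finally show ?case
    by (simp add: sum_Ls_Suc)
qed simp

lemma mon_mat_1: "length i = length c \<Longrightarrow> mon (mat 1) i c = (if i = c then 1 else 0)"
  by (induction i c rule: list_induct2) (auto simp: mat_def)

lemma mon_transpose: "length i = length c \<Longrightarrow> mon (transpose M) i c = mon M c i"
  by (induction i c rule: list_induct2) (auto simp: transpose_def)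

lemma mon_scale: "length i = length c \<Longrightarrow> mon (r *\<^sub>R M) i c = r ^ length c * mon M i c"
  by (induction i c rule: list_induct2) auto

lemma peval_mult: "peval f (A ** B) c = (\<Sum>j\<in>Ls (length c). peval f A j * mon B j c)"
proof -
  have "peval f (A ** B) c = (\<Sum>i\<in>Ls (length c). \<Sum>j\<in>Ls (length c). f i * mon A i j * mon B j c)"
    unfolding peval_def by (auto simp: mon_mult sum_distrib_left mult_ac intro!: sum.cong)
  also have "\<dots> = (\<Sum>j\<in>Ls (length c). \<Sum>i\<in>Ls (length c). f i * mon A i j * mon B j c)"
    by (rule sum.swap)
  finally show ?thesis
    by (simp add: peval_def sum_distrib_right)
qed

lemma continuous_on_mon:
  assumes "length i = length c" "continuous_on S g"
  shows "continuous_on S (\<lambda>M. mon (g M) i c)"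
  using assms(1) by (induction i c rule: list_induct2) (auto intro!: continuous_intros assms(2))

lemma continuous_on_peval [continuous_intros]:
  assumes "continuous_on S g"
  shows "continuous_on S (\<lambda>M. peval a (g M) c)"
  unfolding peval_def using assms by (auto intro!: continuous_intros continuous_on_mon)

abbreviation unit_mats :: "'n::finite list \<Rightarrow> 'n list \<Rightarrow> (real^'n^'n) list" where
  "unit_mats \<equiv> map2 (\<lambda>a b. axis a (axis b 1))"

lemma mon_eq_inner: "mon M i c = prod_list (map ((\<bullet>) M) (unit_mats i c))"
  by (simp add: mon_def inner_axis o_def split_def)

text \<open>A basis of \<open>S\<close> together with \<open>f\<close> is independent, so some
  linear functional is 1 at \<open>f\<close> and 0 on \<open>S\<close>. Functions that vanish on
  \<open>X\<close> lie in \<open>S\<close> by \<open>cong\<close>; the functional therefore depends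
  only on the finitely many values on \<open>X\<close> and is given by coefficients
  \<open>g\<close>.\<close>

lemma separating_coefficients:
  fixes S :: "('x \<Rightarrow> real) set"
  assumes X: "finite X" and S0: "(\<lambda>_. 0) \<in> S"
    and add: "\<And>a b. a \<in> S \<Longrightarrow> b \<in> S \<Longrightarrow> (\<lambda>x. a x + b x) \<in> S"
    and scale: "\<And>a r. a \<in> S \<Longrightarrow> (\<lambda>x. r * a x) \<in> S"
    and cong: "\<And>a b. a \<in> S \<Longrightarrow> (\<And>x. x \<in> X \<Longrightarrow> a x = b x) \<Longrightarrow> b \<in> S"
    and f: "f \<notin> S"
  shows "\<exists>g. (\<forall>a\<in>S. (\<Sum>x\<in>X. g x * a x) = 0) \<and> (\<Sum>x\<in>X. g x * f x) \<noteq> 0"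
proof -
  define sc :: "real \<Rightarrow> ('x \<Rightarrow> real) \<Rightarrow> 'x \<Rightarrow> real" where "sc r a = (\<lambda>x. r * a x)" for r a
  interpret V: vector_space sc
    by standard (auto simp: sc_def algebra_simps)
  interpret P: vector_space_pair sc "(*) :: real \<Rightarrow> real \<Rightarrow> real"
    by standard (auto simp: algebra_simps)
  have sub: "V.subspace S"
    unfolding V.subspace_def using S0 add scale by (auto simp: sc_def zero_fun_def plus_fun_def)
  obtain B where B: "B \<subseteq> S" "V.independent B" "S \<subseteq> V.span B"
    using V.basis_exists by metis
  have "V.span B \<subseteq> S"
    using B sub by (simp add: V.span_minimal)
  then have "V.independent (insert f B)"
    using f B by (metis V.independent_insertI subsetD)
  from P.linear_independent_extend[OF this, of "\<lambda>x. if x = f then 1 else 0"]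
  obtain l where l: "Vector_Spaces.linear sc (*) l" and l1: "\<And>x. x \<in> insert f B \<Longrightarrow> l x = (if x = f then 1 else 0)"
    by metis
  interpret l: Vector_Spaces.linear sc "(*)" l by (rule l)
  have "l b = 0" if "b \<in> B" for b
    using l1[of b] that B f by auto
  then have lS: "l a = 0" if "a \<in> S" for a
    using B that P.linear_eq_0_on_span[OF l, of B a] by auto
  define g where "g x = l (\<lambda>y. if y = x then 1 else 0)" for x
  have "l a = (\<Sum>x\<in>X. g x * a x)" for a
  proof -
    define a' where "a' = (\<Sum>x\<in>X. sc (a x) (\<lambda>y. if y = x then 1 else 0))"
    have a': "a' y = (if y \<in> X then a y else 0)" for y
    proof -
      have "a' y = (\<Sum>x\<in>X. a x * (if y = x then 1 else 0))"
        unfolding a'_def sc_def by (induction X rule: infinite_finite_induct) auto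
      then show ?thesis
        using X by (simp add: sum.delta if_distrib cong: if_cong)
    qed
    have "a - a' \<in> S"
      by (rule cong[OF S0]) (simp add: a')
    then have "l (a - a') = 0"
      by (rule lS)
    then have "l a = l a'"
      by (simp add: l.diff)
    also have "\<dots> = (\<Sum>x\<in>X. a x * g x)"
      unfolding a'_def l.sum l.scale g_def ..
    finally show ?thesis
      by (simp add: mult.commute)
  qed
  then show ?thesis
    using lS l1[of f] by (intro exI[of _ g]) auto
qed

text \<open>Column \<open>k\<close> is replaced by the basis vector \<open>j\<close>, the form in
  which Cramer's rule delivers the inverse. For invertible \<open>M\<close> this is the determinant
  times the transposed inverse, yet it is polynomial in \<open>M\<close> and thus defined
  everywhere.\<close>

definition cofactor_matrix :: "real^'n^'n \<Rightarrow> real^'n^'n" where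
  "cofactor_matrix M = (\<chi> j k. det (\<chi> i l. if l = k then (if i = j then 1 else 0) else M $ i $ l))"

lemma mult_cofactor_matrix:
  fixes M :: "real^'n^'n"
  assumes "det M \<noteq> 0"
  shows "M ** transpose (cofactor_matrix M) = det M *\<^sub>R mat 1"
proof -
  have "(M ** transpose (cofactor_matrix M)) $ i $ j = (det M *\<^sub>R mat 1) $ i $ j" for i j
  proof -
    define x :: "real^'n" where "x = (\<chi> k. det (\<chi> i l. if l = k then axis j 1 $ i else M $ i $ l) / det M)"
    have "M *v x = axis j 1"
      using cramer[OF assms, of x "axis j 1"] by (simp add: x_def)
    moreover have "cofactor_matrix M $ j $ k = det M * x $ k" for k
      using assms by (simp add: cofactor_matrix_def x_def axis_def cong: if_cong)
    then have "(M ** transpose (cofactor_matrix M)) $ i $ j = det M * (M *v x) $ i"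
      by (simp add: matrix_matrix_mult_def transpose_def matrix_vector_mult_def sum_distrib_left mult_ac)
    ultimately show ?thesis
      by (simp add: mat_def axis_def)
  qed
  then show ?thesis
    by (simp add: vec_eq_iff)
qed

lemma continuous_on_det [continuous_intros]:
  fixes f :: "'a::topological_space \<Rightarrow> real^'n^'n"
  assumes "continuous_on S f"
  shows "continuous_on S (\<lambda>x. det (f x))"
  unfolding det_def by (intro continuous_intros assms)

lemma continuous_on_cofactor_matrix [continuous_intros]:
  fixes f :: "'a::topological_space \<Rightarrow> real^'n^'n"
  assumes "continuous_on S f"
  shows "continuous_on S (\<lambda>x. cofactor_matrix (f x))"
proof -
  have "continuous_on S (\<lambda>x. if l = k then r else f x $ i $ l)" for i k l :: 'n and r :: real
    by (cases "l = k") (auto intro!: continuous_intros assms)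
  then show ?thesis
    unfolding cofactor_matrix_def by (intro continuous_intros)
qed

text \<open>Transforming one array by \<open>M\<close> and the other by the transposed inverse
  leaves their pairing unchanged; the cofactor matrix adds one factor \<open>det M\<close> for each
  of the \<open>N\<close> indices.\<close>

lemma sum_peval_cofactor_matrix:
  fixes M :: "real^'n^'n"
  assumes "det M \<noteq> 0"
  shows "(\<Sum>c\<in>Ls N. peval g M c * peval f (cofactor_matrix M) c) = det M ^ N * (\<Sum>i\<in>Ls N. g i * f i)"
proof -
  define C where "C = cofactor_matrix M"
  have "(\<Sum>c\<in>Ls N. peval g M c * peval f C c)
      = (\<Sum>c\<in>Ls N. \<Sum>i\<in>Ls N. \<Sum>j\<in>Ls N. g i * mon M i c * (f j * mon C j c))"
    unfolding peval_def by (intro sum.cong HOL.refl) (simp add: sum_product)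
  also have "\<dots> = (\<Sum>c\<in>Ls N. \<Sum>i\<in>Ls N. \<Sum>j\<in>Ls N. g i * f j * (mon M i c * mon (transpose C) c j))"
    by (intro sum.cong HOL.refl) (simp add: mon_transpose)
  also have "\<dots> = (\<Sum>i\<in>Ls N. \<Sum>c\<in>Ls N. \<Sum>j\<in>Ls N. g i * f j * (mon M i c * mon (transpose C) c j))"
    by (rule sum.swap)
  also have "\<dots> = (\<Sum>i\<in>Ls N. \<Sum>j\<in>Ls N. \<Sum>c\<in>Ls N. g i * f j * (mon M i c * mon (transpose C) c j))"
    by (intro sum.cong HOL.refl sum.swap)
  also have "\<dots> = (\<Sum>i\<in>Ls N. \<Sum>j\<in>Ls N. g i * f j * mon (det M *\<^sub>R mat 1) i j)"
    unfolding mult_cofactor_matrix[OF assms, symmetric] C_def[symmetric]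
    by (intro sum.cong HOL.refl) (simp add: mon_mult sum_distrib_left)
  also have "\<dots> = (\<Sum>i\<in>Ls N. \<Sum>j\<in>Ls N. if i = j then det M ^ N * (g i * f i) else 0)"
    by (intro sum.cong HOL.refl) (simp add: mon_scale mon_mat_1)
  also have "\<dots> = det M ^ N * (\<Sum>i\<in>Ls N. g i * f i)"
    by (simp add: sum_distrib_left)
  finally show ?thesis
    by (simp add: C_def)
qed

text \<open>An even power makes the integrand nonnegative and continuous, so a vanishing integral
  would force it to vanish on the whole cube; a small scalar matrix shows that it does not.\<close>

lemma integral_det_power_neq_0:
  assumes "even n"
  shows "integral UNIV (\<lambda>M :: real^'n^'n. det M ^ n * max 0 (1 - M \<bullet> M)) \<noteq> 0"
proof -
  define w where "w M = max 0 (1 - M \<bullet> M)" for M :: "real^'n^'n"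
  have "integral UNIV (\<lambda>M. det M ^ n * w M) \<noteq> 0"
  proof
    assume "integral UNIV (\<lambda>M. det M ^ n * w M) = 0"
    then have int0: "integral (cbox (- One) One) (\<lambda>M :: real^'n^'n. det M ^ n * w M) = 0"
      by (subst integral_unit_support) (auto simp: w_def norm_eq_sqrt_inner cball_subset_cbox_One max_def)
    have ne: "box (- One) (One :: real^'n^'n) \<noteq> {}"
      by (simp add: box_ne_empty inner_sum_left_Basis)
    have all0: "det M ^ n * w M = 0" if "M \<in> cbox (- One) One" for M :: "real^'n^'n"
    proof -
      have "continuous_on (cbox (- One) One) (\<lambda>M :: real^'n^'n. det M ^ n * w M)"
        unfolding w_def by (intro continuous_intros)
      moreover have "0 \<le> det M ^ n * w M" for M :: "real^'n^'n"
        by (intro mult_nonneg_nonneg zero_le_even_power assms) (simp_all add: w_def)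
      ultimately show ?thesis
        using ne int0 that by (simp add: integral_cbox_eq_0_iff)
    qed
    \<comment> \<open>Scales the identity matrix to norm 1/2, inside the ball where the weight is
      positive.\<close>
    define r where "r = 1 / (2 * norm (mat 1 :: real^'n^'n))"
    have "mat 1 \<noteq> (0 :: real^'n^'n)"
      by (simp add: mat_def vec_eq_iff)
    then have r: "r > 0" "norm (r *\<^sub>R mat 1 :: real^'n^'n) = 1 / 2"
      by (simp_all add: r_def)
    have "w (r *\<^sub>R mat 1) \<noteq> 0"
      unfolding w_def power2_norm_eq_inner[symmetric] r(2) by (simp add: power2_eq_square)
    moreover have "r *\<^sub>R mat 1 \<in> cbox (- One) (One :: real^'n^'n)"
      using r(2) cball_subset_cbox_One by (force simp: dist_norm)
    moreover have "det (r *\<^sub>R mat 1 :: real^'n^'n) \<noteq> 0"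
      using r(1) by (simp add: det_diagonal mat_def)
    ultimately show False
      using all0[of "r *\<^sub>R mat 1"] by simp
  qed
  then show ?thesis
    unfolding w_def .
qed

section \<open>Families of arrays closed under tensor operations\<close>

text \<open>The closure axioms mirror diagrams: \<open>contract\<close> and \<open>swap\<close> act
  on adjacent positions only, as a cap or a crossing between identity strands does. By
  \<open>cong\<close>, degree \<open>n\<close> sees only the values on lists of length
  \<open>n\<close>.\<close>

locale tensor_family =
  fixes A :: "nat \<Rightarrow> ('n::finite list \<Rightarrow> real) set" and t :: "'n list \<Rightarrow> real"
  assumes add: "a \<in> A n \<Longrightarrow> b \<in> A n \<Longrightarrow> (\<lambda>i. a i + b i) \<in> A n"
    and scale: "a \<in> A n \<Longrightarrow> (\<lambda>i. r * a i) \<in> A n"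
    and cong: "a \<in> A n \<Longrightarrow> (\<And>i. length i = n \<Longrightarrow> a i = b i) \<Longrightarrow> b \<in> A n"
    and one: "(\<lambda>_. 1) \<in> A 0"
    and tensor: "a \<in> A m \<Longrightarrow> b \<in> A n \<Longrightarrow> (\<lambda>i. a (take m i) * b (drop m i)) \<in> A (m + n)"
    and contract: "a \<in> A (m + 2 + n) \<Longrightarrow> (\<lambda>i. \<Sum>x\<in>UNIV. a (take m i @ [x, x] @ drop m i)) \<in> A (m + n)"
    and swap: "a \<in> A (m + 2 + n) \<Longrightarrow>
      (\<lambda>i. a (take m i @ [i ! Suc m, i ! m] @ drop (m + 2) i)) \<in> A (m + 2 + n)"
    and delta: "(\<lambda>i. if i ! 0 = i ! 1 then 1 else 0) \<in> A 2"
    and cubic: "t \<in> A 3"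
begin

text \<open>Scaling by 0 needs some member in every degree: degree 1 is supplied by contracting the
  cubic form, higher degrees by tensoring with \<open>delta\<close>.\<close>

lemma zero: "(\<lambda>_. 0) \<in> A n"
proof -
  have "\<exists>a. a \<in> A n"
  proof (induction n rule: less_induct)
    case (less n)
    consider "n = 0" | "n = 1" | "n \<ge> 2" by linarith
    then show ?case
    proof cases
      case 2
      show ?thesis
        using contract[of t 0 1] cubic 2 by (auto simp: numeral_3_eq_3)
    next
      case 3
      then obtain m where m: "n = 2 + m"
        by (metis le_add_diff_inverse)
      then obtain a where a: "a \<in> A m"
        using less[of m] by force
      show ?thesis
        unfolding m by (rule exI, rule tensor[OF delta a])
    qed (use one in auto)
  qed
  then show ?thesis
    using scale[of _ n 0] by auto
qed

lemma sum: "(\<And>k. k \<in> K \<Longrightarrow> a k \<in> A n) \<Longrightarrow> (\<lambda>i. \<Sum>k\<in>K. a k i) \<in> A n"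
  by (induction K rule: infinite_finite_induct) (auto simp: zero intro: add)

text \<open>For \<open>k = 0\<close> this is the tensor product of \<open>delta\<close> with
  \<open>b\<close>; every further step moves the second leg of \<open>delta\<close> one position to
  the right by an adjacent swap.\<close>

lemma insert_delta:
  assumes "b \<in> A n" "k \<le> n"
  shows "(\<lambda>i. (if hd i = tl i ! k then 1 else 0) * b (delete_nth k (tl i))) \<in> A (n + 2)"
  using assms(2)
proof (induction k)
  case 0
  have "(\<lambda>i. (if take 2 i ! 0 = take 2 i ! 1 then 1 else 0) * b (drop 2 i)) \<in> A (2 + n)"
    by (rule tensor[OF delta assms(1)])
  then show ?case
    unfolding add.commute[of n 2]
    by (rule cong) (auto simp: numeral_2_eq_2 length_Suc_conv)
next
  case (Suc k)
  have n: "n + 2 = Suc k + 2 + (n - Suc k)"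
    using Suc by simp
  have "(\<lambda>i. (if hd i = tl i ! k then 1 else 0) * b (delete_nth k (tl i))) \<in> A (Suc k + 2 + (n - Suc k))"
    using Suc n by simp
  from swap[OF this] show ?case
    unfolding n[symmetric]
  proof (rule cong)
    fix i :: "'n list" assume "length i = n + 2"
    then obtain x js where i: "i = x # js" "length js = n + 1"
      by (auto simp: length_Suc_conv)
    have "length (drop k js) \<ge> 2"
      using Suc.prems i by simp
    then obtain y z v where "drop k js = y # z # v"
      by (cases "drop k js" rule: remdups_adj.cases) auto
    then have "js = take k js @ y # z # v"
      by (metis append_take_drop_id)
    then obtain u where js: "js = u @ y # z # v" "length u = k"
      using Suc.prems i by (metis add_leD1 length_take min_absorb2 Suc_eq_plus1 le_add1 le_trans)
    show "(if hd (take (Suc k) i @ [i ! Suc (Suc k), i ! Suc k] @ drop (Suc k + 2) i)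
            = tl (take (Suc k) i @ [i ! Suc (Suc k), i ! Suc k] @ drop (Suc k + 2) i) ! k then 1 else 0)
          * b (delete_nth k (tl (take (Suc k) i @ [i ! Suc (Suc k), i ! Suc k] @ drop (Suc k + 2) i)))
        = (if hd i = tl i ! Suc k then 1 else 0) * b (delete_nth (Suc k) (tl i))"
      using js by (simp add: i nth_append)
  qed
qed

text \<open>A Wick-type expansion: integration by parts matches the first row index with each of the
  others in turn. Every match raises the exponent of the weight, so \<open>k\<close> stays arbitrary
  in the induction.\<close>

lemma moments: "k \<ge> 1 \<Longrightarrow> (\<lambda>x. moment k (unit_mats x y)) \<in> A (length y)"
proof (induction y arbitrary: k rule: length_induct)
  case (1 y)
  show ?case
  proof (cases y)
    case Nil
    show ?thesis
      using scale[OF one, of "moment k []"] Nil by (auto intro: cong)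
  next
    case (Cons b ys)
    define n where "n = length ys"
    \<comment> \<open>One summand of \<open>moment_Cons\<close>, divided by its left-hand factor.
      The inner product of two matrix units is a delta in the columns, constant because
      \<open>y\<close> is fixed, times a delta in the rows.\<close>
    define F where "F l x = (1 / (2 * Suc k)) * ((if b = ys ! l then 1 else 0) *
      ((if hd x = tl x ! l then 1 else 0) * moment (Suc k) (unit_mats (delete_nth l (tl x)) (delete_nth l ys))))" for l x
    have "F l \<in> A (length y)" if "l \<in> {..<n}" for l
    proof -
      have "(\<lambda>x. moment (Suc k) (unit_mats x (delete_nth l ys))) \<in> A (n - 1)"
        using 1 that Cons by (auto simp: n_def dest: spec[of _ "delete_nth l ys"])
      moreover have "n - 1 + 2 = length y" "l \<le> n - 1"
        using that Cons by (auto simp: n_def)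
      ultimately show ?thesis
        unfolding F_def using insert_delta[of _ "n - 1" l] by (intro scale) simp
    qed
    then have "(\<lambda>x. \<Sum>l<n. F l x) \<in> A (length y)"
      by (rule sum)
    then show ?thesis
    proof (rule cong)
      fix x :: "'n list" assume "length x = length y"
      then obtain a xs where x: "x = a # xs" "length xs = n"
        by (auto simp: Cons n_def length_Suc_conv)
      have del: "delete_nth l (unit_mats xs ys) = unit_mats (delete_nth l xs) (delete_nth l ys)" if "l < n" for l
        using x that by (simp add: take_map drop_map take_zip drop_zip n_def)
      have "2 * Suc k * moment k (unit_mats x y)
          = (\<Sum>l<n. (axis a (axis b 1) \<bullet> unit_mats xs ys ! l) * moment (Suc k) (delete_nth l (unit_mats xs ys)))"
        using moment_Cons[OF 1(2), of "axis a (axis b 1)" "unit_mats xs ys"] x by (simp add: Cons n_def)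
      also have "\<dots> = (\<Sum>l<n. 2 * Suc k * F l x)"
        using x by (intro sum.cong HOL.refl) (auto simp: F_def del inner_axis_axis n_def)
      finally show "(\<Sum>l<n. F l x) = moment k (unit_mats x y)"
        by (simp add: sum_distrib_left[symmetric])
    qed
  qed
qed

text \<open>Reversing the second copy makes the innermost pair adjacent, so repeated contraction in
  the middle removes all \<open>l\<close> pairs without any swap.\<close>

lemma contract_rev: "a \<in> A (n + 2 * l) \<Longrightarrow> (\<lambda>i. \<Sum>j\<in>Ls l. a (i @ j @ rev j)) \<in> A n"
proof (induction l arbitrary: a)
  case (Suc l)
  have n: "n + 2 * Suc l = (n + l) + 2 + l" "n + l + l = n + 2 * l"
    by simp_all
  have "(\<lambda>i. \<Sum>x\<in>UNIV. a (take (n + l) i @ [x, x] @ drop (n + l) i)) \<in> A (n + 2 * l)"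
    using contract[of a "n + l" l] Suc.prems unfolding n .
  from Suc.IH[OF this] show ?case
  proof (rule cong)
    fix i :: "'n list" assume "length i = n"
    then show "(\<Sum>j\<in>Ls l. \<Sum>x\<in>UNIV. a (take (n + l) (i @ j @ rev j) @ [x, x] @ drop (n + l) (i @ j @ rev j)))
        = (\<Sum>j\<in>Ls (Suc l). a (i @ j @ rev j))"
      using sum_Ls_add[of "\<lambda>j. a (i @ j @ rev j)" l 1]
      by (auto simp: sum_Ls_Suc intro!: sum.cong)
  qed
qed simp

inductive_set polys :: "(real^'n^'n \<Rightarrow> real) set" where
  peval: "a \<in> A (length d) \<Longrightarrow> (\<lambda>M. peval a M d) \<in> polys"
| plus: "p \<in> polys \<Longrightarrow> q \<in> polys \<Longrightarrow> (\<lambda>M. p M + q M) \<in> polys"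

lemma peval_tensor:
  "peval a M c * peval b M d = peval (\<lambda>i. a (take (length c) i) * b (drop (length c) i)) M (c @ d)"
  by (auto simp: peval_def sum_Ls_add sum_product mon_append intro!: sum.cong)

lemma polys_mult:
  assumes "p \<in> polys" "q \<in> polys"
  shows "(\<lambda>M. p M * q M) \<in> polys"
  using assms
proof (induction arbitrary: q)
  case (peval a c)
  show ?case
    using peval(2)
  proof induction
    case (peval b d)
    show ?case
      unfolding peval_tensor using polys.peval[of _ "c @ d"] tensor[OF \<open>a \<in> A (length c)\<close> peval] by simp
  next
    case (plus p q)
    then show ?case
      using polys.plus[of "\<lambda>M. peval a M c * p M" "\<lambda>M. peval a M c * q M"] by (simp add: distrib_left)
  qed
next
  case (plus p p')
  then show ?case
    using polys.plus[of "\<lambda>M. p M * q M" "\<lambda>M. p' M * q M"] by (simp add: distrib_right)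
qed

lemma polys_const: "(\<lambda>_. r) \<in> polys"
  using polys.peval[of "\<lambda>_. r" "[]"] scale[OF one, of r] by (simp add: peval_def)

lemma continuous_on_polys: "p \<in> polys \<Longrightarrow> continuous_on S p"
  by (induction rule: polys.induct) (auto intro!: continuous_intros)

text \<open>
  The moments are combinations of products of Kronecker deltas, so integrating against a polynomial
  from \<open>polys\<close> contracts its array to a member of \<open>A N\<close>.
\<close>

lemma polys_orthogonal:
  assumes "p \<in> polys" and g: "\<And>a. a \<in> A N \<Longrightarrow> (\<Sum>i\<in>Ls N. g i * a i) = 0" and c: "length c = N"
  shows "integral UNIV (\<lambda>M. peval g M c * p M * max 0 (1 - M \<bullet> M)) = 0"
  using assms(1)
proof induction
  case (peval a d)
  define l where "l = length d"
  \<comment> \<open>Reversing \<open>d\<close> makes \<open>a\<close> appear at \<open>rev j\<close>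
    after reindexing, the pattern that \<open>contract_rev\<close> contracts.\<close>
  define T where "T x = moment 1 (unit_mats x (c @ rev d))" for x
  have a: "a \<in> A l"
    using peval by (simp add: l_def)
  have T: "((\<lambda>M. mon M x (c @ rev d) * max 0 (1 - M \<bullet> M)) has_integral T x) UNIV" for x
    unfolding T_def mon_eq_inner moment_def
    using integrable_integral[OF weight_integrable[OF continuous_on_prod_list_inner, of 1]]
    by (simp del: map_map)
  have "peval g M c * peval a M d * max 0 (1 - M \<bullet> M)
      = (\<Sum>i\<in>Ls N. \<Sum>j\<in>Ls l. (g i * a (rev j)) * (mon M (i @ j) (c @ rev d) * max 0 (1 - M \<bullet> M)))" for M
  proof -
    have "peval a M d = (\<Sum>j\<in>Ls l. a (rev j) * mon M (rev j) d)"
      unfolding peval_def l_def by (rule sum_Ls_rev[symmetric])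
    also have "\<dots> = (\<Sum>j\<in>Ls l. a (rev j) * mon M j (rev d))"
      using mon_rev[of _ "rev d" M] by (intro sum.cong) (auto simp: l_def)
    finally show ?thesis
      unfolding peval_def[of g] c sum_product
      by (simp add: sum_distrib_right sum_distrib_left mon_append c mult_ac) (rule sum.swap)
  qed
  moreover have "((\<lambda>M. \<Sum>i\<in>Ls N. \<Sum>j\<in>Ls l. (g i * a (rev j)) * (mon M (i @ j) (c @ rev d) * max 0 (1 - M \<bullet> M)))
      has_integral (\<Sum>i\<in>Ls N. \<Sum>j\<in>Ls l. (g i * a (rev j)) * T (i @ j))) UNIV"
    by (intro has_integral_sum finite_Ls has_integral_mult_right T)
  moreover have "(\<Sum>i\<in>Ls N. \<Sum>j\<in>Ls l. (g i * a (rev j)) * T (i @ j))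
      = (\<Sum>i\<in>Ls N. g i * (\<Sum>j\<in>Ls l. T (i @ j) * a (rev j)))"
    by (simp add: sum_distrib_left mult_ac)
  moreover have "(\<lambda>i. \<Sum>j\<in>Ls l. T (i @ j) * a (rev j)) \<in> A N"
  proof -
    have "T \<in> A (N + l)"
      unfolding T_def using moments[of 1 "c @ rev d"] by (simp add: c l_def)
    from tensor[OF this a]
    have "(\<lambda>i. T (take (N + l) i) * a (drop (N + l) i)) \<in> A (N + 2 * l)"
      by (simp only: mult_2 add.assoc)
    from contract_rev[OF this] show ?thesis
      by (rule cong) (auto intro!: sum.cong)
  qed
  ultimately show ?case
    using g by (simp add: integral_unique)
next
  case (plus p q)
  have "(\<lambda>M. peval g M c * p M * max 0 (1 - M \<bullet> M)) integrable_on UNIV" if "p \<in> polys" for p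
    using weight_integrable[of "\<lambda>M. peval g M c * p M" 1] continuous_on_polys[OF that]
    by (simp add: continuous_intros)
  from integral_add[OF this[OF plus(1)] this[OF plus(2)]] plus show ?case
    by (simp add: algebra_simps)
qed

text \<open>The Stone--Weierstrass theorem on the image of the cube under the Gram matrix and the values of \<open>t\<close>.\<close>

lemma polys_approx:
  assumes F: "continuous_on UNIV F"
    and inv: "\<And>M M'. transpose M ** M = transpose M' ** M' \<Longrightarrow>
      (\<And>c. length c = 3 \<Longrightarrow> peval t M c = peval t M' c) \<Longrightarrow> F M = F M'"
    and "\<epsilon> > 0"
  shows "\<exists>p\<in>polys. \<forall>M\<in>cbox (- One) One. \<bar>F M - p M\<bar> < \<epsilon>"
proof -
  define \<phi> :: "real^'n^'n \<Rightarrow> (real^'n^'n) \<times> (real^'n^'n^'n)" where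
    "\<phi> M = (transpose M ** M, \<chi> a b c. peval t M [a, b, c])" for M
  define K where "K = cbox (- One) (One :: real^'n^'n)"
  define R where "R = {q. continuous_on (\<phi> ` K) q \<and> (\<exists>p\<in>polys. \<forall>M\<in>K. q (\<phi> M) = p M)}"
  have cont: "continuous_on K \<phi>"
    unfolding \<phi>_def by (intro continuous_intros) (auto simp: matrix_matrix_mult_def transpose_def intro!: continuous_intros)
  have comp: "compact (\<phi> ` K)"
    using cont by (intro compact_continuous_image) (auto simp: K_def)
  have gram: "(\<lambda>M. (transpose M ** M) $ a $ b) \<in> polys" for a b
  proof -
    have "peval (\<lambda>i. if i ! 0 = i ! 1 then 1 else 0) M [a, b] = (transpose M ** M) $ a $ b" for M
      by (simp add: peval_def sum_Ls_Suc matrix_matrix_mult_def transpose_def if_distrib if_distribR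
          sum.delta numeral_2_eq_2 cong: if_cong)
    moreover have "(\<lambda>i. if i ! 0 = i ! 1 then 1 else 0) \<in> A (length [a, b])"
      using delta by (simp add: numeral_2_eq_2)
    ultimately show ?thesis
      using polys.peval by fastforce
  qed
  have R: "q \<in> R" if "continuous_on UNIV q" "(\<lambda>M. q (\<phi> M)) \<in> polys" for q
    unfolding R_def mem_Collect_eq
    by (intro conjI bexI[OF _ that(2)] continuous_on_subset[OF that(1)]) simp_all
  interpret function_ring_on R "\<phi> ` K"
  proof
    fix f g assume fg: "f \<in> R" "g \<in> R"
    then show "(\<lambda>x. f x + g x) \<in> R" "(\<lambda>x. f x * g x) \<in> R"
      unfolding R_def using polys.plus polys_mult
      by (auto intro!: continuous_intros)
  next
    fix r show "(\<lambda>_. r) \<in> R"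
      unfolding R_def using polys_const by auto
  next
    fix x y :: "(real^'n^'n) \<times> (real^'n^'n^'n)" assume "x \<noteq> y"
    then consider a b where "fst x $ a $ b \<noteq> fst y $ a $ b" | a b c where "snd x $ a $ b $ c \<noteq> snd y $ a $ b $ c"
      by (metis prod_eq_iff vec_eq_iff)
    then show "\<exists>f\<in>R. f x \<noteq> f y"
    proof cases
      case 1
      have "(\<lambda>x. fst x $ a $ b) \<in> R"
        by (rule R) (use gram in \<open>auto simp: \<phi>_def intro!: continuous_intros\<close>)
      from bexI[OF _ this] 1 show ?thesis by simp
    next
      case 2
      have "(\<lambda>M. peval t M [a, b, c]) \<in> polys"
        using polys.peval[of t "[a, b, c]"] cubic by (simp add: numeral_3_eq_3)
      then have "(\<lambda>x. snd x $ a $ b $ c) \<in> R"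
        by (intro R) (auto simp: \<phi>_def intro!: continuous_intros)
      from bexI[OF _ this] 2 show ?thesis by simp
    qed
  qed (auto simp: R_def comp)
  \<comment> \<open>By \<open>inv\<close>, the value does not depend on the chosen preimage, so
    \<open>F\<close> factors through the image.\<close>
  define Q where "Q y = F (SOME M. M \<in> K \<and> \<phi> M = y)" for y
  have Q: "Q (\<phi> M) = F M" if "M \<in> K" for M
  proof -
    have "(SOME M'. M' \<in> K \<and> \<phi> M' = \<phi> M) \<in> K \<and> \<phi> (SOME M'. M' \<in> K \<and> \<phi> M' = \<phi> M) = \<phi> M"
      by (rule someI[of _ M]) (use that in simp)
    then show ?thesis
      unfolding Q_def by (intro inv) (auto simp: \<phi>_def vec_eq_iff length_Suc_conv numeral_3_eq_3)
  qed
  \<comment> \<open>On the compact cube the map is closed: the preimage of a closed set under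
    \<open>Q\<close> is the image of a compact set.\<close>
  have "continuous_on (\<phi> ` K) Q"
  proof (rule continuous_on_closed_vimage[THEN iffD2, rule_format])
    show "closed (\<phi> ` K)"
      using comp compact_imp_closed by blast
    fix B :: "real set" assume "closed B"
    have "Q -` B \<inter> \<phi> ` K = \<phi> ` (F -` B \<inter> K)"
      using Q by auto
    moreover have "compact (F -` B \<inter> K)"
      using F \<open>closed B\<close> by (intro closed_Int_compact closed_vimage) (auto simp: K_def)
    then have "compact (\<phi> ` (F -` B \<inter> K))"
      by (intro compact_continuous_image continuous_on_subset[OF cont]) auto
    ultimately show "closed (Q -` B \<inter> \<phi> ` K)"
      using compact_imp_closed by simp
  qed
  from Stone_Weierstrass_basic[OF this \<open>\<epsilon> > 0\<close>] obtain q where "q \<in> R" "\<forall>x\<in>\<phi> ` K. \<bar>Q x - q x\<bar> < \<epsilon>"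
    by blast
  then show ?thesis
    using Q unfolding R_def K_def[symmetric] by fastforce
qed

text \<open>Members of \<open>polys\<close> integrate to 0 by \<open>polys_orthogonal\<close>. A
  uniform approximation of \<open>F\<close> by them on the cube bounds the integral by
  \<open>I * \<epsilon>\<close>, since the weight vanishes outside the cube.\<close>

lemma integral_orthogonal_eq_0:
  assumes contF: "continuous_on UNIV F"
    and inv: "\<And>M M'. transpose M ** M = transpose M' ** M' \<Longrightarrow>
      (\<And>c. length c = 3 \<Longrightarrow> peval t M c = peval t M' c) \<Longrightarrow> F M = F M'"
    and g: "\<And>a. a \<in> A N \<Longrightarrow> (\<Sum>i\<in>Ls N. g i * a i) = 0" and c: "length c = N"
  shows "integral UNIV (\<lambda>M. peval g M c * F M * max 0 (1 - M \<bullet> M)) = 0"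
proof -
  define w where "w M = max 0 (1 - M \<bullet> M)" for M :: "real^'n^'n"
  have int: "(\<lambda>M. q M * w M) integrable_on UNIV" if "continuous_on UNIV q" for q
    using weight_integrable[OF that, of 1] by (simp add: w_def)
  define I where "I = integral UNIV (\<lambda>M. \<bar>peval g M c\<bar> * w M)"
  have contg: "continuous_on UNIV (\<lambda>M. peval g M c)"
    by (intro continuous_intros)
  have "\<bar>integral UNIV (\<lambda>M. peval g M c * F M * w M)\<bar> \<le> I * \<epsilon>" if "\<epsilon> > 0" for \<epsilon>
  proof -
    obtain p where p: "p \<in> polys" and Fp: "\<And>M. M \<in> cbox (- One) One \<Longrightarrow> \<bar>F M - p M\<bar> < \<epsilon>"
      using polys_approx[OF contF inv \<open>\<epsilon> > 0\<close>] by blast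
    have contp: "continuous_on UNIV p"
      using p by (rule continuous_on_polys)
    have "integral UNIV (\<lambda>M. peval g M c * p M * w M) = 0"
      unfolding w_def by (rule polys_orthogonal[OF p _ c]) (rule g)
    then have "integral UNIV (\<lambda>M. peval g M c * F M * w M)
        = integral UNIV (\<lambda>M. peval g M c * F M * w M) - integral UNIV (\<lambda>M. peval g M c * p M * w M)"
      by simp
    also have "\<dots> = integral UNIV (\<lambda>M. peval g M c * (F M - p M) * w M)"
    proof -
      have "continuous_on UNIV (\<lambda>M. peval g M c * F M)" "continuous_on UNIV (\<lambda>M. peval g M c * p M)"
        by (intro continuous_on_mult contg contF contp)+
      from integral_diff[OF this[THEN int]] show ?thesis
        by (simp add: algebra_simps)
    qed
    also have "\<bar>\<dots>\<bar> \<le> integral UNIV (\<lambda>M. \<epsilon> * (\<bar>peval g M c\<bar> * w M))"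
    proof (rule integral_norm_bound_integral[where f = "\<lambda>M. peval g M c * (F M - p M) * w M", unfolded real_norm_def])
      fix M :: "real^'n^'n"
      show "\<bar>peval g M c * (F M - p M) * w M\<bar> \<le> \<epsilon> * (\<bar>peval g M c\<bar> * w M)"
      proof (cases "M \<in> cbox (- One) One")
        case True
        then have "\<bar>F M - p M\<bar> \<le> \<epsilon>"
          using Fp by fastforce
        then have "\<bar>F M - p M\<bar> * (\<bar>peval g M c\<bar> * w M) \<le> \<epsilon> * (\<bar>peval g M c\<bar> * w M)"
          by (intro mult_right_mono) (auto simp: w_def)
        then show ?thesis
          by (simp add: abs_mult w_def mult_ac)
      next
        case False
        then have "1 < norm M"
          using cball_subset_cbox_One by (force simp: dist_norm)
        then have "w M = 0"
          by (simp add: w_def norm_eq_sqrt_inner)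
        then show ?thesis by simp
      qed
    qed (auto intro!: int continuous_intros contF contp integrable_on_mult_right)
    also have "\<dots> = I * \<epsilon>"
      by (simp add: I_def)
    finally show ?thesis .
  qed
  note le = this
  have "\<bar>integral UNIV (\<lambda>M. peval g M c * F M * w M)\<bar> \<le> 0"
  proof (rule field_le_epsilon)
    fix e :: real assume "e > 0"
    have "I \<ge> 0"
      unfolding I_def by (intro integral_nonneg int continuous_intros) (simp add: w_def)
    \<comment> \<open>The denominator \<open>I + 1\<close> stays positive also when \<open>I\<close>
      is 0.\<close>
    then have "I * (e / (I + 1)) \<le> e"
      using \<open>e > 0\<close> by (simp add: field_simps)
    then show "\<bar>integral UNIV (\<lambda>M. peval g M c * F M * w M)\<bar> \<le> 0 + e"
      using le[of "e / (I + 1)"] \<open>e > 0\<close> \<open>I \<ge> 0\<close> by simp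
  qed
  then show ?thesis by (simp add: w_def)
qed

text \<open>A first fundamental theorem for the stabiliser of \<open>t\<close> in the orthogonal
  group. For \<open>f\<close> outside \<open>A N\<close>, a separating \<open>g\<close> would make
  the integral of an even power of the determinant against the weight vanish.\<close>

theorem invariant_mem:
  assumes inv: "\<And>h c. orthogonal_matrix h \<Longrightarrow> (\<And>d. length d = 3 \<Longrightarrow> peval t h d = t d) \<Longrightarrow>
      length c = N \<Longrightarrow> peval f h c = f c"
  shows "f \<in> A N"
proof (rule ccontr)
  assume "f \<notin> A N"
  have "\<exists>g. (\<forall>a\<in>A N. (\<Sum>x\<in>Ls N. g x * a x) = 0) \<and> (\<Sum>x\<in>Ls N. g x * f x) \<noteq> 0"
  proof (rule separating_coefficients)
    fix a b assume "a \<in> A N" "\<And>x. x \<in> Ls N \<Longrightarrow> a x = b x"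
    then show "b \<in> A N" using cong[of a N b] by simp
  qed (use zero add scale \<open>f \<notin> A N\<close> in simp_all)
  then obtain g where g: "\<And>a. a \<in> A N \<Longrightarrow> (\<Sum>i\<in>Ls N. g i * a i) = 0" and gf: "(\<Sum>i\<in>Ls N. g i * f i) \<noteq> 0"
    by blast
  define w where "w M = max 0 (1 - M \<bullet> M)" for M :: "real^'n^'n"
  \<comment> \<open>Up to an even power of \<open>det M\<close> this is \<open>f\<close> transformed by the transposed inverse of \<open>M\<close>;
    the cofactor matrix makes it continuous at singular \<open>M\<close>.\<close>
  define F where "F c M = det M ^ (N + 2) * peval f (cofactor_matrix M) c" for c and M :: "real^'n^'n"
  have contF: "continuous_on UNIV (F c)" for c
    unfolding F_def by (intro continuous_intros)
  have int: "(\<lambda>M. q M * w M) integrable_on UNIV" if "continuous_on UNIV q" for q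
    using weight_integrable[OF that, of 1] by (simp add: w_def)
  \<comment> \<open>For invertible matrices, equal Gram matrices give \<open>M' = h ** M\<close>
    with \<open>h\<close> orthogonal, and equal cubic values make \<open>h\<close> fix
    \<open>t\<close>. The determinants agree up to a sign, which enters with exponent
    \<open>N + 2\<close> from the prefactor and \<open>N\<close> from the cofactors, hence cancels.
    At singular matrices both sides are 0 because \<open>N + 2\<close> is positive.\<close>
  have invF: "F c M = F c M'" if c: "length c = N" and gram: "transpose M ** M = transpose M' ** M'"
      and cub: "\<And>c. length c = 3 \<Longrightarrow> peval t M c = peval t M' c" for c M M'
  proof -
    have "det M * det M = det M' * det M'"
      using arg_cong[OF gram, of det] by (simp add: det_mul det_transpose)
    note dd = this
    have "det M = 0 \<and> det M' = 0 \<or> (\<exists>s. s * s = 1 \<and> det M' = s * det M \<and> det M \<noteq> 0)"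
    proof (cases "det M = 0")
      case False
      then have *: "(det M' / det M) * (det M' / det M) = 1"
        using dd False by (metis mult_eq_0_iff divide_self_if times_divide_times_eq)
      then show ?thesis
        using False by (intro disjI2 exI[of _ "det M' / det M"] conjI *) simp
    qed (use dd in simp)
    then consider "det M = 0" "det M' = 0" | s where "s * s = 1" "det M' = s * det M" "det M \<noteq> 0"
      by blast
    then show ?thesis
    proof cases
      case 2
      note s = 2
      obtain Mi where Mi: "M ** Mi = mat 1" "Mi ** M = mat 1"
        using 2(3) invertible_det_nz[of M] by (auto simp: invertible_def)
      define h where "h = M' ** Mi"
      have hM: "h ** M = M'"
        by (simp add: h_def matrix_mul_assoc[symmetric] Mi)
      have "transpose h ** h = transpose (Mi) ** (transpose M' ** M') ** Mi"
        by (simp add: h_def matrix_transpose_mul matrix_mul_assoc)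
      also have "\<dots> = transpose (M ** Mi) ** (M ** Mi)"
        unfolding gram[symmetric] by (simp add: matrix_transpose_mul matrix_mul_assoc)
      finally have orth: "orthogonal_matrix h"
        by (simp add: Mi orthogonal_matrix)
      have "peval t h d = t d" if d: "length d = 3" for d
      proof -
        have "peval t h d = peval t (M ** Mi) d"
          unfolding h_def peval_mult using cub d by simp
        also have "\<dots> = (\<Sum>i\<in>Ls 3. t i * (if i = d then 1 else 0))"
          unfolding Mi peval_def d by (intro sum.cong HOL.refl) (simp add: mon_mat_1 d)
        finally show ?thesis
          using d by (simp add: sum.delta if_distrib cong: if_cong)
      qed
      note inv' = inv[OF orth this]
      have "M' ** transpose (cofactor_matrix M') = det M' *\<^sub>R mat 1"
        using s by (intro mult_cofactor_matrix) auto
      also have "\<dots> = s *\<^sub>R (h ** (M ** transpose (cofactor_matrix M)) ** transpose h)"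
        using orth s by (simp add: mult_cofactor_matrix scalar_matrix_assoc[symmetric] matrix_scalar_ac
            orthogonal_matrix_def)
      also have "\<dots> = M' ** transpose (s *\<^sub>R (h ** cofactor_matrix M))"
        by (simp add: matrix_transpose_mul transpose_scalar matrix_scalar_ac scalar_matrix_assoc[symmetric]
            matrix_mul_assoc hM)
      finally have "M' ** transpose (cofactor_matrix M') = M' ** transpose (s *\<^sub>R (h ** cofactor_matrix M))" .
      moreover obtain Mi' where "Mi' ** M' = mat 1"
        using invertible_det_nz[of M'] s by (auto simp: invertible_def)
      ultimately have "cofactor_matrix M' = s *\<^sub>R (h ** cofactor_matrix M)"
        by (metis matrix_mul_assoc matrix_mul_lid transpose_transpose)
      then have "peval f (cofactor_matrix M') c = s ^ N * peval f (h ** cofactor_matrix M) c"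
        by (simp add: peval_def mon_scale c sum_distrib_left mult_ac)
      also have "peval f (h ** cofactor_matrix M) c = peval f (cofactor_matrix M) c"
        unfolding peval_mult using inv' c by (simp add: peval_def)
      finally have "F c M' = (s * det M) ^ (N + 2) * (s ^ N * peval f (cofactor_matrix M) c)"
        by (simp add: F_def s(2))
      also have "\<dots> = (s * s) ^ Suc N * F c M"
        by (simp add: F_def power_mult_distrib mult_ac)
      finally show ?thesis
        using s by simp
    qed (simp add: F_def)
  qed
  have zero: "integral UNIV (\<lambda>M. peval g M c * F c M * w M) = 0" if "length c = N" for c
    unfolding w_def by (rule integral_orthogonal_eq_0[OF contF invF[OF that] g that])
  \<comment> \<open>The exponent collects \<open>N + 2\<close> from \<open>F\<close> and
    \<open>N\<close> from \<open>sum_peval_cofactor_matrix\<close>; that the total is even keeps the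
    integrand from changing sign.\<close>
  have key: "(\<Sum>c\<in>Ls N. peval g M c * F c M) = det M ^ (2 * N + 2) * (\<Sum>i\<in>Ls N. g i * f i)" for M
  proof (cases "det M = 0")
    case False
    have "(\<Sum>c\<in>Ls N. peval g M c * F c M) = det M ^ (N + 2) * (\<Sum>c\<in>Ls N. peval g M c * peval f (cofactor_matrix M) c)"
      by (simp add: F_def sum_distrib_left mult_ac)
    then show ?thesis
      unfolding sum_peval_cofactor_matrix[OF False] by (simp add: power_add mult_2_right mult_ac)
  qed (simp add: F_def)
  have "((\<lambda>M. \<Sum>c\<in>Ls N. peval g M c * F c M * w M) has_integral (\<Sum>c\<in>(Ls N :: 'n list set). 0)) UNIV"
  proof (rule has_integral_sum[OF finite_Ls])
    fix c :: "'n list" assume "c \<in> Ls N"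
    then show "((\<lambda>M. peval g M c * F c M * w M) has_integral 0) UNIV"
      using zero[of c] integrable_integral[OF int[of "\<lambda>M. peval g M c * F c M"]]
      by (simp add: continuous_intros contF)
  qed
  then have "((\<lambda>M. (\<Sum>i\<in>Ls N. g i * f i) * (det M ^ (2 * N + 2) * w M)) has_integral 0) UNIV"
    unfolding sum_distrib_right[symmetric] key by (simp add: mult_ac)
  then have "integral UNIV (\<lambda>M :: real^'n^'n. det M ^ (2 * N + 2) * w M) = 0"
    using gf by (simp add: integral_unique has_integral_mult_right_iff)
  then show False
    using integral_det_power_neq_0[of "2 * N + 2", where 'n = 'n] by (simp add: w_def)
qed

end

section \<open>Octonions and the Albert algebra\<close>

instantiation octonion :: real_inner
begin
definition inner_octonion :: "octonion \<Rightarrow> octonion \<Rightarrow> real" where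
  "inner_octonion x y = oRe (x * ocnj y)"
instance
proof
  fix x y z :: octonion and r :: real
  show "x \<bullet> y = y \<bullet> x"
    unfolding inner_octonion_def by (transfer; auto simp: algebra_simps)
  show "(x + y) \<bullet> z = x \<bullet> z + y \<bullet> z"
    unfolding inner_octonion_def by (transfer; auto simp: algebra_simps)
  show "(r *\<^sub>R x) \<bullet> y = r * (x \<bullet> y)"
    unfolding inner_octonion_def by (transfer; auto simp: algebra_simps)
  have *: "x \<bullet> x = (norm x)\<^sup>2"
    unfolding inner_octonion_def
    by (transfer; auto simp: norm_Pair cmod_power2) (simp add: power2_eq_square algebra_simps)
  show "0 \<le> x \<bullet> x" "(x \<bullet> x = 0) = (x = 0)" "norm x = sqrt (x \<bullet> x)"
    unfolding * by simp_all
qed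
end

interpretation oct: bounded_bilinear "(*) :: octonion \<Rightarrow> octonion \<Rightarrow> octonion"
proof
  show "(a + a') * b = a * b + a' * b" "a * (b + b') = a * b + a * b'" for a a' b b' :: octonion
    by (rule octonion_distrib)+
  show "(r *\<^sub>R a) * b = r *\<^sub>R (a * b)" "a * (r *\<^sub>R b) = r *\<^sub>R (a * b)" for r and a b :: octonion
    by (transfer; auto simp: algebra_simps)+
  show "\<exists>K. \<forall>a b :: octonion. norm (a * b) \<le> norm a * norm b * K"
    by (rule exI[of _ 1]) (simp add: octonion_norm_mult)
qed

lemma octonion_mult_1 [simp]: "1 * x = x" "x * 1 = x" for x :: octonion
  by (transfer; auto)+

lemma octonion_alternative:
  "ocnj x * (x * y) = (x \<bullet> x) *\<^sub>R y" "(y * x) * ocnj x = (x \<bullet> x) *\<^sub>R y"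
  unfolding inner_octonion_def by (transfer; auto simp: algebra_simps complex_eq_iff)+

lemma octonion_flexible: "(x * y) * x = x * (y * x)" for x y :: octonion
  by (transfer; auto simp: algebra_simps complex_eq_iff)

lemma octonion_Moufang: "u * (x * (u * z)) = ((u * x) * u) * z" for u x z :: octonion
  by (transfer; auto simp: algebra_simps complex_eq_iff)

text \<open>For a unit \<open>v\<close> this says that conjugation, two-sided multiplication by
  \<open>v\<close> and a sign compose to the reflection in the hyperplane orthogonal to
  \<open>v\<close>. Reflections thus become available through multiplications.\<close>

lemma octonion_reflection: "(v * ocnj x) * v = (2 * (v \<bullet> x)) *\<^sub>R v - (v \<bullet> v) *\<^sub>R x"
  unfolding inner_octonion_def by (transfer; auto simp: algebra_simps complex_eq_iff)

lemma ocnj_inner [simp]: "ocnj x \<bullet> ocnj y = x \<bullet> y"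
  unfolding inner_octonion_def by (transfer; auto simp: algebra_simps)

lemma octonion_mult_inner: "(x * y) \<bullet> z = y \<bullet> (ocnj x * z)" "(x * y) \<bullet> z = x \<bullet> (z * ocnj y)"
  unfolding inner_octonion_def by (transfer; auto simp: algebra_simps)+

lemma inner_1_octonion: "x \<bullet> 1 = oRe x" "1 \<bullet> x = oRe x"
  by (simp_all add: inner_octonion_def) (transfer; auto)

lemma ocnj_eq: "ocnj x = (2 * oRe x) *\<^sub>R 1 - x"
  by (transfer; auto simp: complex_eq_iff)

lemma norm_ocnj [simp]: "norm (ocnj x) = norm x"
  by (simp add: norm_eq_sqrt_inner)

lemma octonion_one_inner [simp]: "(1::octonion) \<bullet> 1 = 1" "norm (1::octonion) = 1"
  unfolding norm_eq_sqrt_inner by (simp_all add: inner_1_octonion oRe.rep_eq one_octonion.rep_eq)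

section \<open>Coordinates on the Albert algebra\<close>

lift_definition mk :: "real \<Rightarrow> real \<Rightarrow> real \<Rightarrow> octonion \<Rightarrow> octonion \<Rightarrow> octonion \<Rightarrow> albert" is
  "\<lambda>d1 d2 d3 x y z. vector [vector [d1 *\<^sub>R 1, x, z], vector [ocnj x, d2 *\<^sub>R 1, y], vector [ocnj z, ocnj y, d3 *\<^sub>R 1]]"
  by (simp add: omat_adjoint_def vec_eq_iff forall_3)

lemma octonion_1_neq_0 [simp]: "(1::octonion) \<noteq> 0" "(0::octonion) \<noteq> 1"
  by (metis norm_zero octonion_one_inner(2) zero_neq_one)+

lemma oRe_simps:
  "oRe 1 = 1" "oRe (x + y) = oRe x + oRe y" "oRe (r *\<^sub>R x) = r * oRe x"
  "oRe (x * ocnj y) = x \<bullet> y" "oRe (ocnj x * y) = x \<bullet> y"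
  by (simp add: oRe.rep_eq one_octonion.rep_eq)
    (simp_all add: inner_octonion_def, (transfer; auto simp: algebra_simps)+)

lemma albert_cases: obtains d1 d2 d3 x y z where "a = mk d1 d2 d3 x y z"
proof -
  define R where "R = Rep_albert a"
  have "omat_adjoint R = R"
    using Rep_albert[of a] by (simp add: R_def)
  then have adj: "R $ j $ i = ocnj (R $ i $ j)" for i j
    by (simp add: omat_adjoint_def vec_eq_iff)
  have diag: "R $ i $ i = oRe (R $ i $ i) *\<^sub>R 1" for i
  proof -
    have "2 *\<^sub>R R $ i $ i = 2 *\<^sub>R (oRe (R $ i $ i) *\<^sub>R 1)"
      using adj[of i i] ocnj_eq[of "R $ i $ i"] by (simp add: scaleR_2 algebra_simps)
    then show ?thesis
      unfolding scaleR_cancel_left by simp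
  qed
  have "a = mk (oRe (R $ 1 $ 1)) (oRe (R $ 2 $ 2)) (oRe (R $ 3 $ 3)) (R $ 1 $ 2) (R $ 2 $ 3) (R $ 1 $ 3)"
    using adj[of 1 2] adj[of 2 3] adj[of 1 3] diag[symmetric] by (simp add: Rep_albert_inject[symmetric] mk.rep_eq R_def[symmetric] vec_eq_iff forall_3)
  then show ?thesis by (rule that)
qed

lemma mk_eq_iff [simp]:
  "mk d1 d2 d3 x y z = mk e1 e2 e3 x' y' z' \<longleftrightarrow> d1 = e1 \<and> d2 = e2 \<and> d3 = e3 \<and> x = x' \<and> y = y' \<and> z = z'"
  by (auto simp: Rep_albert_inject[symmetric] mk.rep_eq vec_eq_iff forall_3)

lemma mk_arith:
  "mk d1 d2 d3 x y z + mk e1 e2 e3 x' y' z' = mk (d1 + e1) (d2 + e2) (d3 + e3) (x + x') (y + y') (z + z')"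
  "mk d1 d2 d3 x y z - mk e1 e2 e3 x' y' z' = mk (d1 - e1) (d2 - e2) (d3 - e3) (x - x') (y - y') (z - z')"
  "- mk d1 d2 d3 x y z = mk (- d1) (- d2) (- d3) (- x) (- y) (- z)"
  "r *\<^sub>R mk d1 d2 d3 x y z = mk (r * d1) (r * d2) (r * d3) (r *\<^sub>R x) (r *\<^sub>R y) (r *\<^sub>R z)"
  "0 = mk 0 0 0 0 0 0" "1 = mk 1 1 1 0 0 0"
  by (simp_all add: Rep_albert_inject[symmetric] mk.rep_eq vec_eq_iff forall_3 plus_albert.rep_eq
      minus_albert.rep_eq uminus_albert.rep_eq scaleR_albert.rep_eq zero_albert.rep_eq one_albert.rep_eq
      algebra_simps)

lemma tr_mk [simp]: "tr (mk d1 d2 d3 x y z) = d1 + d2 + d3"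
  by (simp add: tr.rep_eq mk.rep_eq sum_3 oRe_simps)

lemma albert_eqI:
  assumes "oRe (Rep_albert a $ 1 $ 1) = oRe (Rep_albert b $ 1 $ 1)" "oRe (Rep_albert a $ 2 $ 2) = oRe (Rep_albert b $ 2 $ 2)"
    "oRe (Rep_albert a $ 3 $ 3) = oRe (Rep_albert b $ 3 $ 3)" "Rep_albert a $ 1 $ 2 = Rep_albert b $ 1 $ 2"
    "Rep_albert a $ 2 $ 3 = Rep_albert b $ 2 $ 3" "Rep_albert a $ 1 $ 3 = Rep_albert b $ 1 $ 3"
  shows "a = b"
  using assms by (cases a rule: albert_cases, cases b rule: albert_cases) (simp add: mk.rep_eq oRe_simps)

text \<open>With \<open>x\<close>, \<open>y\<close>, \<open>z\<close> at the positions (1,2), (2,3),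
  (1,3), the last entry of the product receives \<open>x * y'\<close> without conjugation. The
  relation between the three component maps in \<open>frame_fixing_form\<close> comes from this
  entry.\<close>

lemma jordan_mk:
  "mk d1 d2 d3 x y z \<circ>\<^sub>J mk e1 e2 e3 x' y' z' =
    mk (d1 * e1 + x \<bullet> x' + z \<bullet> z') (d2 * e2 + x \<bullet> x' + y \<bullet> y') (d3 * e3 + y \<bullet> y' + z \<bullet> z')
      ((1 / 2) *\<^sub>R ((d1 + d2) *\<^sub>R x' + (e1 + e2) *\<^sub>R x + z * ocnj y' + z' * ocnj y))
      ((1 / 2) *\<^sub>R ((d2 + d3) *\<^sub>R y' + (e2 + e3) *\<^sub>R y + ocnj x * z' + ocnj x' * z))
      ((1 / 2) *\<^sub>R ((d1 + d3) *\<^sub>R z' + (e1 + e3) *\<^sub>R z + x * y' + x' * y))"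
  by (rule albert_eqI)
    (simp_all add: mk.rep_eq jordan.rep_eq omat_mult_def sum_3 oct.scaleR_left oct.scaleR_right algebra_simps
      oRe_simps inner_commute)

lemma inner_tr_mk: "tr (mk d1 d2 d3 x y z \<circ>\<^sub>J mk e1 e2 e3 x' y' z')
    = d1 * e1 + d2 * e2 + d3 * e3 + 2 * (x \<bullet> x') + 2 * (y \<bullet> y') + 2 * (z \<bullet> z')"
  by (simp add: jordan_mk)

instantiation albert :: real_inner
begin
definition inner_albert :: "albert \<Rightarrow> albert \<Rightarrow> real" where
  "inner_albert a b = tr (a \<circ>\<^sub>J b)"
instance
proof
  fix a b c :: albert and r :: real
  show "a \<bullet> b = b \<bullet> a"
    by (cases a rule: albert_cases, cases b rule: albert_cases)
      (simp add: inner_albert_def inner_tr_mk inner_commute mult.commute)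
  show "(a + b) \<bullet> c = a \<bullet> c + b \<bullet> c"
    by (cases a rule: albert_cases, cases b rule: albert_cases, cases c rule: albert_cases)
      (simp add: inner_albert_def inner_tr_mk mk_arith algebra_simps)
  show "(r *\<^sub>R a) \<bullet> b = r * (a \<bullet> b)"
    by (cases a rule: albert_cases, cases b rule: albert_cases)
      (simp add: inner_albert_def inner_tr_mk mk_arith algebra_simps)
  have *: "a \<bullet> a = (norm a)\<^sup>2"
    by (cases a rule: albert_cases)
      (simp add: inner_albert_def inner_tr_mk norm_albert.rep_eq mk.rep_eq norm_vec_def L2_set_def sum_3
        sum_nonneg power2_norm_eq_inner power2_eq_square flip: power2_norm_eq_inner)
  show "0 \<le> a \<bullet> a" "(a \<bullet> a = 0) = (a = 0)" "norm a = sqrt (a \<bullet> a)"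
    unfolding * by simp_all
qed
end

lemma inner_mk [simp]: "mk d1 d2 d3 x y z \<bullet> mk e1 e2 e3 x' y' z'
    = d1 * e1 + d2 * e2 + d3 * e3 + 2 * (x \<bullet> x') + 2 * (y \<bullet> y') + 2 * (z \<bullet> z')"
  by (simp add: inner_albert_def inner_tr_mk)

lemma tr_eq_inner: "tr a = 1 \<bullet> a"
  by (cases a rule: albert_cases) (simp add: mk_arith)

lemma bilinear_jordan: "bilinear (\<circ>\<^sub>J)"
  unfolding bilinear_def
proof (intro conjI allI linearI)
  fix a a' b b' :: albert and r
  show "(a + a') \<circ>\<^sub>J b = a \<circ>\<^sub>J b + a' \<circ>\<^sub>J b" "a \<circ>\<^sub>J (b + b') = a \<circ>\<^sub>J b + a \<circ>\<^sub>J b'"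
    by (cases a rule: albert_cases, cases a' rule: albert_cases, cases b rule: albert_cases, cases b' rule: albert_cases;
      simp add: jordan_mk mk_arith inner_simps oct.add_left oct.add_right algebra_simps)+
  show "(r *\<^sub>R a) \<circ>\<^sub>J b = r *\<^sub>R (a \<circ>\<^sub>J b)" "a \<circ>\<^sub>J (r *\<^sub>R b) = r *\<^sub>R (a \<circ>\<^sub>J b)"
    by (cases a rule: albert_cases, cases b rule: albert_cases;
      simp add: jordan_mk mk_arith inner_simps oct.scaleR_left oct.scaleR_right algebra_simps)+
qed

lemma jordan_commute: "a \<circ>\<^sub>J b = b \<circ>\<^sub>J a"
  by (cases a rule: albert_cases, cases b rule: albert_cases) (simp add: jordan_mk inner_commute algebra_simps)

lemma one_jordan: "1 \<circ>\<^sub>J a = a"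
  by (cases a rule: albert_cases) (simp add: jordan_mk mk_arith oct.zero_left oct.zero_right algebra_simps flip: scaleR_2)

lemmas jordan_simps = bilinear_ladd[OF bilinear_jordan] bilinear_radd[OF bilinear_jordan]
  bilinear_lmul[OF bilinear_jordan] bilinear_rmul[OF bilinear_jordan]
  bilinear_lzero[OF bilinear_jordan] bilinear_rzero[OF bilinear_jordan]
  bilinear_lsub[OF bilinear_jordan] bilinear_rsub[OF bilinear_jordan]

lemma jordan_inner: "(a \<circ>\<^sub>J b) \<bullet> 1 = a \<bullet> b"
  by (simp add: inner_albert_def jordan_commute[of _ 1] one_jordan)

text \<open>Preserving the trace as well as the product gives invariance of the inner product at
  once. The inclusion in \<open>G\<close> is the direction that matters: one-parameter groups inside
  \<open>autos\<close> have generators in \<open>Lie_G\<close>.\<close>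

definition autos :: "(albert \<Rightarrow> albert) set" where
  "autos = {h. linear h \<and> bij h \<and> (\<forall>a b. h (a \<circ>\<^sub>J b) = h a \<circ>\<^sub>J h b) \<and> (\<forall>a. tr (h a) = tr a)}"

lemma autos_subset_G: "autos \<subseteq> G"
  by (auto simp: autos_def G_def)

lemma autosD:
  assumes "h \<in> autos"
  shows "linear h" "bij h" "h (a \<circ>\<^sub>J b) = h a \<circ>\<^sub>J h b" "tr (h a) = tr a"
  using assms by (auto simp: autos_def)

lemma autos_inner: "h \<in> autos \<Longrightarrow> h a \<bullet> h b = a \<bullet> b"
  using autosD(3)[of h a b] autosD(4)[of h "a \<circ>\<^sub>J b"] by (simp add: inner_albert_def)

lemma autos_one:
  assumes "h \<in> autos" shows "h 1 = 1"
proof -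
  obtain c where c: "h c = 1"
    using autosD(2)[OF assms] by (metis bij_pointE)
  have "h 1 = h 1 \<circ>\<^sub>J h c"
    by (simp add: c jordan_commute[of _ 1] one_jordan)
  also have "\<dots> = h (1 \<circ>\<^sub>J c)"
    by (rule autosD(3)[OF assms, symmetric])
  finally show ?thesis
    by (simp add: one_jordan c)
qed

lemma autosI:
  assumes "linear h" "\<And>a. k (h a) = a" "\<And>a. h (k a) = a" "\<And>a b. h (a \<circ>\<^sub>J b) = h a \<circ>\<^sub>J h b" "\<And>a. tr (h a) = tr a"
  shows "h \<in> autos"
  using assms by (auto simp: autos_def intro!: o_bij[of k h])

lemma autos_comp: "h \<in> autos \<Longrightarrow> k \<in> autos \<Longrightarrow> h \<circ> k \<in> autos"
  by (auto simp: autos_def intro: linear_compose bij_comp)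

section \<open>One-parameter groups of automorphisms\<close>

text \<open>Only scalar pairings are differentiated, so one-variable calculus suffices. Skewness and
  the bound on \<open>D\<close> feed the Taylor estimate of \<open>one_param_Lie\<close>.\<close>

definition one_param :: "(real \<Rightarrow> albert \<Rightarrow> albert) \<Rightarrow> (albert \<Rightarrow> albert) \<Rightarrow> bool" where
  "one_param \<gamma> D \<longleftrightarrow> linear D \<and> (\<forall>a b. D a \<bullet> b = - (a \<bullet> D b)) \<and> (\<exists>C. \<forall>a. norm (D a) \<le> C * norm a) \<and> \<gamma> 0 = id \<and> (\<forall>\<theta>. \<gamma> \<theta> \<in> autos) \<and>
     (\<forall>\<theta> a b. ((\<lambda>\<theta>. \<gamma> \<theta> a \<bullet> b) has_real_derivative (D (\<gamma> \<theta> a) \<bullet> b)) (at \<theta>))"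

lemma one_paramD:
  assumes "one_param \<gamma> D"
  shows "linear D" "D a \<bullet> b = - (a \<bullet> D b)" "\<gamma> 0 a = a" "\<gamma> \<theta> \<in> autos"
    "((\<lambda>\<theta>. \<gamma> \<theta> a \<bullet> b) has_real_derivative (D (\<gamma> \<theta> a) \<bullet> b)) (at \<theta>)"
  using assms by (auto simp: one_param_def)

lemma one_param_one:
  assumes "one_param \<gamma> D"
  shows "D 1 = 0"
proof -
  have "D 1 \<bullet> b = 0" for b
  proof -
    have "\<gamma> \<theta> 1 = 1" for \<theta>
      by (rule autos_one[OF one_paramD(4)[OF assms]])
    then have "((\<lambda>\<theta>. 1 \<bullet> b) has_real_derivative (D 1 \<bullet> b)) (at 0)"
      using one_paramD(5)[OF assms, of 1 b 0] by simp
    then show ?thesis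
      using DERIV_unique DERIV_const by blast
  qed
  from this[of "D 1"] show ?thesis by simp
qed

definition "c1 a = oRe (Rep_albert a $ 1 $ 1)"
definition "c2 a = oRe (Rep_albert a $ 2 $ 2)"
definition "c3 a = oRe (Rep_albert a $ 3 $ 3)"
definition "cx a = Rep_albert a $ 1 $ 2"
definition "cy a = Rep_albert a $ 2 $ 3"
definition "cz a = Rep_albert a $ 1 $ 3"

lemma coords_mk [simp]:
  "c1 (mk d1 d2 d3 x y z) = d1" "c2 (mk d1 d2 d3 x y z) = d2" "c3 (mk d1 d2 d3 x y z) = d3"
  "cx (mk d1 d2 d3 x y z) = x" "cy (mk d1 d2 d3 x y z) = y" "cz (mk d1 d2 d3 x y z) = z"
  by (simp_all add: c1_def c2_def c3_def cx_def cy_def cz_def mk.rep_eq oRe_simps)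

lemma norm_mk_le: "norm (mk d1 d2 d3 x y z) \<le> \<bar>d1\<bar> + \<bar>d2\<bar> + \<bar>d3\<bar> + 2 * (norm x + norm y + norm z)"
proof (rule power2_le_imp_le)
  show "(norm (mk d1 d2 d3 x y z))\<^sup>2 \<le> (\<bar>d1\<bar> + \<bar>d2\<bar> + \<bar>d3\<bar> + 2 * (norm x + norm y + norm z))\<^sup>2"
    unfolding power2_norm_eq_inner inner_mk
    by (simp add: dot_square_norm power2_eq_square algebra_simps)
qed simp

lemma mk_coords_le:
  "\<bar>d1\<bar> \<le> norm (mk d1 d2 d3 x y z) \<and> \<bar>d2\<bar> \<le> norm (mk d1 d2 d3 x y z) \<and> \<bar>d3\<bar> \<le> norm (mk d1 d2 d3 x y z)
    \<and> norm x \<le> norm (mk d1 d2 d3 x y z) \<and> norm y \<le> norm (mk d1 d2 d3 x y z) \<and> norm z \<le> norm (mk d1 d2 d3 x y z)"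
proof -
  have *: "(norm (mk d1 d2 d3 x y z))\<^sup>2 = d1\<^sup>2 + d2\<^sup>2 + d3\<^sup>2 + 2 * (norm x)\<^sup>2 + 2 * (norm y)\<^sup>2 + 2 * (norm z)\<^sup>2"
    unfolding power2_norm_eq_inner inner_mk by (simp add: power2_eq_square)
  have **: "0 \<le> d1\<^sup>2" "0 \<le> d2\<^sup>2" "0 \<le> d3\<^sup>2" "0 \<le> (norm x)\<^sup>2" "0 \<le> (norm y)\<^sup>2" "0 \<le> (norm z)\<^sup>2"
    by simp_all
  show ?thesis
    by (intro conjI; rule power2_le_imp_le) (use * ** in simp_all)
qed

section \<open>Unit octonions acting by Moufang triples\<close>

definition triality :: "octonion \<Rightarrow> albert \<Rightarrow> albert" where
  "triality u a = mk (c1 a) (c2 a) (c3 a) ((u * cx a) * u) (ocnj u * cy a) (u * cz a)"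

definition triality_gen :: "octonion \<Rightarrow> albert \<Rightarrow> albert" where
  "triality_gen e a = mk 0 0 0 (e * cx a + cx a * e) (- (e * cy a)) (e * cz a)"

lemma triality_mk [simp]:
  "triality u (mk d1 d2 d3 x y z) = mk d1 d2 d3 ((u * x) * u) (ocnj u * y) (u * z)"
  "triality_gen u (mk d1 d2 d3 x y z) = mk 0 0 0 (u * x + x * u) (- (u * y)) (u * z)"
  by (simp_all add: triality_def triality_gen_def)

lemma octonion_Moufang_middle: "(u * x) * (y * u) = (u * (x * y)) * u" for u x y :: octonion
  by (transfer; auto simp: algebra_simps complex_eq_iff)

lemma octonion_alternative':
  "x * (ocnj x * y) = (x \<bullet> x) *\<^sub>R y" "(y * ocnj x) * x = (x \<bullet> x) *\<^sub>R y"
  using octonion_alternative(1)[of "ocnj x" y] octonion_alternative(2)[of y "ocnj x"] by simp_all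

lemma octonion_isometry:
  fixes u x y :: octonion
  shows "(u * x) \<bullet> (u * y) = (u \<bullet> u) * (x \<bullet> y)" "(x * u) \<bullet> (y * u) = (u \<bullet> u) * (x \<bullet> y)"
  by (simp_all add: octonion_mult_inner(1)[of u x] octonion_mult_inner(2)[of x u] octonion_alternative)

text \<open>The three off-diagonal entries of the Jordan product ask for the three identities named
  \<open>x\<close>, \<open>y\<close>, \<open>z\<close> below. Each is a Moufang identity combined
  with the fact that \<open>ocnj u\<close> undoes multiplication by the unit
  \<open>u\<close>.\<close>

lemma triality_autos:
  assumes "u \<bullet> u = 1"
  shows "triality u \<in> autos"
proof (rule autosI[of _ "triality (ocnj u)"])
  have inv: "triality (ocnj v) (triality v a) = a" if "v \<bullet> v = 1" for v a
    by (cases a rule: albert_cases)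
      (simp add: that octonion_alternative octonion_alternative' octonion_flexible)
  show "triality (ocnj u) (triality u a) = a" "triality u (triality (ocnj u) a) = a" for a
    using inv[of u a] inv[of "ocnj u" a] assms by simp_all
  show "linear (triality u)"
  proof (rule linearI)
    show "triality u (a + b) = triality u a + triality u b" for a b
      by (cases a rule: albert_cases, cases b rule: albert_cases) (simp add: mk_arith octonion_distrib)
    show "triality u (r *\<^sub>R a) = r *\<^sub>R triality u a" for r a
      by (cases a rule: albert_cases) (simp add: mk_arith oct.scaleR_left oct.scaleR_right)
  qed
  show "tr (triality u a) = tr a" for a
    by (cases a rule: albert_cases) simp
  have x: "u * z * (ocnj y * u) = (u * (z * ocnj y)) * u" for z y
    by (rule octonion_Moufang_middle)
  have y: "(ocnj u * (ocnj x * ocnj u)) * (u * z) = ocnj u * (ocnj x * z)" for x z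
    using octonion_Moufang[of "ocnj u" "ocnj x" "u * z"] assms
    by (simp add: octonion_alternative octonion_flexible)
  have z: "((u * x) * u) * (ocnj u * y) = u * (x * y)" for x y
    using octonion_Moufang[of u x "ocnj u * y"] assms by (simp add: octonion_alternative')
  show "triality u (a \<circ>\<^sub>J b) = triality u a \<circ>\<^sub>J triality u b" for a b
    by (cases a rule: albert_cases, cases b rule: albert_cases)
      (simp add: jordan_mk octonion_isometry assms ocnj_mult x y z octonion_distrib oct.scaleR_left oct.scaleR_right)
qed

text \<open>The pairing along the path of \<open>one_param_triality\<close> with every inner product
  replaced by a constant, so that differentiation meets trigonometric functions only.\<close>

lemma DERIV_trig:
  "((\<lambda>t. p1 * q1 + p2 * q2 + p3 * q3 + 2 * (cos t * cos t * a0 + cos t * sin t * (a1 + a1') + sin t * sin t * a2)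
      + 2 * (cos t * b0 - sin t * b1) + 2 * (cos t * l0 + sin t * l1)) has_real_derivative
    2 * ((cos \<theta> * cos \<theta> - sin \<theta> * sin \<theta>) * (a1 + a1') + 2 * (cos \<theta> * sin \<theta>) * (a2 - a0))
      - 2 * (sin \<theta> * b0 + cos \<theta> * b1) + 2 * (cos \<theta> * l1 - sin \<theta> * l0)) (at \<theta>)"
  by (auto intro!: derivative_eq_intros simp: algebra_simps)

text \<open>For an imaginary unit, alternativity gives \<open>e * (e * x) = - x\<close>, and
  flexibility reduces products with three factors \<open>e\<close>. Hence the derivative at every
  angle, not only at 0, is the generator applied to the moved element.\<close>

lemma one_param_triality:
  assumes e: "e \<bullet> e = 1" "oRe e = 0"
  shows "one_param (\<lambda>\<theta>. triality (cos \<theta> *\<^sub>R 1 + sin \<theta> *\<^sub>R e)) (triality_gen e)"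
  unfolding one_param_def
proof (intro conjI allI)
  have cn: "ocnj e = - e"
    using ocnj_eq[of e] e by simp
  have ee: "e * (e * x) = - x" "(x * e) * e = - x" for x
    using octonion_alternative(1)[of e x] octonion_alternative(2)[of x e] e
    by (simp_all add: cn oct.minus_left oct.minus_right minus_equation_iff[of _ x] eq_commute[of x])
  show "linear (triality_gen e)"
  proof (rule linearI)
    show "triality_gen e (a + b) = triality_gen e a + triality_gen e b" for a b
      by (cases a rule: albert_cases, cases b rule: albert_cases) (simp add: mk_arith octonion_distrib)
    show "triality_gen e (r *\<^sub>R a) = r *\<^sub>R triality_gen e a" for r a
      by (cases a rule: albert_cases)
        (simp add: mk_arith oct.scaleR_left oct.scaleR_right scaleR_add_right)
  qed
  show "triality_gen e a \<bullet> b = - (a \<bullet> triality_gen e b)" for a b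
    by (cases a rule: albert_cases, cases b rule: albert_cases)
      (simp add: inner_simps octonion_mult_inner(1)[of e] octonion_mult_inner(2)[of _ e] cn
        oct.minus_left oct.minus_right)
  show "\<exists>C. \<forall>a. norm (triality_gen e a) \<le> C * norm a"
  proof (intro exI allI)
    fix a
    obtain d1 d2 d3 x y z where a: "a = mk d1 d2 d3 x y z"
      by (rule albert_cases)
    have "norm e = 1"
      using e by (simp add: norm_eq_sqrt_inner)
    then have "norm (e * x + x * e) \<le> 2 * norm x"
      using norm_triangle_ineq[of "e * x" "x * e"] by (simp add: octonion_norm_mult)
    then show "norm (triality_gen e a) \<le> 8 * norm a"
      using norm_mk_le[of 0 0 0 "e * x + x * e" "- (e * y)" "e * z"] mk_coords_le[of d1 d2 d3 x y z] \<open>norm e = 1\<close>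
      by (simp add: a octonion_norm_mult)
  qed
  show "triality (cos 0 *\<^sub>R 1 + sin 0 *\<^sub>R e) = id"
  proof
    show "triality (cos 0 *\<^sub>R 1 + sin 0 *\<^sub>R e) a = id a" for a
      by (cases a rule: albert_cases) simp
  qed
  show "triality (cos \<theta> *\<^sub>R 1 + sin \<theta> *\<^sub>R e) \<in> autos" for \<theta>
    using e by (intro triality_autos) (simp add: inner_simps inner_1_octonion oRe_simps flip: power2_eq_square)
  show "((\<lambda>\<theta>. triality (cos \<theta> *\<^sub>R 1 + sin \<theta> *\<^sub>R e) a \<bullet> b) has_real_derivative
      triality_gen e (triality (cos \<theta> *\<^sub>R 1 + sin \<theta> *\<^sub>R e) a) \<bullet> b) (at \<theta>)" for \<theta> a b
  proof (cases a rule: albert_cases, cases b rule: albert_cases)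
    fix d1 d2 d3 x y z e1 e2 e3 x' y' z'
    assume ab: "a = mk d1 d2 d3 x y z" "b = mk e1 e2 e3 x' y' z'"
    have xe: "(((cos t *\<^sub>R 1 + sin t *\<^sub>R e) * x) * (cos t *\<^sub>R 1 + sin t *\<^sub>R e))
        = (cos t * cos t) *\<^sub>R x + (cos t * sin t) *\<^sub>R (e * x + x * e) + (sin t * sin t) *\<^sub>R ((e * x) * e)" for t
      by (simp add: octonion_distrib oct.scaleR_left oct.scaleR_right scaleR_add_right algebra_simps)
    have ye: "ocnj (cos t *\<^sub>R 1 + sin t *\<^sub>R e) * y = cos t *\<^sub>R y - sin t *\<^sub>R (e * y)" for t
      by (simp add: cn octonion_distrib oct.scaleR_left oct.minus_left oct.diff_left)
    have ze: "(cos t *\<^sub>R 1 + sin t *\<^sub>R e) * z = cos t *\<^sub>R z + sin t *\<^sub>R (e * z)" for t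
      by (simp add: octonion_distrib oct.scaleR_left)
    have exe: "e * ((e * x) * e) = - (x * e)" "((e * x) * e) * e = - (e * x)" "e * (x * e) = (e * x) * e"
      by (simp_all add: ee octonion_flexible oct.minus_right)
    have X: "e * (p *\<^sub>R x + q *\<^sub>R (e * x + x * e) + r *\<^sub>R ((e * x) * e))
           + (p *\<^sub>R x + q *\<^sub>R (e * x + x * e) + r *\<^sub>R ((e * x) * e)) * e
        = (p - r) *\<^sub>R (e * x + x * e) + (q *\<^sub>R ((e * x) * e - x) + q *\<^sub>R ((e * x) * e - x))" for p q r
      by (simp only: octonion_distrib oct.scaleR_left oct.scaleR_right exe ee)
        (simp only: scaleR_add_right scaleR_diff_right scaleR_diff_left scaleR_minus_right, simp add: ac_simps)
    have Y: "e * (p *\<^sub>R v + q *\<^sub>R (e * v)) = p *\<^sub>R (e * v) - q *\<^sub>R v"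
      "e * (p *\<^sub>R v - q *\<^sub>R (e * v)) = p *\<^sub>R (e * v) + q *\<^sub>R v" for p q v
      by (simp_all add: octonion_distrib oct.scaleR_right oct.diff_right ee)
    show ?thesis
      unfolding ab triality_mk inner_mk xe ye ze X Y inner_simps
      by (rule DERIV_cong[OF DERIV_trig], simp add: inner_simps algebra_simps)
  qed
qed

section \<open>Conjugation by real orthogonal matrices\<close>

definition lm :: "real^3^3 \<Rightarrow> octonion^3^3 \<Rightarrow> octonion^3^3" where
  "lm g a = (\<chi> i j. \<Sum>k\<in>UNIV. g $ i $ k *\<^sub>R a $ k $ j)"

definition rm :: "octonion^3^3 \<Rightarrow> real^3^3 \<Rightarrow> octonion^3^3" where
  "rm a g = (\<chi> i j. \<Sum>k\<in>UNIV. g $ k $ j *\<^sub>R a $ i $ k)"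

text \<open>Real scalars commute and associate with all octonions, so real matrices behave
  associatively next to octonionic ones. This is what makes \<open>rconj\<close> of an orthogonal
  matrix an automorphism.\<close>

lemma lm_rm:
  "lm (g ** h) a = lm g (lm h a)" "rm a (g ** h) = rm (rm a g) h" "lm g (rm a h) = rm (lm g a) h"
  "lm (mat 1) a = a" "rm a (mat 1) = a"
  "omat_adjoint (lm g a) = rm (omat_adjoint a) (transpose g)"
  "omat_adjoint (rm a g) = lm (transpose g) (omat_adjoint a)"
  "omat_mult (lm g a) b = lm g (omat_mult a b)" "omat_mult a (rm b g) = rm (omat_mult a b) g"
  "omat_mult (rm a g) b = omat_mult a (lm g b)"
  by (simp_all add: vec_eq_iff forall_3 lm_def rm_def omat_adjoint_def omat_mult_def transpose_def mat_def
      matrix_matrix_mult_def sum_3 oct.scaleR_left oct.scaleR_right octonion_distrib algebra_simps)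

lemma lm_linear: "lm g (a + b) = lm g a + lm g b" "lm g (r *\<^sub>R a) = r *\<^sub>R lm g a"
  "rm (a + b) g = rm a g + rm b g" "rm (r *\<^sub>R a) g = r *\<^sub>R rm a g"
  by (simp_all add: vec_eq_iff lm_def rm_def sum.distrib scaleR_add_right scaleR_sum_right mult.commute)

lift_definition rconj :: "real^3^3 \<Rightarrow> albert \<Rightarrow> albert" is "\<lambda>g a. lm g (rm a (transpose g))"
  by (simp add: lm_rm)

lemma rconj_autos:
  assumes "orthogonal_matrix g"
  shows "rconj g \<in> autos"
proof (rule autosI[of _ "rconj (transpose g)"])
  note g = assms[unfolded orthogonal_matrix_def]
  note rep = Rep_albert_inject[symmetric] rconj.rep_eq jordan.rep_eq plus_albert.rep_eq scaleR_albert.rep_eq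
  show "linear (rconj g)"
    by (rule linearI) (simp_all add: rep lm_linear)
  show "rconj (transpose g) (rconj g a) = a" "rconj g (rconj (transpose g) a) = a" for a
    by (simp_all add: rep lm_rm(3)) (simp_all add: lm_rm(1,2)[symmetric] g lm_rm(4,5))
  show "rconj g (a \<circ>\<^sub>J b) = rconj g a \<circ>\<^sub>J rconj g b" for a b
  proof -
    have "omat_mult (lm g (rm a (transpose g))) (lm g (rm b (transpose g))) = lm g (rm (omat_mult a b) (transpose g))" for a b
      by (simp add: lm_rm(8,10) lm_rm(1)[symmetric] g lm_rm(4,9))
    then show ?thesis
      by (simp add: rep lm_linear)
  qed
  show "tr (rconj g a) = tr a" for a
  proof -
    have "(transpose g ** g) $ k $ l = (if k = l then 1 else 0)" for k l
      using g by (simp add: mat_def)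
    then have gg: "g $ 1 $ k * g $ 1 $ l + g $ 2 $ k * g $ 2 $ l + g $ 3 $ k * g $ 3 $ l = (if k = l then 1 else 0)" for k l
      by (simp add: matrix_matrix_mult_def transpose_def sum_3)
    have "tr (rconj g a) = (\<Sum>k\<in>UNIV. \<Sum>l\<in>UNIV.
        (g $ 1 $ k * g $ 1 $ l + g $ 2 $ k * g $ 2 $ l + g $ 3 $ k * g $ 3 $ l) * oRe (Rep_albert a $ k $ l))"
      by (simp add: tr.rep_eq rconj.rep_eq lm_def rm_def sum_3 transpose_def oRe_simps algebra_simps)
    then show ?thesis
      by (simp add: gg tr.rep_eq if_distrib if_distribR cong: if_cong)
  qed
qed

definition rot12 :: "real \<Rightarrow> real^3^3" where
  "rot12 t = vector [vector [cos t, - sin t, 0], vector [sin t, cos t, 0], vector [0, 0, 1]]"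

definition rot23 :: "real \<Rightarrow> real^3^3" where
  "rot23 t = vector [vector [1, 0, 0], vector [0, cos t, - sin t], vector [0, sin t, cos t]]"

lemma orthogonal_rot: "orthogonal_matrix (rot12 t)" "orthogonal_matrix (rot23 t)"
  by (simp_all add: orthogonal_matrix rot12_def rot23_def vec_eq_iff forall_3 matrix_matrix_mult_def sum_3
      transpose_def mat_def flip: power2_eq_square)

lemma oRe_ocnj [simp]: "oRe (ocnj x) = oRe x"
  using ocnj_inner[of x 1] by (simp add: inner_1_octonion)

lemma oRe_diff: "oRe (x - y) = oRe x - oRe y"
  using oRe_simps(2)[of x "(-1) *\<^sub>R y"] by (simp only: oRe_simps(3)) simp

lemma rconj_rot:
  "rconj (rot12 t) (mk d1 d2 d3 x y z) =
    mk (cos t * cos t * d1 - 2 * (cos t * sin t) * oRe x + sin t * sin t * d2)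
       (sin t * sin t * d1 + 2 * (cos t * sin t) * oRe x + cos t * cos t * d2) d3
       ((cos t * sin t * (d1 - d2)) *\<^sub>R 1 + (cos t * cos t) *\<^sub>R x - (sin t * sin t) *\<^sub>R ocnj x)
       (sin t *\<^sub>R z + cos t *\<^sub>R y) (cos t *\<^sub>R z - sin t *\<^sub>R y)"
  "rconj (rot23 t) (mk d1 d2 d3 x y z) =
    mk d1 (cos t * cos t * d2 - 2 * (cos t * sin t) * oRe y + sin t * sin t * d3)
       (sin t * sin t * d2 + 2 * (cos t * sin t) * oRe y + cos t * cos t * d3)
       (cos t *\<^sub>R x - sin t *\<^sub>R z)
       ((cos t * sin t * (d2 - d3)) *\<^sub>R 1 + (cos t * cos t) *\<^sub>R y - (sin t * sin t) *\<^sub>R ocnj y)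
       (sin t *\<^sub>R x + cos t *\<^sub>R z)"
  by (rule albert_eqI; simp add: rconj.rep_eq mk.rep_eq lm_def rm_def sum_3 transpose_def rot12_def rot23_def
      oRe_simps oRe_diff algebra_simps)+

lemma inner_ocnj: "ocnj x \<bullet> y = 2 * oRe x * oRe y - x \<bullet> y"
  by (simp add: ocnj_eq inner_simps inner_1_octonion)

text \<open>The derivative at \<open>t = 0\<close> of the explicit formula in
  \<open>rconj_rot\<close>; likewise for \<open>rot23_gen\<close>.\<close>

definition rot12_gen :: "albert \<Rightarrow> albert" where
  "rot12_gen a = mk (- 2 * oRe (cx a)) (2 * oRe (cx a)) 0 ((c1 a - c2 a) *\<^sub>R 1) (cz a) (- cy a)"

definition rot23_gen :: "albert \<Rightarrow> albert" where
  "rot23_gen a = mk 0 (- 2 * oRe (cy a)) (2 * oRe (cy a)) (- cz a) ((c2 a - c3 a) *\<^sub>R 1) (cx a)"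

lemma abs_oRe_le: "\<bar>oRe x\<bar> \<le> norm x"
  using Cauchy_Schwarz_ineq2[of x 1] by (simp add: inner_1_octonion)

lemma one_param_rot:
  "one_param (\<lambda>t. rconj (rot12 t)) rot12_gen" "one_param (\<lambda>t. rconj (rot23 t)) rot23_gen"
proof -
  have id: "rconj (rot12 0) = id" "rconj (rot23 0) = id"
  proof -
    have "rconj (rot12 0) a = id a" "rconj (rot23 0) a = id a" for a
      by (cases a rule: albert_cases; simp add: rconj_rot)+
    then show "rconj (rot12 0) = id" "rconj (rot23 0) = id" by blast+
  qed
  have lin: "linear rot12_gen" "linear rot23_gen"
  proof -
    have "rot12_gen (a + b) = rot12_gen a + rot12_gen b" "rot23_gen (a + b) = rot23_gen a + rot23_gen b" for a b
      by (cases a rule: albert_cases, cases b rule: albert_cases;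
        simp add: rot12_gen_def rot23_gen_def mk_arith oRe_simps algebra_simps)+
    moreover have "rot12_gen (r *\<^sub>R a) = r *\<^sub>R rot12_gen a" "rot23_gen (r *\<^sub>R a) = r *\<^sub>R rot23_gen a" for r a
      by (cases a rule: albert_cases; simp add: rot12_gen_def rot23_gen_def mk_arith oRe_simps algebra_simps)+
    ultimately show "linear rot12_gen" "linear rot23_gen"
      by (auto intro!: linearI)
  qed
  have skew: "rot12_gen a \<bullet> b = - (a \<bullet> rot12_gen b)" "rot23_gen a \<bullet> b = - (a \<bullet> rot23_gen b)" for a b
    by (cases a rule: albert_cases, cases b rule: albert_cases;
      simp add: rot12_gen_def rot23_gen_def inner_simps inner_1_octonion algebra_simps)+
  have bd: "norm (rot12_gen a) \<le> 20 * norm a" "norm (rot23_gen a) \<le> 20 * norm a" for a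
  proof -
    obtain d1 d2 d3 x y z where a: "a = mk d1 d2 d3 x y z"
      by (rule albert_cases)
    have le: "\<bar>d1\<bar> \<le> norm a" "\<bar>d2\<bar> \<le> norm a" "\<bar>d3\<bar> \<le> norm a"
      "norm x \<le> norm a" "norm y \<le> norm a" "norm z \<le> norm a"
      unfolding a by (simp_all only: mk_coords_le)
    \<comment> \<open>The terms add up to at most \<open>12 * n\<close>; any constant would serve,
      as only the existence of a bound enters \<open>one_param\<close>.\<close>
    have bound: "N \<le> 4 * u + (2 * v + 2 * n1 + 2 * n2) \<Longrightarrow> u \<le> n3 \<Longrightarrow> v \<le> p + q \<Longrightarrow> p \<le> n \<Longrightarrow> q \<le> n \<Longrightarrow>
      n1 \<le> n \<Longrightarrow> n2 \<le> n \<Longrightarrow> n3 \<le> n \<Longrightarrow> 0 \<le> n \<Longrightarrow> N \<le> 20 * n" for N u v n1 n2 n3 p q n :: real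
      by linarith
    have "norm (rot12_gen a) \<le> 4 * \<bar>oRe x\<bar> + (2 * \<bar>d1 - d2\<bar> + 2 * norm z + 2 * norm y)"
      using norm_mk_le[of "- 2 * oRe x" "2 * oRe x" 0 "(d1 - d2) *\<^sub>R 1" z "- y"]
      by (simp add: a rot12_gen_def abs_mult)
    then show "norm (rot12_gen a) \<le> 20 * norm a"
      by (rule bound[OF _ abs_oRe_le abs_triangle_ineq4 le(1,2,6,5,4) norm_ge_zero])
    have "norm (rot23_gen a) \<le> 4 * \<bar>oRe y\<bar> + (2 * \<bar>d2 - d3\<bar> + 2 * norm z + 2 * norm x)"
      using norm_mk_le[of 0 "- 2 * oRe y" "2 * oRe y" "- z" "(d2 - d3) *\<^sub>R 1" x]
      by (simp add: a rot23_gen_def abs_mult)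
    then show "norm (rot23_gen a) \<le> 20 * norm a"
      by (rule bound[OF _ abs_oRe_le abs_triangle_ineq4 le(2,3,6,4,5) norm_ge_zero])
  qed
  have der: "((\<lambda>t. rconj (rot12 t) a \<bullet> b) has_real_derivative (rot12_gen (rconj (rot12 t) a) \<bullet> b)) (at t)"
    "((\<lambda>t. rconj (rot23 t) a \<bullet> b) has_real_derivative (rot23_gen (rconj (rot23 t) a) \<bullet> b)) (at t)" for a b t
  proof -
    obtain d1 d2 d3 x y z e1 e2 e3 x' y' z' where ab: "a = mk d1 d2 d3 x y z" "b = mk e1 e2 e3 x' y' z'"
      by (metis albert_cases)
    show "((\<lambda>t. rconj (rot12 t) a \<bullet> b) has_real_derivative (rot12_gen (rconj (rot12 t) a) \<bullet> b)) (at t)"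
      "((\<lambda>t. rconj (rot23 t) a \<bullet> b) has_real_derivative (rot23_gen (rconj (rot23 t) a) \<bullet> b)) (at t)"
      unfolding ab rconj_rot rot12_gen_def rot23_gen_def coords_mk inner_mk inner_simps inner_1_octonion oRe_simps oRe_diff oRe_ocnj
      by (auto intro!: derivative_eq_intros simp: inner_ocnj algebra_simps)
  qed
  show "one_param (\<lambda>t. rconj (rot12 t)) rot12_gen" "one_param (\<lambda>t. rconj (rot23 t)) rot23_gen"
    unfolding one_param_def using id lin skew bd der by (auto intro!: rconj_autos orthogonal_rot)
qed

section \<open>One-parameter groups as exponentials\<close>

lemma funpow_scaleR_linear:
  fixes D :: "'a::real_vector \<Rightarrow> 'a"
  assumes "linear D"
  shows "((\<lambda>a. t *\<^sub>R D a) ^^ n) a = t ^ n *\<^sub>R (D ^^ n) a"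
  by (induction n) (simp_all add: linear_scale[OF assms])

text \<open>The path is the exponential of its generator: the partial sums of the exponential series
  are Taylor polynomials of the path, with an error of order
  \<open>(K * \<bar>t\<bar>) ^ n / fact n\<close>.\<close>

lemma one_param_Lie:
  assumes op: "one_param \<gamma> D"
  shows "D \<in> Lie_G"
proof -
  note D = one_paramD[OF op]
  obtain C where C: "\<And>a. norm (D a) \<le> C * norm a"
    using op by (auto simp: one_param_def)
  define K where "K = \<bar>C\<bar>"
  have K: "norm (D a) \<le> K * norm a" for a
    using C[of a] mult_right_mono[OF abs_ge_self[of C] norm_ge_zero[of a]] unfolding K_def by linarith
  have Kn: "norm ((D ^^ n) a) \<le> K ^ n * norm a" for n a
  proof (induction n)
    case (Suc n)
    have "norm ((D ^^ Suc n) a) \<le> K * norm ((D ^^ n) a)"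
      using K by simp
    also have "\<dots> \<le> K * (K ^ n * norm a)"
      using Suc by (intro mult_left_mono) (simp_all add: K_def)
    finally show ?case by (simp add: mult_ac)
  qed simp
  have skew: "(D ^^ n) a \<bullet> b = (- 1) ^ n * (a \<bullet> (D ^^ n) b)" for n a b
  proof (induction n arbitrary: b)
    case (Suc n)
    then show ?case
      using Suc[of "D b"] by (simp add: D(2) funpow_swap1[of D n b])
  qed simp
  have "(\<lambda>n. ((\<lambda>a. t *\<^sub>R D a) ^^ n) a /\<^sub>R fact n) sums \<gamma> t a" for t a
  proof -
    define S where "S n = (\<Sum>m<n. ((\<lambda>a. t *\<^sub>R D a) ^^ m) a /\<^sub>R fact m)" for n
    have bound: "norm (\<gamma> t a - S n) \<le> norm a * ((K * \<bar>t\<bar>) ^ n / fact n)" for n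
    proof -
      define v where "v = \<gamma> t a - S n"
      \<comment> \<open>The test vector \<open>v\<close> is the error itself, and skewness moves all
        powers of \<open>D\<close> onto it. The scalar Maclaurin formula then expresses
        \<open>v \<bullet> v\<close> as its remainder term alone.\<close>
      define diff where "diff m s = (- 1) ^ m * (\<gamma> s a \<bullet> (D ^^ m) v)" for m s
      have "DERIV (diff m) s :> diff (Suc m) s" for m s
      proof -
        have "((\<lambda>s. (- 1) ^ m * (\<gamma> s a \<bullet> (D ^^ m) v)) has_real_derivative
            (- 1) ^ m * (D (\<gamma> s a) \<bullet> (D ^^ m) v)) (at s)"
          by (rule DERIV_cmult[OF D(5)])
        then show ?thesis
          unfolding diff_def by (simp add: D(2))
      qed
      then obtain s where s: "diff 0 t = (\<Sum>m<n. diff m 0 / fact m * t ^ m) + diff n s / fact n * t ^ n"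
        using Maclaurin_all_le[of diff "diff 0" t n] by blast
      have "(\<Sum>m<n. diff m 0 / fact m * t ^ m) = S n \<bullet> v"
        unfolding S_def inner_sum_left diff_def funpow_scaleR_linear[OF D(1)]
        by (intro sum.cong HOL.refl) (simp add: D(3) skew divide_inverse mult_ac)
      then have "v \<bullet> v = diff n s / fact n * t ^ n"
        using s by (simp add: v_def diff_def inner_diff_left)
      also have "\<dots> \<le> \<bar>diff n s\<bar> / fact n * \<bar>t\<bar> ^ n"
        by (rule order_trans[OF abs_ge_self]) (simp add: abs_mult power_abs)
      also have "\<dots> \<le> (norm a * (K ^ n * norm v)) / fact n * \<bar>t\<bar> ^ n"
      proof -
        have "norm (\<gamma> s a) = norm a"
          by (simp add: norm_eq_sqrt_inner autos_inner[OF D(4)])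
        then have "\<bar>diff n s\<bar> \<le> norm a * norm ((D ^^ n) v)"
          using Cauchy_Schwarz_ineq2[of "\<gamma> s a" "(D ^^ n) v"] by (simp add: diff_def abs_mult)
        also have "\<dots> \<le> norm a * (K ^ n * norm v)"
          by (intro mult_left_mono Kn) simp
        finally show ?thesis
          by (intro mult_right_mono divide_right_mono) simp_all
      qed
      finally have le: "norm v * norm v \<le> (norm a * ((K * \<bar>t\<bar>) ^ n / fact n)) * norm v"
        by (simp add: dot_square_norm power2_eq_square power_mult_distrib mult_ac)
      have nn: "0 \<le> norm a * ((K * \<bar>t\<bar>) ^ n / fact n)"
        by (simp add: K_def)
      have "norm v \<le> norm a * ((K * \<bar>t\<bar>) ^ n / fact n)"
      proof (cases "v = 0")
        case True
        then show ?thesis using nn by simp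
      next
        case False
        then show ?thesis using mult_right_le_imp_le[OF le] by simp
      qed
      then show ?thesis
        unfolding v_def .
    qed
    have "(\<lambda>n. norm a * ((K * \<bar>t\<bar>) ^ n / fact n)) \<longlonglongrightarrow> norm a * 0"
      using summable_LIMSEQ_zero[OF summable_exp[of "K * \<bar>t\<bar>"]]
      by (intro tendsto_mult tendsto_const) (simp add: field_simps)
    then have lim: "(\<lambda>n. norm a * ((K * \<bar>t\<bar>) ^ n / fact n)) \<longlonglongrightarrow> 0"
      by simp
    have "(\<lambda>n. \<gamma> t a - S n) \<longlonglongrightarrow> 0"
      by (rule Lim_null_comparison[OF always_eventually lim]) (rule allI, rule bound)
    then have "S \<longlonglongrightarrow> \<gamma> t a"
      using tendsto_diff[OF tendsto_const[of "\<gamma> t a"]] by fastforce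
    then show ?thesis
      unfolding sums_def S_def .
  qed
  then have "exp_end (\<lambda>a. t *\<^sub>R D a) = \<gamma> t" for t
    by (auto simp: exp_end_def sums_unique[symmetric])
  then show ?thesis
    using D(1,4) autos_subset_G by (auto simp: Lie_G_def)
qed

section \<open>Matrices in an orthonormal frame of the trace-free part\<close>

locale orthonormal_frame =
  fixes e :: "'n::finite \<Rightarrow> albert"
  assumes orth: "e i \<bullet> e j = (if i = j then 1 else 0)"
    and e_V: "e i \<in> V_R"
    and span_e: "V_R \<subseteq> span (range e)"
begin

lemma expand_V:
  assumes "a \<in> V_R"
  shows "a = (\<Sum>i\<in>UNIV. (e i \<bullet> a) *\<^sub>R e i)"
proof -
  have inj: "inj e"
    using orth by (metis injI zero_neq_one)
  have "a \<in> span (range e)"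
    using assms span_e by blast
  then obtain u where u: "a = (\<Sum>i\<in>UNIV. u i *\<^sub>R e i)"
    using span_finite[of "range e"] by (auto simp: sum.reindex[OF inj])
  have "e j \<bullet> a = u j" for j
    unfolding u by (simp add: inner_sum_right orth if_distrib cong: if_cong)
  then show ?thesis
    using u by simp
qed

definition mat_of :: "(albert \<Rightarrow> albert) \<Rightarrow> real^'n^'n" where
  "mat_of h = (\<chi> i j. e i \<bullet> h (e j))"

lemma expand_op:
  assumes "h (e j) \<in> V_R"
  shows "h (e j) = (\<Sum>i\<in>UNIV. mat_of h $ i $ j *\<^sub>R e i)"
  using expand_V[OF assms] by (simp add: mat_of_def)

lemma autos_V: "h \<in> autos \<Longrightarrow> h (e j) \<in> V_R"
  using e_V[of j] by (simp add: V_R_def autosD(4))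

definition fixed :: "nat \<Rightarrow> ('n list \<Rightarrow> real) \<Rightarrow> (albert \<Rightarrow> albert) \<Rightarrow> bool" where
  "fixed N f h \<longleftrightarrow> (\<forall>c. length c = N \<longrightarrow> peval f (mat_of h) c = f c)"

text \<open>The infinitesimal form of \<open>fixed\<close>: differentiating \<open>peval\<close> at
  the identity in the direction \<open>D\<close> alters one index at a time.\<close>

definition killed :: "nat \<Rightarrow> ('n list \<Rightarrow> real) \<Rightarrow> (albert \<Rightarrow> albert) \<Rightarrow> bool" where
  "killed N f D \<longleftrightarrow> (\<forall>c. length c = N \<longrightarrow>
     (\<Sum>k<N. \<Sum>j\<in>UNIV. mat_of D $ j $ (c ! k) * f (c[k := j])) = 0)"

lemma DERIV_mon:
  assumes "length i = length c"
    and "\<And>a b. ((\<lambda>\<theta>. M \<theta> $ a $ b) has_real_derivative (E ** M \<theta>) $ a $ b) (at \<theta>)"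
  shows "((\<lambda>\<theta>. mon (M \<theta>) i c) has_real_derivative
    (\<Sum>k<length c. \<Sum>l\<in>UNIV. E $ (i ! k) $ l * mon (M \<theta>) (i[k := l]) c)) (at \<theta>)"
  using assms(1)
proof (induction i c rule: list_induct2)
  case (Cons a i b c)
  have "(\<Sum>k<length (b # c). \<Sum>l\<in>UNIV. E $ ((a # i) ! k) $ l * mon (M \<theta>) ((a # i)[k := l]) (b # c))
      = (E ** M \<theta>) $ a $ b * mon (M \<theta>) i c
        + (\<Sum>k<length c. \<Sum>l\<in>UNIV. E $ (i ! k) $ l * mon (M \<theta>) (i[k := l]) c) * M \<theta> $ a $ b"
    by (simp add: sum.lessThan_Suc_shift matrix_matrix_mult_def sum_distrib_left sum_distrib_right mult_ac
        del: sum.lessThan_Suc)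
  then show ?case
    using DERIV_mult[OF assms(2) Cons.IH] by simp
qed simp

text \<open>The matrices satisfy the differential equation with derivative
  \<open>E ** M \<theta>\<close>, generator on the left. The derivative of
  \<open>peval f (M \<theta>) c\<close> is therefore, at every angle, a combination of the sums that
  \<open>killed\<close> sets to 0.\<close>

lemma fixed_one_param:
  assumes op: "one_param \<gamma> D" and "killed N f D"
  shows "fixed N f (\<gamma> \<theta>)"
  unfolding fixed_def
proof (intro allI impI)
  fix c :: "'n list" assume c: "length c = N"
  note D = one_paramD[OF op]
  define M where "M \<theta> = mat_of (\<gamma> \<theta>)" for \<theta>
  define E where "E = mat_of D"
  have M': "((\<lambda>\<theta>. M \<theta> $ a $ b) has_real_derivative (E ** M \<theta>) $ a $ b) (at \<theta>)" for a b \<theta>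
  proof -
    have "e a \<bullet> D (\<gamma> \<theta> (e b)) = (E ** M \<theta>) $ a $ b"
      unfolding expand_op[of "\<gamma> \<theta>" b, OF autos_V[OF D(4)]]
      by (simp add: linear_sum[OF D(1)] linear_scale[OF D(1)] inner_sum_right matrix_matrix_mult_def E_def M_def
          mat_of_def mult.commute)
    then show ?thesis
      using D(5)[of "e b" "e a" \<theta>] by (simp add: M_def mat_of_def inner_commute)
  qed
  have "((\<lambda>\<theta>. peval f (M \<theta>) c) has_real_derivative 0) (at \<theta>)" for \<theta>
  proof -
    have "((\<lambda>\<theta>. peval f (M \<theta>) c) has_real_derivative
       (\<Sum>i\<in>Ls N. f i * (\<Sum>k<N. \<Sum>l\<in>UNIV. E $ (i ! k) $ l * mon (M \<theta>) (i[k := l]) c))) (at \<theta>)"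
      unfolding peval_def c using DERIV_mon[OF _ M'] c by (intro DERIV_sum DERIV_cmult) auto
    also have "(\<Sum>i\<in>Ls N. f i * (\<Sum>k<N. \<Sum>l\<in>UNIV. E $ (i ! k) $ l * mon (M \<theta>) (i[k := l]) c))
        = (\<Sum>k<N. \<Sum>(i, l)\<in>Ls N \<times> UNIV. f i * E $ (i ! k) $ l * mon (M \<theta>) (i[k := l]) c)"
      by (simp add: sum_distrib_left sum.cartesian_product[symmetric] mult.assoc) (rule sum.swap)
    \<comment> \<open>Exchanging the entry at \<open>k\<close> with the summation index
      \<open>l\<close> is an involution of the pairs; it moves the modified list from the monomial
      to \<open>f\<close>.\<close>
    also have "\<dots> = (\<Sum>k<N. \<Sum>(i, l)\<in>Ls N \<times> UNIV. f (i[k := l]) * E $ l $ (i ! k) * mon (M \<theta>) i c)"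
    proof (rule sum.cong[OF HOL.refl])
      fix k assume "k \<in> {..<N}"
      then show "(\<Sum>(i, l)\<in>Ls N \<times> UNIV. f i * E $ (i ! k) $ l * mon (M \<theta>) (i[k := l]) c)
          = (\<Sum>(i, l)\<in>Ls N \<times> UNIV. f (i[k := l]) * E $ l $ (i ! k) * mon (M \<theta>) i c)"
        by (intro sum.reindex_bij_witness[of _ "\<lambda>(i, l). (i[k := l], i ! k)" "\<lambda>(i, l). (i[k := l], i ! k)"]) auto
    qed
    also have "\<dots> = (\<Sum>i\<in>Ls N. (\<Sum>k<N. \<Sum>l\<in>UNIV. E $ l $ (i ! k) * f (i[k := l])) * mon (M \<theta>) i c)"
      by (simp add: sum.cartesian_product[symmetric] sum_distrib_right sum_distrib_left mult_ac) (rule sum.swap)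
    also have "\<dots> = 0"
      using assms(2) by (intro sum.neutral) (simp add: killed_def E_def)
    finally show ?thesis .
  qed
  then have "peval f (M \<theta>) c = peval f (M 0) c"
    using DERIV_isconst_all by blast
  also have "M 0 = mat 1"
    by (simp add: M_def mat_of_def D(3) orth mat_def vec_eq_iff)
  also have "peval f (mat 1) c = (\<Sum>i\<in>Ls N. if i = c then f c else 0)"
    unfolding peval_def c by (intro sum.cong HOL.refl) (simp add: mon_mat_1 c)
  also have "\<dots> = f c"
    using c by simp
  finally show "peval f (mat_of (\<gamma> \<theta>)) c = f c"
    by (simp add: M_def)
qed

end

section \<open>Generation of the automorphism group\<close>

lift_definition oc :: "complex \<Rightarrow> complex \<Rightarrow> complex \<Rightarrow> complex \<Rightarrow> octonion" is "\<lambda>a b c d. ((a, b), (c, d))" .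

lemma oc_cases: obtains a b c d where "x = oc a b c d"
  by (metis oc.rep_eq Rep_octonion_inject prod.exhaust)

lemma oc_simps:
  "oc a b c d = oc a' b' c' d' \<longleftrightarrow> a = a' \<and> b = b' \<and> c = c' \<and> d = d'"
  "oc a b c d + oc a' b' c' d' = oc (a + a') (b + b') (c + c') (d + d')"
  "r *\<^sub>R oc a b c d = oc (r *\<^sub>R a) (r *\<^sub>R b) (r *\<^sub>R c) (r *\<^sub>R d)"
  "ocnj (oc a b c d) = oc (cnj a) (- b) (- c) (- d)" "oRe (oc a b c d) = Re a"
  "1 = oc 1 0 0 0" "0 = oc 0 0 0 0" "- oc a b c d = oc (- a) (- b) (- c) (- d)"
  by ((transfer; auto simp: zero_prod_def)[1])+

lemma oc_mult: "oc a b c d * oc p q r s = oc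
    (a * p - cnj q * b - cnj r * c - cnj d * s) (q * a + b * cnj p - d * cnj r + s * cnj c)
    (r * a - cnj b * s + c * cnj p + cnj q * d) (b * r + s * cnj a + d * p - q * c)"
  by (transfer; simp)

definition imaginary_units :: "octonion list" where
  "imaginary_units = [oc \<i> 0 0 0, oc 0 1 0 0, oc 0 \<i> 0 0, oc 0 0 1 0, oc 0 0 \<i> 0, oc 0 0 0 1, oc 0 0 0 \<i>]"

lemma inner_oc: "oc a b c d \<bullet> oc p q r s = Re (a * cnj p) + Re (b * cnj q) + Re (c * cnj r) + Re (d * cnj s)"
  by (simp add: inner_octonion_def oc_simps oc_mult)

lemma imaginary_units:
  "b \<in> set imaginary_units \<Longrightarrow> b \<bullet> b = 1" "b \<in> set imaginary_units \<Longrightarrow> b \<bullet> 1 = 0"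
  "distinct imaginary_units"
  "b \<in> set imaginary_units \<Longrightarrow> b' \<in> set imaginary_units \<Longrightarrow> b \<noteq> b' \<Longrightarrow> b \<bullet> b' = 0"
  by (auto simp: imaginary_units_def inner_oc oc_simps(1,6))

lemma octonion_expand: "x = oRe x *\<^sub>R 1 + (\<Sum>b\<leftarrow>imaginary_units. (b \<bullet> x) *\<^sub>R b)"
  by (cases x rule: oc_cases) (simp add: imaginary_units_def inner_oc oc_simps complex_eq_iff)

text \<open>Each tested pair generates a quaternion subalgebra and forces the component of
  \<open>q\<close> orthogonal to it to vanish. The three subalgebras meet in the reals.\<close>

lemma octonion_nucleus:
  fixes q :: octonion
  assumes "\<And>x y. x * (y * q) = (x * y) * q"
  shows "q = oRe q *\<^sub>R 1"
proof (cases q rule: oc_cases)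
  case (1 a b c d)
  show ?thesis
    using assms[of "oc \<i> 0 0 0" "oc 0 1 0 0"] assms[of "oc \<i> 0 0 0" "oc 0 0 1 0"] assms[of "oc 0 1 0 0" "oc 0 0 1 0"]
    by (simp add: 1 oc_mult oc_simps complex_eq_iff)
qed

text \<open>Each tested pair forces the component of \<open>q\<close> inside the quaternion
  subalgebra that it generates to vanish. The first three subalgebras miss one direction, which the
  fourth supplies.\<close>

lemma octonion_no_reversal:
  fixes q :: octonion
  assumes "\<And>x y. x * (y * q) = (y * x) * q"
  shows "q = 0"
proof (cases q rule: oc_cases)
  case (1 a b c d)
  show ?thesis
    using assms[of "oc \<i> 0 0 0" "oc 0 1 0 0"] assms[of "oc \<i> 0 0 0" "oc 0 0 1 0"] assms[of "oc 0 1 0 0" "oc 0 0 1 0"]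
      assms[of "oc 0 \<i> 0 0" "oc 0 0 1 0"]
    by (simp add: 1 oc_mult oc_simps complex_eq_iff)
qed

text \<open>The mirror vector \<open>w\<close> is the normalised difference of \<open>p\<close> and
  \<open>q\<close>. The last conclusion keeps vectors in place that pair equally with both, so that
  reflections can be applied successively.\<close>

lemma reflection_swap:
  fixes p q :: "'a::real_inner"
  assumes "p \<bullet> p = q \<bullet> q" "p \<noteq> q"
  obtains w where "w \<bullet> w = 1" "p - (2 * (w \<bullet> p)) *\<^sub>R w = q" "\<And>v. v \<bullet> p = v \<bullet> q \<Longrightarrow> w \<bullet> v = 0"
proof
  define n where "n = norm (p - q)"
  define w where "w = (1 / n) *\<^sub>R (p - q)"
  have n: "n \<noteq> 0" "(p - q) \<bullet> (p - q) = n * n"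
    using assms(2) by (simp_all add: n_def dot_square_norm power2_eq_square)
  show "w \<bullet> w = 1"
    using n by (simp add: w_def)
  have nn: "n * n = 2 * ((p - q) \<bullet> p)"
    using assms(1) unfolding n(2)[symmetric] by (simp add: inner_simps inner_commute)
  have "2 * (w \<bullet> p) * (1 / n) = 2 * ((p - q) \<bullet> p) / (n * n)"
    by (simp add: w_def)
  also have "\<dots> = n * n / (n * n)"
    by (simp only: nn)
  also have "\<dots> = 1"
    using n(1) by simp
  finally have "2 * (w \<bullet> p) * (1 / n) = 1" .
  moreover have "c *\<^sub>R w = (c * (1 / n)) *\<^sub>R (p - q)" for c
    by (simp add: w_def)
  ultimately have "(2 * (w \<bullet> p)) *\<^sub>R w = p - q"
    by (simp only: scaleR_one)
  then show "p - (2 * (w \<bullet> p)) *\<^sub>R w = q"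
    by simp
  show "w \<bullet> v = 0" if "v \<bullet> p = v \<bullet> q" for v
    using that by (simp add: w_def inner_simps inner_commute)
qed

text \<open>Negated conjugation fixes imaginary octonions, so whenever the reflected vector is
  imaginary the left side is exactly that vector.\<close>

lemma triality_reflection:
  assumes "w \<bullet> w = 1"
  shows "(ocnj w * x) * ocnj w = - ocnj (x - (2 * (w \<bullet> x)) *\<^sub>R w)"
proof -
  have "(ocnj w * x) * ocnj w = (2 * (w \<bullet> x)) *\<^sub>R ocnj w - ocnj x"
    using octonion_reflection[of "ocnj w" "ocnj x"] assms by simp
  then show ?thesis by simp
qed

section \<open>Reduction of an automorphism by rotations and reflections\<close>

definition E1 :: albert where "E1 = mk 1 0 0 0 0 0"
definition E2 :: albert where "E2 = mk 0 1 0 0 0 0"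
definition E3 :: albert where "E3 = mk 0 0 1 0 0 0"

lemma c_inner: "c1 a = a \<bullet> E1" "c2 a = a \<bullet> E2" "c3 a = a \<bullet> E3"
  by (cases a rule: albert_cases; simp add: E1_def E2_def E3_def)+

definition diag_sq :: "albert \<Rightarrow> real" where
  "diag_sq a = (c1 a)\<^sup>2 + (c2 a)\<^sup>2 + (c3 a)\<^sup>2"

lemma diag_sq_mk [simp]: "diag_sq (mk d1 d2 d3 x y z) = d1\<^sup>2 + d2\<^sup>2 + d3\<^sup>2"
  by (simp add: diag_sq_def)

text \<open>
  Compactness enters only through the last assumption: as in the Jacobi eigenvalue algorithm, a point
  of the orbit that maximises the diagonal squares is diagonal.
\<close>

locale f4_subgroup =
  fixes K :: "(albert \<Rightarrow> albert) set"
  assumes autos: "k \<in> K \<Longrightarrow> k \<in> autos"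
    and comp: "k \<in> K \<Longrightarrow> l \<in> K \<Longrightarrow> k \<circ> l \<in> K"
    and cancel: "h \<in> autos \<Longrightarrow> k \<in> K \<Longrightarrow> k \<circ> h \<in> K \<Longrightarrow> h \<in> K"
    and tri: "u \<bullet> u = 1 \<Longrightarrow> triality u \<in> K"
    and rot12: "rconj (rot12 t) \<in> K"
    and rot23: "rconj (rot23 t) \<in> K"
    and max: "\<exists>k\<in>K. \<forall>l\<in>K. diag_sq (l a) \<le> diag_sq (k a)"
begin

definition "perm12 = rconj (rot12 (pi / 2))"
definition "perm23 = rconj (rot23 (pi / 2))"

lemma perms: "perm12 \<in> K" "perm23 \<in> K"
  "perm12 (mk d1 d2 d3 x y z) = mk d2 d1 d3 (- ocnj x) z (- y)"
  "perm23 (mk d1 d2 d3 x y z) = mk d1 d3 d2 (- z) (- ocnj y) x"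
  unfolding perm12_def perm23_def by (rule rot12 rot23)+ (simp_all add: rconj_rot)

text \<open>A Jacobi step: a triality map makes a nonzero entry \<open>x\<close> real without
  changing the diagonal, and a plane rotation that annihilates it would raise the sum of the
  diagonal squares by twice its square.\<close>

lemma max_cx_0:
  assumes max: "\<forall>l\<in>K. diag_sq (l b) \<le> diag_sq b"
  shows "cx b = 0"
proof (rule ccontr)
  assume nz: "cx b \<noteq> 0"
  obtain d1 d2 d3 x y z where b: "b = mk d1 d2 d3 x y z"
    by (rule albert_cases)
  define s where "s = norm x"
  have s: "s > 0" "x \<bullet> x = s * s"
    using nz by (simp_all add: b s_def dot_square_norm power2_eq_square)
  have "\<exists>k r. k \<in> K \<and> r \<noteq> 0 \<and> (\<exists>y z. k b = mk d1 d2 d3 (r *\<^sub>R 1) y z)"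
  proof (cases "x = s *\<^sub>R 1")
    case True
    have "triality 1 \<in> K"
      by (rule tri) simp
    then show ?thesis
      using s True by (intro exI[of _ "triality 1"] exI[of _ s]) (auto simp: b)
  next
    case False
    have "x \<bullet> x = (s *\<^sub>R 1) \<bullet> (s *\<^sub>R (1 :: octonion))"
      using s by simp
    from reflection_swap[OF this False] obtain w where w1: "w \<bullet> w = 1" and w: "x - (2 * (w \<bullet> x)) *\<^sub>R w = s *\<^sub>R 1"
      by metis
    have "(ocnj w * x) * ocnj w = (- s) *\<^sub>R 1"
      unfolding triality_reflection[OF w1] w by simp
    moreover have "triality (ocnj w) \<in> K"
      using w1 by (intro tri) simp
    ultimately show ?thesis
      using s by (intro exI[of _ "triality (ocnj w)"] exI[of _ "- s"]) (auto simp: b)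
  qed
  then obtain k r y' z' where k: "k \<in> K" "r \<noteq> 0" "k b = mk d1 d2 d3 (r *\<^sub>R 1) y' z'"
    by blast
  \<comment> \<open>The gap between the eigenvalues of the real symmetric block with diagonal
    \<open>d1\<close>, \<open>d2\<close> and off-diagonal entry \<open>r\<close>.\<close>
  define R where "R = sqrt ((d1 - d2)\<^sup>2 + (2 * r)\<^sup>2)"
  have R2: "R\<^sup>2 = (d1 - d2)\<^sup>2 + (2 * r)\<^sup>2"
    by (simp add: R_def)
  have R0: "R > 0"
    using k(2) by (simp add: R_def add_nonneg_pos)
  have "((d1 - d2) / R)\<^sup>2 + (- 2 * r / R)\<^sup>2 = ((d1 - d2)\<^sup>2 + (2 * r)\<^sup>2) / R\<^sup>2"
    by (simp add: power_divide add_divide_distrib)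
  also have "\<dots> = 1"
    using R0 unfolding R2[symmetric] by simp
  finally have "((d1 - d2) / R)\<^sup>2 + (- 2 * r / R)\<^sup>2 = 1" .
  then obtain \<phi> where phi: "(d1 - d2) / R = cos \<phi>" "- 2 * r / R = sin \<phi>"
    using sincos_total_2pi_le by metis
  \<comment> \<open>Half the angle, because the diagonal after the rotation depends on the double
    angle; the difference of its first two entries then becomes \<open>R\<close>.\<close>
  define t where "t = \<phi> / 2"
  have c2: "cos t * cos t - sin t * sin t = (d1 - d2) / R" "2 * (cos t * sin t) = - 2 * r / R"
    using phi cos_double[of t] sin_double[of t] by (simp_all add: t_def power2_eq_square mult_ac)
  have cs: "cos t * cos t + sin t * sin t = 1"
    by (simp flip: power2_eq_square)
  define p q where "p = cos t * cos t * d1 - 2 * (cos t * sin t) * r + sin t * sin t * d2"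
    and "q = sin t * sin t * d1 + 2 * (cos t * sin t) * r + cos t * cos t * d2"
  have "p + q = (cos t * cos t + sin t * sin t) * (d1 + d2)"
    unfolding p_def q_def by algebra
  then have pq: "p + q = d1 + d2"
    unfolding cs by simp
  have "p - q = (cos t * cos t - sin t * sin t) * (d1 - d2) - 2 * (2 * (cos t * sin t)) * r"
    unfolding p_def q_def by algebra
  also have "\<dots> = R\<^sup>2 / R"
    unfolding c2 R2 by (simp add: power2_eq_square add_divide_distrib)
  finally have pR: "p - q = R"
    using R0 by (simp add: power2_eq_square)
  have "2 * (p\<^sup>2 + q\<^sup>2) = (p + q)\<^sup>2 + (p - q)\<^sup>2"
    by (simp add: power2_eq_square algebra_simps)
  then have "2 * (p\<^sup>2 + q\<^sup>2) = (d1 + d2)\<^sup>2 + R\<^sup>2"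
    unfolding pq pR .
  then have "p\<^sup>2 + q\<^sup>2 = d1\<^sup>2 + d2\<^sup>2 + 2 * r\<^sup>2"
    unfolding R2 by (simp add: power2_eq_square algebra_simps)
  moreover have "c1 ((rconj (rot12 t) \<circ> k) b) = p" "c2 ((rconj (rot12 t) \<circ> k) b) = q" "c3 ((rconj (rot12 t) \<circ> k) b) = d3"
    by (simp_all add: k(3) rconj_rot p_def q_def oRe_simps)
  ultimately have "diag_sq ((rconj (rot12 t) \<circ> k) b) = d1\<^sup>2 + d2\<^sup>2 + 2 * r\<^sup>2 + d3\<^sup>2"
    by (simp add: diag_sq_def)
  moreover have "diag_sq ((rconj (rot12 t) \<circ> k) b) \<le> diag_sq b"
    using max comp[OF rot12 k(1)] by blast
  ultimately show False
    using k(2) by (simp add: b)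
qed

text \<open>The permutations \<open>perm12\<close> and \<open>perm23\<close> carry the other two
  off-diagonal entries to the position of \<open>x\<close>. They preserve the sum of the diagonal
  squares, so the permuted element is still maximal.\<close>

lemma diagonalise: "\<exists>k\<in>K. \<exists>d1 d2 d3. k a = mk d1 d2 d3 0 0 0"
proof -
  obtain k where k: "k \<in> K" and m: "\<forall>l\<in>K. diag_sq (l a) \<le> diag_sq (k a)"
    using max by blast
  obtain d1 d2 d3 x y z where b: "k a = mk d1 d2 d3 x y z"
    by (rule albert_cases)
  have *: "cx (l (k a)) = 0" if "l \<in> K" "diag_sq (l (k a)) = diag_sq (k a)" for l
  proof (rule max_cx_0, intro ballI)
    fix l' assume "l' \<in> K"
    then have "l' \<circ> (l \<circ> k) \<in> K"
      using that k comp by blast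
    then show "diag_sq (l' (l (k a))) \<le> diag_sq (l (k a))"
      using m that(2) by fastforce
  qed
  \<comment> \<open>The map \<open>triality 1\<close> plays the part of the identity, whose
    membership in \<open>K\<close> is not among the assumptions.\<close>
  have "triality 1 \<in> K"
    by (rule tri) simp
  from *[OF this] have "x = 0"
    by (simp add: b)
  moreover have "z = 0"
    using *[OF perms(2)] by (simp add: b perms)
  moreover have "y = 0"
    using *[OF comp[OF perms(2,1)]] by (simp add: b perms)
  ultimately show ?thesis
    using k b by blast
qed

text \<open>Newton's identities turn the power sums into elementary symmetric functions, which
  identify the three numbers as roots of d(d - 1)(d - 2).\<close>

lemma power_sums_012:
  fixes d1 d2 d3 :: real
  assumes "d1 + d2 + d3 = 3" "d1 * d1 + d2 * d2 + d3 * d3 = 5" "d1 * d1 * d1 + d2 * d2 * d2 + d3 * d3 * d3 = 9"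
  shows "(d1, d2, d3) \<in> {(0, 1, 2), (0, 2, 1), (1, 0, 2), (1, 2, 0), (2, 0, 1), (2, 1, 0)}"
proof -
  have e2: "d1 * d2 + d1 * d3 + d2 * d3 = 2"
  proof -
    have "(d1 + d2 + d3) * (d1 + d2 + d3) = (d1 * d1 + d2 * d2 + d3 * d3) + 2 * (d1 * d2 + d1 * d3 + d2 * d3)"
      by (simp add: algebra_simps)
    then show ?thesis
      unfolding assms by simp
  qed
  have e3: "d1 * d2 * d3 = 0"
  proof -
    have "d1 * d1 * d1 + d2 * d2 * d2 + d3 * d3 * d3
      = (d1 + d2 + d3) * (d1 * d1 + d2 * d2 + d3 * d3) - (d1 + d2 + d3) * (d1 * d2 + d1 * d3 + d2 * d3) + 3 * (d1 * d2 * d3)"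
      by (simp add: algebra_simps)
    then show ?thesis
      unfolding assms e2 by simp
  qed
  have root: "d = 0 \<or> d = 1 \<or> d = 2" if "d = d1 \<or> d = d2 \<or> d = d3" for d
  proof -
    have "(d - d1) * (d - d2) * (d - d3)
        = d * d * d - (d1 + d2 + d3) * (d * d) + (d1 * d2 + d1 * d3 + d2 * d3) * d - d1 * d2 * d3"
      by (simp add: algebra_simps)
    also have "\<dots> = d * (d - 1) * (d - 2)"
      unfolding assms e2 e3 by (simp add: algebra_simps)
    finally show ?thesis
      using that by auto
  qed
  have "d1 = 0 \<or> d1 = 1 \<or> d1 = 2" "d2 = 0 \<or> d2 = 1 \<or> d2 = 2" "d3 = 0 \<or> d3 = 1 \<or> d3 = 2"
    by (rule root; simp)+
  then show ?thesis
    using assms(1,2) by (elim disjE) simp_all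
qed

text \<open>Trace, norm and cubic form determine the entries of the diagonalised image of
  \<open>P\<close> up to order, and a permutation restores \<open>P\<close>. As its entries are
  distinct, the idempotents \<open>E1\<close>, \<open>E2\<close>, \<open>E3\<close> are polynomials
  in \<open>P\<close> and are fixed with it.\<close>

lemma fix_frame:
  assumes h: "h \<in> autos"
  shows "\<exists>k\<in>K. k (h E1) = E1 \<and> k (h E2) = E2 \<and> k (h E3) = E3"
proof -
  define P where "P = mk 0 1 2 0 0 0"
  obtain k d1 d2 d3 where k: "k \<in> K" and d: "k (h P) = mk d1 d2 d3 0 0 0"
    using diagonalise by blast
  have g: "k \<circ> h \<in> autos"
    using k h autos autos_comp by blast
  have gP: "(k \<circ> h) P = mk d1 d2 d3 0 0 0"
    using d by simp
  have "tr (mk d1 d2 d3 0 0 0) = tr P"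
    unfolding gP[symmetric] by (rule autosD(4)[OF g])
  moreover have "mk d1 d2 d3 0 0 0 \<bullet> mk d1 d2 d3 0 0 0 = P \<bullet> P"
    unfolding gP[symmetric] by (rule autos_inner[OF g])
  moreover have "(mk d1 d2 d3 0 0 0 \<circ>\<^sub>J mk d1 d2 d3 0 0 0) \<bullet> mk d1 d2 d3 0 0 0 = (P \<circ>\<^sub>J P) \<bullet> P"
    unfolding gP[symmetric] autosD(3)[OF g, symmetric] by (rule autos_inner[OF g])
  ultimately have "(d1, d2, d3) \<in> {(0, 1, 2), (0, 2, 1), (1, 0, 2), (1, 2, 0), (2, 0, 1), (2, 1, 0)}"
    by (intro power_sums_012) (simp_all add: P_def jordan_mk oct.zero_left oct.zero_right)
  moreover have "triality 1 \<in> K"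
    by (rule tri) simp
  ultimately have "\<exists>l\<in>K. l (mk d1 d2 d3 0 0 0) = P"
    using perms(1,2) comp[OF perms(1,2)] comp[OF perms(2,1)] comp[OF comp[OF perms(1,2)] perms(1)]
    by (auto simp: P_def perms oct.zero_left oct.zero_right intro: bexI[of _ "triality 1"] bexI[of _ perm12] bexI[of _ perm23]
        bexI[of _ "perm12 \<circ> perm23"] bexI[of _ "perm23 \<circ> perm12"] bexI[of _ "perm12 \<circ> perm23 \<circ> perm12"])
  then obtain l where l: "l \<in> K" "l (k (h P)) = P"
    using d by auto
  define g where "g = (l \<circ> k) \<circ> h"
  have g: "g \<in> autos"
    unfolding g_def using l k h autos comp autos_comp by blast
  note lin = autosD(1)[OF g]
  have gP: "g P = P"
    using l by (simp add: g_def)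
  then have gP2: "g (P \<circ>\<^sub>J P) = P \<circ>\<^sub>J P"
    by (simp add: autosD(3)[OF g])
  \<comment> \<open>Lagrange interpolation at the diagonal entries 0, 1, 2 of
    \<open>P\<close>.\<close>
  have E: "E1 = 1 - (3/2) *\<^sub>R P + (1/2) *\<^sub>R (P \<circ>\<^sub>J P)" "E2 = 2 *\<^sub>R P - P \<circ>\<^sub>J P"
    "E3 = (1/2) *\<^sub>R (P \<circ>\<^sub>J P) - (1/2) *\<^sub>R P"
    by (simp_all add: E1_def E2_def E3_def P_def jordan_mk mk_arith oct.zero_left oct.zero_right)
  have "g E1 = E1" "g E2 = E2" "g E3 = E3"
    unfolding E linear_add[OF lin] linear_diff[OF lin] linear_scale[OF lin] gP gP2 autos_one[OF g] by (rule HOL.refl)+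
  moreover have "l \<circ> k \<in> K"
    using l k comp by blast
  ultimately show ?thesis
    by (intro bexI[of _ "l \<circ> k"]) (simp_all add: g_def)
qed

text \<open>Each off-diagonal space is a Peirce space, on which two of the idempotents act with
  eigenvalue 1/2. Fixing the idempotents preserves these spaces, and the product of the first two
  lies in the third.\<close>

lemma frame_fixing_form:
  assumes g: "g \<in> autos" and E: "g E1 = E1" "g E2 = E2" "g E3 = E3"
  shows "\<exists>\<alpha> \<beta> \<gamma>. (\<forall>d1 d2 d3 x y z. g (mk d1 d2 d3 x y z) = mk d1 d2 d3 (\<alpha> x) (\<beta> y) (\<gamma> z))
    \<and> (\<forall>x y. \<alpha> x * \<beta> y = \<gamma> (x * y)) \<and> linear \<alpha> \<and> (\<forall>x x'. \<alpha> x \<bullet> \<alpha> x' = x \<bullet> x') \<and> (\<forall>y. norm (\<beta> y) = norm y)"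
proof -
  note lin = autosD(1)[OF g]
  have half: "r *\<^sub>R v = v \<longleftrightarrow> v = 0 \<or> r = 1" for r and v :: octonion
    using scaleR_cancel_right[of r v 1] by auto
  define \<alpha> where "\<alpha> x = cx (g (mk 0 0 0 x 0 0))" for x
  define \<beta> where "\<beta> y = cy (g (mk 0 0 0 0 y 0))" for y
  define \<gamma> where "\<gamma> z = cz (g (mk 0 0 0 0 0 z))" for z
  have X: "g (mk 0 0 0 x 0 0) = mk 0 0 0 (\<alpha> x) 0 0" for x
  proof -
    have "E1 \<circ>\<^sub>J mk 0 0 0 x 0 0 = (1/2) *\<^sub>R mk 0 0 0 x 0 0" "E2 \<circ>\<^sub>J mk 0 0 0 x 0 0 = (1/2) *\<^sub>R mk 0 0 0 x 0 0"
      by (simp_all add: E1_def E2_def jordan_mk mk_arith oct.zero_left oct.zero_right)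
    from this[THEN arg_cong[of _ _ g]]
    have "E1 \<circ>\<^sub>J g (mk 0 0 0 x 0 0) = (1/2) *\<^sub>R g (mk 0 0 0 x 0 0)" "E2 \<circ>\<^sub>J g (mk 0 0 0 x 0 0) = (1/2) *\<^sub>R g (mk 0 0 0 x 0 0)"
      by (simp_all add: autosD(3)[OF g] E linear_scale[OF lin])
    then show ?thesis
      by (cases "g (mk 0 0 0 x 0 0)" rule: albert_cases)
        (simp add: \<alpha>_def E1_def E2_def jordan_mk mk_arith oct.zero_left oct.zero_right half)
  qed
  have Y: "g (mk 0 0 0 0 y 0) = mk 0 0 0 0 (\<beta> y) 0" for y
  proof -
    have "E2 \<circ>\<^sub>J mk 0 0 0 0 y 0 = (1/2) *\<^sub>R mk 0 0 0 0 y 0" "E3 \<circ>\<^sub>J mk 0 0 0 0 y 0 = (1/2) *\<^sub>R mk 0 0 0 0 y 0"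
      by (simp_all add: E3_def E2_def jordan_mk mk_arith oct.zero_left oct.zero_right)
    from this[THEN arg_cong[of _ _ g]]
    have "E2 \<circ>\<^sub>J g (mk 0 0 0 0 y 0) = (1/2) *\<^sub>R g (mk 0 0 0 0 y 0)" "E3 \<circ>\<^sub>J g (mk 0 0 0 0 y 0) = (1/2) *\<^sub>R g (mk 0 0 0 0 y 0)"
      by (simp_all add: autosD(3)[OF g] E linear_scale[OF lin])
    then show ?thesis
      by (cases "g (mk 0 0 0 0 y 0)" rule: albert_cases)
        (simp add: \<beta>_def E3_def E2_def jordan_mk mk_arith oct.zero_left oct.zero_right half)
  qed
  have Z: "g (mk 0 0 0 0 0 z) = mk 0 0 0 0 0 (\<gamma> z)" for z
  proof -
    have "E1 \<circ>\<^sub>J mk 0 0 0 0 0 z = (1/2) *\<^sub>R mk 0 0 0 0 0 z" "E3 \<circ>\<^sub>J mk 0 0 0 0 0 z = (1/2) *\<^sub>R mk 0 0 0 0 0 z"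
      by (simp_all add: E3_def E1_def jordan_mk mk_arith oct.zero_left oct.zero_right)
    from this[THEN arg_cong[of _ _ g]]
    have "E1 \<circ>\<^sub>J g (mk 0 0 0 0 0 z) = (1/2) *\<^sub>R g (mk 0 0 0 0 0 z)" "E3 \<circ>\<^sub>J g (mk 0 0 0 0 0 z) = (1/2) *\<^sub>R g (mk 0 0 0 0 0 z)"
      by (simp_all add: autosD(3)[OF g] E linear_scale[OF lin])
    then show ?thesis
      by (cases "g (mk 0 0 0 0 0 z)" rule: albert_cases)
        (simp add: \<gamma>_def E3_def E1_def jordan_mk mk_arith oct.zero_left oct.zero_right half)
  qed
  have "g (mk d1 d2 d3 x y z) = mk d1 d2 d3 (\<alpha> x) (\<beta> y) (\<gamma> z)" for d1 d2 d3 x y z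
  proof -
    have "mk d1 d2 d3 x y z = d1 *\<^sub>R E1 + d2 *\<^sub>R E2 + d3 *\<^sub>R E3 + mk 0 0 0 x 0 0 + mk 0 0 0 0 y 0 + mk 0 0 0 0 0 z"
      by (simp add: E1_def E2_def E3_def mk_arith)
    then have "g (mk d1 d2 d3 x y z)
        = d1 *\<^sub>R E1 + d2 *\<^sub>R E2 + d3 *\<^sub>R E3 + mk 0 0 0 (\<alpha> x) 0 0 + mk 0 0 0 0 (\<beta> y) 0 + mk 0 0 0 0 0 (\<gamma> z)"
      by (simp only: linear_add[OF lin] linear_scale[OF lin] E X Y Z)
    then show ?thesis
      by (simp add: E1_def E2_def E3_def mk_arith)
  qed
  moreover have "\<alpha> x * \<beta> y = \<gamma> (x * y)" for x y
  proof -
    have "2 *\<^sub>R (mk 0 0 0 x 0 0 \<circ>\<^sub>J mk 0 0 0 0 y 0) = mk 0 0 0 0 0 (x * y)"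
      by (simp add: jordan_mk mk_arith oct.zero_left oct.zero_right)
    then have "2 *\<^sub>R (g (mk 0 0 0 x 0 0) \<circ>\<^sub>J g (mk 0 0 0 0 y 0)) = g (mk 0 0 0 0 0 (x * y))"
      by (simp only: linear_scale[OF lin, symmetric] autosD(3)[OF g, symmetric])
    then show ?thesis
      by (simp add: X Y Z jordan_mk mk_arith oct.zero_left oct.zero_right)
  qed
  moreover have "linear \<alpha>"
  proof (rule linearI)
    show "\<alpha> (x + x') = \<alpha> x + \<alpha> x'" for x x'
      using linear_add[OF lin, of "mk 0 0 0 x 0 0" "mk 0 0 0 x' 0 0"] by (simp add: mk_arith X)
    show "\<alpha> (r *\<^sub>R x) = r *\<^sub>R \<alpha> x" for r x
      using linear_scale[OF lin, of r "mk 0 0 0 x 0 0"] by (simp add: mk_arith X)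
  qed
  moreover have "\<alpha> x \<bullet> \<alpha> x' = x \<bullet> x'" for x x'
    using autos_inner[OF g, of "mk 0 0 0 x 0 0" "mk 0 0 0 x' 0 0"] by (simp add: X)
  moreover have "norm (\<beta> y) = norm y" for y
    using autos_inner[OF g, of "mk 0 0 0 0 y 0" "mk 0 0 0 0 y 0"] by (simp add: Y norm_eq_sqrt_inner)
  ultimately show ?thesis by blast
qed

text \<open>Since \<alpha> is an isometry, the units already fixed are orthogonal to both \<alpha> b
  and b, hence to the mirror vector, and stay fixed. The reflected vectors are imaginary, so
  \<open>triality_reflection\<close> realises the reflection on them exactly.\<close>

lemma fix_imaginary_units:
  assumes g: "g \<in> autos" and E: "g E1 = E1" "g E2 = E2" "g E3 = E3"
    and bs: "set bs \<subseteq> set imaginary_units" "distinct bs"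
  shows "\<exists>k\<in>K. k (g E1) = E1 \<and> k (g E2) = E2 \<and> k (g E3) = E3 \<and>
    (\<forall>b\<in>set bs. cx (k (g (mk 0 0 0 b 0 0))) = b)"
  using bs
proof (induction bs)
  case Nil
  have "triality 1 \<in> K"
    by (rule tri) simp
  then show ?case
    using E by (intro bexI[of _ "triality 1"]) (simp_all add: E1_def E2_def E3_def oct.zero_left oct.zero_right)
next
  case (Cons b bs)
  then obtain k where k: "k \<in> K" "k (g E1) = E1" "k (g E2) = E2" "k (g E3) = E3"
    and fix_bs: "\<forall>b\<in>set bs. cx (k (g (mk 0 0 0 b 0 0))) = b"
    by auto
  have "k \<circ> g \<in> autos"
    using k g autos autos_comp by blast
  from frame_fixing_form[OF this] k obtain \<alpha> \<beta> \<gamma>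
    where form: "\<And>d1 d2 d3 x y z. k (g (mk d1 d2 d3 x y z)) = mk d1 d2 d3 (\<alpha> x) (\<beta> y) (\<gamma> z)"
    and lin: "linear \<alpha>" and iso: "\<And>x x'. \<alpha> x \<bullet> \<alpha> x' = x \<bullet> x'"
    by auto
  show ?case
  proof (cases "\<alpha> b = b")
    case True
    then show ?thesis
      using k fix_bs by (intro bexI[of _ k]) (auto simp: form)
  next
    case False
    from reflection_swap[OF iso False] obtain w where w: "w \<bullet> w = 1" "\<alpha> b - (2 * (w \<bullet> \<alpha> b)) *\<^sub>R w = b"
      and orth: "\<And>v. v \<bullet> \<alpha> b = v \<bullet> b \<Longrightarrow> w \<bullet> v = 0"
      by metis
    have im: "ocnj b' = - b'" if "b' \<in> set (b # bs)" for b'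
      using imaginary_units(2)[of b'] that Cons.prems by (auto simp: ocnj_eq inner_1_octonion)
    have "(ocnj w * \<alpha> b') * ocnj w = b'" if "b' \<in> set (b # bs)" for b'
    proof (cases "b' = b")
      case True
      then show ?thesis
        unfolding triality_reflection[OF w(1)] using w(2) im[OF that] by simp
    next
      case False
      then have b': "b' \<in> set bs"
        using that by simp
      then have "\<alpha> b' = b'"
        using fix_bs by (simp add: form)
      moreover have "b' \<bullet> b = 0"
        using imaginary_units(4)[of b' b] False that Cons.prems by auto
      ultimately have "w \<bullet> \<alpha> b' = 0"
        using iso[of b' b] by (intro orth) simp
      then show ?thesis
        unfolding triality_reflection[OF w(1)] using \<open>\<alpha> b' = b'\<close> im[OF that] by simp
    qed
    moreover have "triality (ocnj w) \<circ> k \<in> K"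
      using w(1) k by (intro comp tri) simp_all
    ultimately show ?thesis
      using k(2-4) by (intro bexI[of _ "triality (ocnj w) \<circ> k"])
        (auto simp: form E1_def E2_def E3_def oct.zero_left oct.zero_right)
  qed
qed

text \<open>Once frame and imaginary units are back in place, \<alpha> can only keep or negate 1. If
  it keeps 1, then \<beta> is right multiplication by \<open>q\<close>, which
  \<open>octonion_nucleus\<close> makes real, and the rest is \<open>triality\<close> of a sign. If
  it negates 1, then \<alpha> is negated conjugation, which reverses products, and
  \<open>octonion_no_reversal\<close> contradicts \<open>norm q = 1\<close>.\<close>

theorem autos_subset: "autos \<subseteq> K"
proof
  fix h assume h: "h \<in> autos"
  obtain k where k: "k \<in> K" "k (h E1) = E1" "k (h E2) = E2" "k (h E3) = E3"
    using fix_frame[OF h] by blast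
  have g: "k \<circ> h \<in> autos"
    using k h autos autos_comp by blast
  obtain l where l: "l \<in> K" "l (k (h E1)) = E1" "l (k (h E2)) = E2" "l (k (h E3)) = E3"
    and lb: "\<And>b. b \<in> set imaginary_units \<Longrightarrow> cx (l (k (h (mk 0 0 0 b 0 0)))) = b"
    using fix_imaginary_units[OF g _ _ _ subset_refl imaginary_units(3)] k by auto
  define f where "f = (l \<circ> k) \<circ> h"
  have lk: "l \<circ> k \<in> K"
    using l k comp by blast
  have f: "f \<in> autos"
    unfolding f_def using lk h autos autos_comp by blast
  obtain \<alpha> \<beta> \<gamma> where form: "\<And>d1 d2 d3 x y z. f (mk d1 d2 d3 x y z) = mk d1 d2 d3 (\<alpha> x) (\<beta> y) (\<gamma> z)"
    and mult: "\<And>x y. \<alpha> x * \<beta> y = \<gamma> (x * y)"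
    and lin: "linear \<alpha>" and iso: "\<And>x x'. \<alpha> x \<bullet> \<alpha> x' = x \<bullet> x'" and nb: "\<And>y. norm (\<beta> y) = norm y"
    using frame_fixing_form[OF f] l by (auto simp: f_def)
  have \<alpha>b: "\<alpha> b = b" if "b \<in> set imaginary_units" for b
    using lb[OF that] form[of 0 0 0 b 0 0] by (simp add: f_def)
  define q where "q = \<beta> 1"
  have q1: "norm q = 1"
    by (simp add: q_def nb)
  define r where "r = oRe (\<alpha> 1)"
  have "b \<bullet> \<alpha> 1 = 0" if "b \<in> set imaginary_units" for b
    using iso[of b 1] \<alpha>b[OF that] imaginary_units(2)[OF that] by simp
  then have "map (\<lambda>b. (b \<bullet> \<alpha> 1) *\<^sub>R b) imaginary_units = map (\<lambda>_. 0) imaginary_units"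
    by simp
  then have "(\<Sum>b\<leftarrow>imaginary_units. (b \<bullet> \<alpha> 1) *\<^sub>R b) = 0"
    by (simp only: sum_list_0)
  then have \<alpha>1: "\<alpha> 1 = r *\<^sub>R 1"
    using octonion_expand[of "\<alpha> 1"] by (simp add: r_def)
  have "r * r = 1"
    using iso[of 1 1] by (simp add: \<alpha>1)
  then have "r = 1 \<or> r = - 1"
    by (simp add: square_eq_1_iff)
  have \<alpha>: "\<alpha> x = (r * oRe x) *\<^sub>R 1 + (x - oRe x *\<^sub>R 1)" for x
  proof -
    define y where "y = (\<Sum>b\<leftarrow>imaginary_units. (b \<bullet> x) *\<^sub>R b)"
    have "\<alpha> (\<Sum>b\<leftarrow>bs. (b \<bullet> x) *\<^sub>R b) = (\<Sum>b\<leftarrow>bs. (b \<bullet> x) *\<^sub>R b)" if "set bs \<subseteq> set imaginary_units" for bs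
      using that by (induction bs) (simp_all add: linear_0[OF lin] linear_add[OF lin] linear_scale[OF lin] \<alpha>b)
    then have "\<alpha> y = y"
      by (simp add: y_def)
    moreover have xy: "x = oRe x *\<^sub>R 1 + y"
      unfolding y_def by (rule octonion_expand)
    ultimately have "\<alpha> x = (oRe x * r) *\<^sub>R 1 + y"
      using linear_add[OF lin, of "oRe x *\<^sub>R 1" y] by (simp add: linear_scale[OF lin] \<alpha>1)
    moreover have "y = x - oRe x *\<^sub>R 1"
      using xy by (metis add_diff_cancel_left')
    ultimately show ?thesis
      by (simp add: mult.commute)
  qed
  have "f \<in> K"
    using \<open>r = 1 \<or> r = - 1\<close>
  proof
    assume "r = 1"
    then have id: "\<alpha> x = x" for x
      by (simp add: \<alpha>)
    have \<gamma>: "\<gamma> y = \<beta> y" for y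
      using mult[of 1 y] by (simp add: id)
    have \<beta>: "\<beta> x = x * q" for x
      using mult[of x 1] by (simp add: id \<gamma> q_def)
    have "q = oRe q *\<^sub>R 1"
      using mult by (intro octonion_nucleus) (simp add: id \<gamma> \<beta>)
    then obtain s where s: "q = s *\<^sub>R 1"
      by blast
    then have "s = 1 \<or> s = - 1"
      using q1 by (simp add: abs_if split: if_splits)
    then have "f a = triality (s *\<^sub>R 1) a" for a
      by (cases a rule: albert_cases) (auto simp: form id \<gamma> \<beta> s oct.minus_left oct.minus_right)
    then have "f = triality (s *\<^sub>R 1)"
      by blast
    moreover have "(s *\<^sub>R 1) \<bullet> (s *\<^sub>R (1 :: octonion)) = 1"
      using \<open>s = 1 \<or> s = - 1\<close> by auto
    ultimately show ?thesis
      using tri by simp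
  next
    assume "r = - 1"
    have cn: "\<alpha> x = - ocnj x" for x
    proof -
      have "(2 * oRe x) *\<^sub>R (1 :: octonion) = oRe x *\<^sub>R 1 + oRe x *\<^sub>R 1"
        unfolding scaleR_scaleR[symmetric] by (rule scaleR_2)
      then show ?thesis
        unfolding \<alpha> ocnj_eq \<open>r = - 1\<close> by simp
    qed
    have \<gamma>: "\<gamma> y = - \<beta> y" for y
      using mult[of 1 y] by (simp add: cn oct.minus_left)
    have \<beta>: "\<beta> x = ocnj x * q" for x
      using mult[of x 1] by (simp add: cn \<gamma> q_def oct.minus_left)
    have "x * (y * q) = (y * x) * q" for x y
      using mult[of "ocnj x" "ocnj y"] by (simp add: cn \<gamma> \<beta> ocnj_mult oct.minus_left)
    then have "q = 0"
      by (rule octonion_no_reversal)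
    then show ?thesis
      using q1 by simp
  qed
  then show "h \<in> K"
    unfolding f_def by (rule cancel[OF h lk])
qed

end

section \<open>The automorphisms as a matrix stabiliser\<close>

context orthonormal_frame begin

lemma mat_of_comp:
  assumes "linear h" "k \<in> autos"
  shows "mat_of (h \<circ> k) = mat_of h ** mat_of k"
proof -
  have "e i \<bullet> h (k (e j)) = (\<Sum>l\<in>UNIV. (e i \<bullet> h (e l)) * (e l \<bullet> k (e j)))" for i j
    using arg_cong[OF expand_op[of k j, OF autos_V[OF assms(2)]], of "\<lambda>v. e i \<bullet> h v"]
    by (simp add: linear_sum[OF assms(1)] linear_scale[OF assms(1)] inner_sum_right mat_of_def mult.commute)
  then show ?thesis
    by (simp add: mat_of_def matrix_matrix_mult_def vec_eq_iff)
qed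

lemma fixed_comp:
  assumes "h \<in> autos" "k \<in> autos" "fixed N f k"
  shows "fixed N f (k \<circ> h) \<longleftrightarrow> fixed N f h"
proof -
  have "peval f (mat_of (k \<circ> h)) c = peval f (mat_of h) c" if "length c = N" for c
    unfolding mat_of_comp[OF autosD(1)[OF assms(2)] assms(1)] peval_mult
    using assms(3) that by (simp add: fixed_def peval_def)
  then show ?thesis
    by (simp add: fixed_def)
qed

definition coords :: "albert \<Rightarrow> real^'n" where
  "coords a = (\<chi> j. e j \<bullet> a)"

text \<open>The operator that fixes 1 and has matrix \<open>M\<close> on the trace-free part; on
  \<open>autos\<close> it inverts \<open>mat_of\<close>.\<close>

definition hat :: "real^'n^'n \<Rightarrow> albert \<Rightarrow> albert" where
  "hat M a = (tr a / 3) *\<^sub>R 1 + (\<Sum>i\<in>UNIV. (M *v coords a) $ i *\<^sub>R e i)"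

definition cubic_form :: "'n list \<Rightarrow> real" where
  "cubic_form c = (e (c ! 0) \<circ>\<^sub>J e (c ! 1)) \<bullet> e (c ! 2)"

lemma tr_e [simp]: "tr (e i) = 0" "1 \<bullet> e i = 0" "e i \<bullet> 1 = 0"
  using e_V[of i] by (simp_all add: V_R_def tr_eq_inner inner_commute)

lemma one_inner_one [simp]: "(1::albert) \<bullet> 1 = 3" "tr 1 = 3"
  by (simp_all add: mk_arith)

lemma expand: "a = (tr a / 3) *\<^sub>R 1 + (\<Sum>i\<in>UNIV. coords a $ i *\<^sub>R e i)"
proof -
  have "a - (tr a / 3) *\<^sub>R 1 \<in> V_R"
    by (simp add: V_R_def tr_eq_inner inner_diff_right)
  from expand_V[OF this] show ?thesis
    by (simp add: coords_def inner_diff_right algebra_simps)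
qed

lemma tr_hat [simp]: "tr (hat M a) = tr a"
  by (simp add: hat_def tr_eq_inner inner_add_right inner_sum_right)

lemma coords_hat: "coords (hat M a) = M *v coords a"
proof -
  have "e i \<bullet> hat M a = (M *v coords a) $ i" for i
    by (simp add: hat_def inner_add_right inner_sum_right orth if_distrib cong: if_cong)
  then show ?thesis
    by (simp add: coords_def[of "hat M a"] vec_eq_iff)
qed

lemma hat_mult: "hat (A ** B) a = hat A (hat B a)"
  unfolding hat_def[of A "hat B a"] hat_def[of "A ** B"] coords_hat tr_hat matrix_vector_mul_assoc ..

lemma hat_1: "hat (mat 1) a = a"
  using expand[of a] by (simp add: hat_def)

lemma linear_coords: "linear coords"
  by (rule linearI) (simp_all add: coords_def vec_eq_iff inner_add_right)

lemma linear_hat: "linear (hat M)"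
  by (rule linearI) (simp_all add: hat_def tr_eq_inner inner_add_right linear_add[OF linear_coords]
      linear_scale[OF linear_coords] matrix_vector_right_distrib matrix_vector_mult_scaleR scaleR_add_left
      sum.distrib add_divide_distrib scaleR_sum_right scaleR_add_right)

lemma inner_coords: "a \<bullet> b = tr a * tr b / 3 + coords a \<bullet> coords b"
proof -
  have "a \<bullet> b = a \<bullet> ((tr b / 3) *\<^sub>R 1 + (\<Sum>i\<in>UNIV. coords b $ i *\<^sub>R e i))"
    using expand[of b] by simp
  then show ?thesis
    by (simp add: inner_add_right inner_sum_right tr_eq_inner inner_vec_def coords_def inner_commute mult.commute)
qed

lemma mat_of_hat: "mat_of (hat M) = M"
proof -
  have "e i \<bullet> hat M (e j) = M $ i $ j" for i j
  proof -
    have "e i \<bullet> hat M (e j) = (M *v coords (e j)) $ i"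
      using coords_hat[of M "e j"] by (simp add: coords_def[of "hat M (e j)"] vec_eq_iff)
    also have "coords (e j) = axis j 1"
      by (simp add: coords_def orth axis_def vec_eq_iff eq_commute)
    finally show ?thesis
      by (simp add: matrix_vector_mult_basis column_def)
  qed
  then show ?thesis
    by (simp add: mat_of_def vec_eq_iff)
qed

lemma hat_mat_of:
  assumes "h \<in> autos"
  shows "hat (mat_of h) = h"
proof
  fix a
  note lin = autosD(1)[OF assms]
  have "h a = (tr a / 3) *\<^sub>R 1 + (\<Sum>j\<in>UNIV. coords a $ j *\<^sub>R h (e j))"
    by (subst expand[of a]) (simp add: linear_add[OF lin] linear_scale[OF lin] linear_sum[OF lin] autos_one[OF assms])
  also have "(\<Sum>j\<in>UNIV. coords a $ j *\<^sub>R h (e j)) = (\<Sum>j\<in>UNIV. \<Sum>i\<in>UNIV. (mat_of h $ i $ j * coords a $ j) *\<^sub>R e i)"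
    by (intro sum.cong HOL.refl, subst expand_op[of h, OF autos_V[OF assms]]) (simp add: scaleR_sum_right mult.commute)
  also have "\<dots> = (\<Sum>i\<in>UNIV. \<Sum>j\<in>UNIV. (mat_of h $ i $ j * coords a $ j) *\<^sub>R e i)"
    by (rule sum.swap)
  also have "\<dots> = (\<Sum>i\<in>UNIV. (mat_of h *v coords a) $ i *\<^sub>R e i)"
    by (simp add: matrix_vector_mult_def scaleR_sum_left)
  finally show "hat (mat_of h) a = h a"
    by (simp add: hat_def)
qed

lemma peval_cubic:
  assumes "linear h" "\<And>j. h (e j) \<in> V_R"
  shows "peval cubic_form (mat_of h) [a, b, c] = (h (e a) \<circ>\<^sub>J h (e b)) \<bullet> h (e c)"
proof -
  have "(h (e a) \<circ>\<^sub>J h (e b)) \<bullet> h (e c) = (\<Sum>(i, j)\<in>UNIV \<times> UNIV. \<Sum>k\<in>UNIV.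
      mat_of h $ i $ a * mat_of h $ j $ b * mat_of h $ k $ c * ((e i \<circ>\<^sub>J e j) \<bullet> e k))"
    by (simp only: expand_op[of h, OF assms(2)] bilinear_sum[OF bilinear_jordan] split_def)
      (simp add: inner_sum_left inner_sum_right jordan_simps sum_distrib_left mult_ac, rule sum.swap)
  then show ?thesis
    by (simp add: peval_def sum_Ls_Suc numeral_3_eq_3 cubic_form_def sum.cartesian_product[symmetric] mult_ac del: UNIV_Times_UNIV)
qed

lemma autos_mat_of:
  assumes "h \<in> autos"
  shows "orthogonal_matrix (mat_of h)" "length d = 3 \<Longrightarrow> peval cubic_form (mat_of h) d = cubic_form d"
proof -
  have "(transpose (mat_of h) ** mat_of h) $ i $ j = mat 1 $ i $ j" for i j
  proof -
    have "h (e i) \<bullet> h (e j) = (\<Sum>k\<in>UNIV. mat_of h $ k $ i * mat_of h $ k $ j)"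
      using arg_cong[OF expand_op[of h i, OF autos_V[OF assms]], of "\<lambda>v. v \<bullet> h (e j)"]
      by (simp add: inner_sum_left mat_of_def)
    then show ?thesis
      by (simp add: autos_inner[OF assms] orth matrix_matrix_mult_def transpose_def mat_def)
  qed
  then show "orthogonal_matrix (mat_of h)"
    by (simp add: orthogonal_matrix vec_eq_iff)
  assume "length d = 3"
  then obtain a b c where d: "d = [a, b, c]"
    by (auto simp: numeral_3_eq_3 length_Suc_conv)
  show "peval cubic_form (mat_of h) d = cubic_form d"
    unfolding d peval_cubic[OF autosD(1)[OF assms] autos_V[OF assms]]
    by (simp add: autosD(3)[OF assms, symmetric] autos_inner[OF assms] cubic_form_def numeral_2_eq_2)
qed

text \<open>The inner product is nondegenerate, so the Jordan product is determined by the trilinear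
  form of \<open>all\<close>. Splitting off multiples of 1 reduces this form to its trace-free part,
  the inner product and the trace, all of which \<open>hat M\<close> preserves.\<close>

lemma hat_autos:
  assumes M: "orthogonal_matrix M" and cub: "\<And>d. length d = 3 \<Longrightarrow> peval cubic_form M d = cubic_form d"
  shows "hat M \<in> autos"
proof (rule autosI[OF linear_hat, of "hat (transpose M)"])
  note lin = linear_hat[of M]
  have inv: "hat (transpose M) (hat M a) = a" "hat M (hat (transpose M) a) = a" for a
    using M unfolding hat_mult[symmetric] by (simp_all add: orthogonal_matrix_def hat_1)
  show "hat (transpose M) (hat M a) = a" "hat M (hat (transpose M) a) = a" for a
    by (rule inv)+
  have inner: "hat M a \<bullet> hat M b = a \<bullet> b" for a b
  proof -
    have "(M *v coords a) \<bullet> (M *v coords b) = coords a \<bullet> (transpose M *v (M *v coords b))"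
      by (metis dot_lmul_matrix transpose_matrix_vector transpose_transpose)
    then show ?thesis
      using M by (simp add: inner_coords coords_hat matrix_vector_mul_assoc orthogonal_matrix_def)
  qed
  have one: "hat M 1 = 1"
    by (simp add: hat_def) (simp add: coords_def matrix_vector_mult_def)
  have eee: "(hat M (e i) \<circ>\<^sub>J hat M (e j)) \<bullet> hat M (e k) = (e i \<circ>\<^sub>J e j) \<bullet> e k" for i j k
    using cub[of "[i, j, k]"] peval_cubic[OF lin, of i j k]
    by (simp add: mat_of_hat cubic_form_def V_R_def numeral_3_eq_3 numeral_2_eq_2)
  have VVV: "(hat M a \<circ>\<^sub>J hat M b) \<bullet> hat M c = (a \<circ>\<^sub>J b) \<bullet> c" if abc: "a \<in> V_R" "b \<in> V_R" "c \<in> V_R" for a b c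
  proof -
    obtain x where "a = (\<Sum>i\<in>UNIV. x i *\<^sub>R e i)"
      by (rule that[OF expand_V[OF abc(1)]])
    moreover obtain y where "b = (\<Sum>i\<in>UNIV. y i *\<^sub>R e i)"
      by (rule that[OF expand_V[OF abc(2)]])
    moreover obtain z where "c = (\<Sum>i\<in>UNIV. z i *\<^sub>R e i)"
      by (rule that[OF expand_V[OF abc(3)]])
    ultimately show ?thesis
      by (simp only: linear_sum[OF lin] linear_scale[OF lin] bilinear_sum[OF bilinear_jordan] split_def)
        (simp add: inner_sum_left inner_sum_right jordan_simps eee)
  qed
  have one_l: "1 \<circ>\<^sub>J a = a" and one_r: "a \<circ>\<^sub>J 1 = a" for a
    by (simp_all add: one_jordan jordan_commute[of a])
  have all: "(hat M a \<circ>\<^sub>J hat M b) \<bullet> hat M c = (a \<circ>\<^sub>J b) \<bullet> c" for a b c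
  proof -
    define p where "p a = a - (tr a / 3) *\<^sub>R 1" for a
    have p: "a = (tr a / 3) *\<^sub>R 1 + p a" "p a \<in> V_R" for a
      by (simp_all add: p_def V_R_def tr_eq_inner inner_diff_right)
    \<comment> \<open>The trilinear form expanded along the multiples of 1 and arbitrary remainders;
      the constant 3 is the trace of 1.\<close>
    have gen: "((r *\<^sub>R 1 + A) \<circ>\<^sub>J (s *\<^sub>R 1 + B)) \<bullet> (u *\<^sub>R 1 + C)
        = 3 * r * s * u + r * s * (1 \<bullet> C) + r * u * (1 \<bullet> B) + r * (B \<bullet> C) + s * u * (1 \<bullet> A) + s * (A \<bullet> C)
          + u * (A \<bullet> B) + (A \<circ>\<^sub>J B) \<bullet> C" for r s u A B C
      by (simp only: jordan_simps one_l one_r inner_add_left inner_add_right inner_scaleR_left inner_scaleR_right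
          scaleR_add_left scaleR_add_right jordan_inner inner_commute[of A 1] inner_commute[of B 1] one_inner_one)
        (simp add: algebra_simps)
    have h: "hat M a = (tr a / 3) *\<^sub>R 1 + hat M (p a)" for a
      using arg_cong[OF p(1)[of a], of "hat M"] by (simp only: linear_add[OF lin] linear_scale[OF lin] one)
    have "1 \<bullet> hat M (p a) = 1 \<bullet> p a" for a
      by (simp add: tr_eq_inner[symmetric])
    then have "(((tr a / 3) *\<^sub>R 1 + hat M (p a)) \<circ>\<^sub>J ((tr b / 3) *\<^sub>R 1 + hat M (p b))) \<bullet> ((tr c / 3) *\<^sub>R 1 + hat M (p c))
        = (((tr a / 3) *\<^sub>R 1 + p a) \<circ>\<^sub>J ((tr b / 3) *\<^sub>R 1 + p b)) \<bullet> ((tr c / 3) *\<^sub>R 1 + p c)"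
      unfolding gen inner VVV[OF p(2)[of a] p(2)[of b] p(2)[of c]] by simp
    then show ?thesis
      unfolding h[symmetric] p(1)[symmetric] .
  qed
  show "hat M (a \<circ>\<^sub>J b) = hat M a \<circ>\<^sub>J hat M b" for a b
  proof -
    have "(hat M (a \<circ>\<^sub>J b) - hat M a \<circ>\<^sub>J hat M b) \<bullet> hat M c = 0" for c
      by (simp add: inner_diff_left inner all)
    \<comment> \<open>The test element is the preimage of the difference, which is thereby
      orthogonal to itself.\<close>
    from this[of "hat (transpose M) (hat M (a \<circ>\<^sub>J b) - hat M a \<circ>\<^sub>J hat M b)"] show ?thesis
      by (simp add: inv)
  qed
qed simp

text \<open>The automorphisms that fix \<open>f\<close> satisfy the assumptions of
  \<open>f4_subgroup\<close>: the one-parameter groups lie among them by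
  \<open>fixed_one_param\<close>, and the required maximum exists by compactness.\<close>

lemma autos_fixed:
  assumes killed: "\<And>\<gamma> D. one_param \<gamma> D \<Longrightarrow> killed N f D" and h: "h \<in> autos"
  shows "fixed N f h"
proof -
  define K where "K = {h \<in> autos. fixed N f h}"
  \<comment> \<open>The matrices of the members of \<open>K\<close>: polynomial equations make the
    set closed, and orthogonality makes it bounded.\<close>
  define S where "S = {M. orthogonal_matrix M \<and> (\<forall>d\<in>Ls 3. peval cubic_form M d = cubic_form d) \<and> (\<forall>c\<in>Ls N. peval f M c = f c)}"
  have fam: "\<gamma> \<theta> \<in> K" if "one_param \<gamma> D" for \<gamma> D \<theta>
    using one_paramD(4)[OF that] fixed_one_param[OF that killed[OF that]] by (simp add: K_def)
  interpret f4_subgroup K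
  proof
    show "k \<in> autos" if "k \<in> K" for k
      using that by (simp add: K_def)
    show "k \<circ> l \<in> K" if "k \<in> K" "l \<in> K" for k l
      using that fixed_comp[of l k N f] autos_comp by (auto simp: K_def)
    show "h \<in> K" if "h \<in> autos" "k \<in> K" "k \<circ> h \<in> K" for h k
      using that fixed_comp[of h k N f] by (auto simp: K_def)
    show "rconj (rot12 t) \<in> K" "rconj (rot23 t) \<in> K" for t
      using fam[OF one_param_rot(1)] fam[OF one_param_rot(2)] by simp_all
    show "triality u \<in> K" if u: "u \<bullet> u = 1" for u
    proof -
      \<comment> \<open>A unit octonion is the cosine of an angle plus its sine times an imaginary
        unit, so it lies on a path of \<open>one_param_triality\<close>.\<close>
      define v where "v = u - oRe u *\<^sub>R 1"
      have vr: "v \<bullet> 1 = 0" "u = oRe u *\<^sub>R 1 + v"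
        by (simp_all add: v_def inner_1_octonion oRe_diff oRe_simps)
      have uv: "(oRe u)\<^sup>2 + (norm v)\<^sup>2 = 1"
        using u vr(1) by (subst (asm) (1 2) vr(2)) (simp add: inner_simps inner_commute power2_norm_eq_inner power2_eq_square[of "oRe u"])
      obtain e where e: "e \<bullet> e = 1" "oRe e = 0" "v = norm v *\<^sub>R e"
      proof (cases "v = 0")
        case True
        \<comment> \<open>Without an imaginary part any imaginary unit serves as direction.\<close>
        show ?thesis
          by (rule that[of "oc \<i> 0 0 0"]) (simp_all add: True inner_oc oc_simps(5))
      next
        case False
        show ?thesis
        proof (rule that[of "(1 / norm v) *\<^sub>R v"])
          show "(1 / norm v) *\<^sub>R v \<bullet> (1 / norm v) *\<^sub>R v = 1"
            using False by (simp add: dot_square_norm power2_eq_square)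
          show "oRe ((1 / norm v) *\<^sub>R v) = 0"
            using vr(1) by (simp add: oRe_simps inner_1_octonion)
        qed (use False in simp)
      qed
      obtain \<theta> where "oRe u = cos \<theta>" "norm v = sin \<theta>"
        using sincos_total_2pi_le[OF uv] by metis
      then have "u = cos \<theta> *\<^sub>R 1 + sin \<theta> *\<^sub>R e"
        using vr(2) e(3) by simp
      then show ?thesis
        using fam[OF one_param_triality[OF e(1,2)]] by simp
    qed
    show "\<exists>k\<in>K. \<forall>l\<in>K. diag_sq (l a) \<le> diag_sq (k a)" for a
    proof -
      have hat_S: "hat M \<in> K" if "M \<in> S" for M
        using that hat_autos[of M] by (simp add: S_def K_def fixed_def mat_of_hat)
      have K_S: "mat_of k \<in> S" if "k \<in> K" for k
        using that autos_mat_of[of k] by (simp add: S_def K_def fixed_def)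
      have "closed {M :: real^'n^'n. transpose M ** M = mat 1}"
        by (intro closed_Collect_eq continuous_intros)
          (auto simp: matrix_matrix_mult_def transpose_def intro!: continuous_intros)
      moreover have "closed {M. \<forall>c\<in>Ls n. peval g M c = g c}" for g :: "'n list \<Rightarrow> real" and n
      proof -
        have "{M. \<forall>c\<in>Ls n. peval g M c = g c} = (\<Inter>c\<in>Ls n. {M. peval g M c = g c})"
          by auto
        then show ?thesis
          by (auto intro!: closed_INT closed_Collect_eq continuous_intros)
      qed
      moreover have "S = {M. transpose M ** M = mat 1} \<inter> {M. \<forall>d\<in>Ls 3. peval cubic_form M d = cubic_form d}
          \<inter> {M. \<forall>c\<in>Ls N. peval f M c = f c}"
        by (auto simp: S_def orthogonal_matrix)
      ultimately have "closed S"
        by auto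
      moreover have "bounded S"
      proof (rule boundedI)
        fix M assume "M \<in> S"
        then have "norm (row i M) = 1" for i
          by (simp add: S_def orthogonal_matrix_orthonormal_rows)
        moreover have "row i M = M $ i" for i
          by (simp add: row_def vec_eq_iff)
        ultimately have "norm (M $ i) = 1" for i
          by simp
        then show "norm M \<le> real CARD('n)"
          unfolding norm_vec_def[of M] using L2_set_le_sum[of UNIV "\<lambda>i. norm (M $ i)"] by simp
      qed
      ultimately have comp: "compact S"
        by (simp add: compact_eq_bounded_closed)
      have "S \<noteq> {}"
        using K_S[OF fam[OF one_param_rot(1)]] by blast
      moreover have "continuous_on S (\<lambda>M. diag_sq (hat M a))"
        unfolding diag_sq_def c_inner hat_def
        by (auto simp: inner_add_left inner_sum_left matrix_vector_mult_def intro!: continuous_intros)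
      ultimately obtain M where M: "M \<in> S" "\<forall>M'\<in>S. diag_sq (hat M' a) \<le> diag_sq (hat M a)"
        using continuous_attains_sup[OF comp] by blast
      show ?thesis
      proof (intro bexI[of _ "hat M"] ballI)
        fix l assume "l \<in> K"
        then show "diag_sq (l a) \<le> diag_sq (hat M a)"
          using M(2) K_S[of l] hat_mat_of[of l] by (auto simp: K_def)
      qed (rule hat_S[OF M(1)])
    qed
  qed
  show ?thesis
    using autos_subset h by (auto simp: K_def)
qed

end

section \<open>Tensor powers and diagrams\<close>

lemma sum_fun_apply: "(\<Sum>k\<in>K. f k) x = (\<Sum>k\<in>K. f k x)" for f :: "'k \<Rightarrow> 'a \<Rightarrow> 'b::comm_monoid_add"
  by (induction K rule: infinite_finite_induct) (auto simp: zero_fun_def plus_fun_def)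

lemma sum_Cx: "(\<Sum>k\<in>K. Cx (f k) (g k)) = Cx (\<Sum>k\<in>K. f k) (\<Sum>k\<in>K. g k)" for f :: "'k \<Rightarrow> 'a::ab_group_add"
  by (induction K rule: infinite_finite_induct) (auto simp: zero_complexification_def plus_complexification_def)

lemma pure_eq: "pure vs \<psi>s = (if length \<psi>s = length vs \<and> functionals \<psi>s
    then prod_list (map2 (\<lambda>\<psi> v. \<psi> v) \<psi>s vs) else 0)"
proof -
  have "(\<Prod>i<length vs. (\<psi>s ! i) (vs ! i)) = prod_list (map2 (\<lambda>\<psi> v. \<psi> v) \<psi>s vs)" if "length \<psi>s = length vs"
    using that
  proof (induction \<psi>s vs rule: list_induct2)
    case (Cons \<psi> \<psi>s v vs)
    then show ?case
      by (simp add: prod.lessThan_Suc_shift del: prod.lessThan_Suc)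
  qed simp
  then show ?thesis
    by (simp add: pure_def)
qed

lemma pure_in_Vpow: "length vs = n \<Longrightarrow> set vs \<subseteq> V \<Longrightarrow> pure vs \<in> Vpow n"
  unfolding Vpow_def by (rule tens.span_base) blast

lemma Vpow_zero: "x \<in> Vpow n \<Longrightarrow> length \<psi>s \<noteq> n \<or> \<not> functionals \<psi>s \<Longrightarrow> x \<psi>s = 0"
  unfolding Vpow_def by (induction rule: tens.span_induct_alt) (auto simp: pure_def tscale_def plus_fun_def zero_fun_def)

lemma tens_mult_Vpow:
  assumes "x \<in> Vpow m" "length \<psi>s = m + n"
  shows "(x \<otimes>\<^sub>T y) \<psi>s = x (take m \<psi>s) * y (drop m \<psi>s)"
proof -
  have "(x \<otimes>\<^sub>T y) \<psi>s = (\<Sum>k\<in>{m}. x (take k \<psi>s) * y (drop k \<psi>s))"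
    unfolding tens_mult_def using assms
    by (intro sum.mono_neutral_right) (auto simp: Vpow_zero)
  then show ?thesis by simp
qed

lemma g_HomD:
  assumes "f \<in> g_Hom (Vpow m) (Vpow n)"
  shows "x \<in> Vpow m \<Longrightarrow> f x \<in> Vpow n" "x \<notin> Vpow m \<Longrightarrow> f x = 0"
    "x \<in> Vpow m \<Longrightarrow> y \<in> Vpow m \<Longrightarrow> f (x + y) = f x + f y"
    "x \<in> Vpow m \<Longrightarrow> f (tscale c x) = tscale c (f x)"
    "X \<in> \<g> \<Longrightarrow> x \<in> Vpow m \<Longrightarrow> f (tens_act X x) = tens_act X (f x)"
  using assms by (auto simp: g_Hom_def)

lemma g_Hom_sum:
  assumes f: "f \<in> g_Hom (Vpow m) (Vpow n)" and "\<And>k. k \<in> K \<Longrightarrow> x k \<in> Vpow m"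
  shows "f (\<Sum>k\<in>K. tscale (a k) (x k)) = (\<Sum>k\<in>K. tscale (a k) (f (x k)))"
proof -
  have 0: "f 0 = 0"
    using g_HomD(4)[OF f, of 0 0] by (simp add: Vpow_def tens.span_zero)
  have *: "(\<Sum>k\<in>K. tscale (a k) (x k)) \<in> Vpow m" if "\<And>k. k \<in> K \<Longrightarrow> x k \<in> Vpow m" for K
    using that unfolding Vpow_def by (intro tens.span_sum tens.span_scale)
  have sc: "tscale c y \<in> Vpow m" if "y \<in> Vpow m" for c y
    using that unfolding Vpow_def by (rule tens.span_scale)
  show ?thesis
    using assms(2)
  proof (induction K rule: infinite_finite_induct)
    case (insert k K)
    have "f (\<Sum>k\<in>insert k K. tscale (a k) (x k)) = f (tscale (a k) (x k) + (\<Sum>k\<in>K. tscale (a k) (x k)))"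
      by (simp only: sum.insert[OF insert(1,2)])
    also have "\<dots> = f (tscale (a k) (x k)) + f (\<Sum>k\<in>K. tscale (a k) (x k))"
      using insert by (intro g_HomD(3)[OF f] sc *) auto
    also have "f (tscale (a k) (x k)) = tscale (a k) (f (x k))"
      using insert by (intro g_HomD(4)[OF f]) auto
    also have "f (\<Sum>k\<in>K. tscale (a k) (x k)) = (\<Sum>k\<in>K. tscale (a k) (f (x k)))"
      using insert by auto
    also have "tscale (a k) (f (x k)) + (\<Sum>k\<in>K. tscale (a k) (f (x k))) = (\<Sum>k\<in>insert k K. tscale (a k) (f (x k)))"
      by (simp only: sum.insert[OF insert(1,2)])
    finally show ?case .
  qed (simp_all add: 0)
qed

section \<open>The functor and the dimension that it forces\<close>

locale T_functor =
  fixes \<Phi> :: "nat \<Rightarrow> nat \<Rightarrow> complex diag set \<Rightarrow> tensor \<Rightarrow> tensor"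
    and B :: "albert set" and dual :: "albert \<Rightarrow> albert"
  assumes basis: "independent B" "span B = V_R"
    and dual: "\<And>a. a \<in> B \<Longrightarrow> dual a \<in> V_R"
      "\<And>a b. a \<in> B \<Longrightarrow> b \<in> B \<Longrightarrow> tr (dual a \<circ>\<^sub>J b) = (if a = b then 1 else 0)"
    and monoidal: "monoidal_functor (7 / 3) 26 \<Phi>"
    and Mu: "\<And>a b. a \<in> V \<Longrightarrow> b \<in> V \<Longrightarrow>
      \<Phi> 2 1 (T_mor (7 / 3) 26 2 1 Mu) (pure [a, b]) = pure [projC (jordanC a b)]"
    and Chi: "\<And>a b. a \<in> V \<Longrightarrow> b \<in> V \<Longrightarrow>
      \<Phi> 2 2 (T_mor (7 / 3) 26 2 2 Chi) (pure [a, b]) = pure [b, a]"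
    and Eta: "\<Phi> 0 2 (T_mor (7 / 3) 26 0 2 Eta) (pure [])
      = (\<Sum>b\<in>B. pure [cx_of b, cx_of (dual b)])"
    and Eps: "\<And>a b. a \<in> V \<Longrightarrow> b \<in> V \<Longrightarrow>
      \<Phi> 2 0 (T_mor (7 / 3) 26 2 0 Eps) (pure [a, b]) = tscale (trC (jordanC a b)) (pure [])"
begin

definition F :: "nat \<Rightarrow> nat \<Rightarrow> complex diag \<Rightarrow> tensor \<Rightarrow> tensor" where
  "F m n t = \<Phi> m n (T_mor (7 / 3) 26 m n t)"

lemma F_Hom: "arr t m n \<Longrightarrow> F m n t \<in> g_Hom (Vpow m) (Vpow n)"
proof -
  assume "arr t m n"
  then have "T_mor (7 / 3) 26 m n t \<in> T_Hom (7 / 3) 26 m n"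
    by (auto simp: T_Hom_def)
  moreover have "\<forall>m n. \<forall>f\<in>T_Hom (7 / 3) 26 m n. \<Phi> m n f \<in> g_Hom (Vpow m) (Vpow n)"
    using monoidal unfolding monoidal_functor_def by (elim conjE)
  ultimately show ?thesis
    unfolding F_def by simp
qed

lemma F_Id: "x \<in> Vpow n \<Longrightarrow> F n n (Id n) x = x"
  using monoidal unfolding monoidal_functor_def F_def by (elim conjE) simp

lemma F_Comp: "arr s n p \<Longrightarrow> arr t m n \<Longrightarrow> x \<in> Vpow m \<Longrightarrow> F m p (Comp s t) x = F n p s (F m n t x)"
  using monoidal unfolding monoidal_functor_def F_def by (elim conjE) simp

lemma F_Add: "arr s m n \<Longrightarrow> arr t m n \<Longrightarrow> x \<in> Vpow m \<Longrightarrow> F m n (Add s t) x = F m n s x + F m n t x"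
  using monoidal unfolding monoidal_functor_def F_def by (elim conjE) simp

lemma F_Scale: "arr t m n \<Longrightarrow> x \<in> Vpow m \<Longrightarrow> F m n (Scale c t) x = tscale c (F m n t x)"
  using monoidal unfolding monoidal_functor_def F_def by (elim conjE) simp

lemma F_Tens: "arr s m n \<Longrightarrow> arr t p q \<Longrightarrow> x \<in> Vpow m \<Longrightarrow> y \<in> Vpow p \<Longrightarrow>
    F (m + p) (n + q) (Tens s t) (x \<otimes>\<^sub>T y) = F m n s x \<otimes>\<^sub>T F p q t y"
  using monoidal unfolding monoidal_functor_def F_def by (elim conjE) simp

lemma F_cong: "diag_eq (7 / 3) 26 m n s t \<Longrightarrow> F m n s = F m n t"
proof -
  assume "diag_eq (7 / 3) 26 m n s t"
  then have "T_mor (7 / 3) 26 m n s = T_mor (7 / 3) 26 m n t"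
    unfolding T_mor_def using diag_eq.trans diag_eq.sym by blast
  then show ?thesis by (simp add: F_def)
qed

lemma cx_of_V: "a \<in> V_R \<Longrightarrow> cx_of a \<in> V"
  by (auto simp: V_def cx_set_def V_R_def tr_eq_inner)

lemma trC_cx_of: "trC (jordanC (cx_of a) (cx_of b)) = of_real (a \<bullet> b)"
proof -
  have "tr 0 = 0"
    by (simp add: tr_eq_inner)
  then show ?thesis
    by (simp add: trC_def jordanC_def cx_bilin_def jordan_simps inner_albert_def complex_eq_iff)
qed

lemma B_V: "b \<in> B \<Longrightarrow> b \<in> V_R"
  using basis(2) span_base by blast

text \<open>In the category \<open>Eps\<close> after \<open>Eta\<close> is 26, while the functor
  turns it into the sum of the pairings of \<open>b\<close> with \<open>dual b\<close>, each of
  which is 1. Finiteness of \<open>B\<close> follows too, as an infinite set has cardinality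
  0.\<close>

lemma card_B: "card B = 26"
proof -
  have unit: "pure [] \<in> Vpow 0"
    by (rule pure_in_Vpow) auto
  have "F 0 0 (Comp Eps Eta) (pure []) = F 2 0 Eps (\<Sum>b\<in>B. tscale 1 (pure [cx_of b, cx_of (dual b)]))"
    using F_Comp[OF arr.intros(5,4) unit] Eta by (simp add: F_def tens.scale_one)
  also have "\<dots> = (\<Sum>b\<in>B. tscale 1 (F 2 0 Eps (pure [cx_of b, cx_of (dual b)])))"
    by (rule g_Hom_sum[OF F_Hom[OF arr.intros(5)]]) (auto intro!: pure_in_Vpow cx_of_V B_V dual)
  also have "\<dots> = (\<Sum>b\<in>B. pure [])"
  proof (rule sum.cong[OF HOL.refl])
    fix b assume b: "b \<in> B"
    have "trC (jordanC (cx_of b) (cx_of (dual b))) = 1"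
      using dual(2)[OF b b] by (simp add: trC_cx_of inner_albert_def jordan_commute[of b])
    then show "tscale 1 (F 2 0 Eps (pure [cx_of b, cx_of (dual b)])) = pure []"
      using Eps[OF cx_of_V[OF B_V[OF b]] cx_of_V[OF dual(1)[OF b]]] by (simp add: F_def tens.scale_one)
  qed
  finally have "F 0 0 (Comp Eps Eta) (pure []) [] = of_nat (card B)"
    by (simp add: sum_fun_apply pure_def functionals_def)
  moreover have "F 0 0 (Comp Eps Eta) (pure []) = tscale 26 (pure [])"
    using F_cong[OF diag_eq.Eps_Eta] F_Scale[OF arr.intros(1) unit, of 26] F_Id[OF unit] by simp
  ultimately have "of_nat (card B) = (26 :: complex)"
    by (simp add: tscale_def pure_def functionals_def)
  then show ?thesis
    by (metis of_nat_eq_iff of_nat_numeral)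
qed

text \<open>Gram-Schmidt applied to \<open>B\<close>. The numeral type as index set turns operators
  into matrices of type \<open>real^26^26\<close>, on which integration and compactness take
  place.\<close>

lemma frame_exists: "\<exists>e :: 26 \<Rightarrow> albert. orthonormal_frame e"
proof -
  have fin: "finite B"
    using card_B by (metis card.infinite zero_neq_numeral)
  obtain C where C: "finite C" "span C = V_R" "pairwise orthogonal C"
    using basis_orthogonal[OF fin] basis(2) by blast
  define D where "D = (\<lambda>x. x /\<^sub>R norm x) ` (C - {0})"
  have unit: "x \<bullet> x = 1" if "x \<in> D" for x
    using that by (auto simp: D_def dot_square_norm power2_eq_square divide_simps split: if_splits)
  have orth: "x \<bullet> y = 0" if xy: "x \<in> D" "y \<in> D" "x \<noteq> y" for x y
  proof -
    obtain x' y' where x': "x' \<in> C" "x = x' /\<^sub>R norm x'" and y': "y' \<in> C" "y = y' /\<^sub>R norm y'"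
      using xy(1,2) by (auto simp: D_def)
    then have "x' \<noteq> y'"
      using xy(3) by blast
    then have "x' \<bullet> y' = 0"
      using C(3) x' y' by (auto simp: pairwise_def orthogonal_def)
    then show ?thesis
      by (simp add: x' y')
  qed
  have "span D = V_R"
  proof
    have "D \<subseteq> span C"
      unfolding D_def by (intro image_subsetI span_scale span_base) simp
    then show "span D \<subseteq> V_R"
      using C(2) by (metis span_minimal subspace_span)
    have "x \<in> span D" if "x \<in> C" for x
    proof (cases "x = 0")
      case False
      then have "x /\<^sub>R norm x \<in> span D"
        unfolding D_def using that by (intro span_base imageI) simp
      from span_scale[OF this, of "norm x"] False show ?thesis by simp
    qed (simp add: span_zero)
    then show "V_R \<subseteq> span D"
      using C(2) by (metis span_minimal subspace_span subsetI)
  qed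
  moreover have "independent D"
  proof (rule pairwise_orthogonal_independent)
    show "pairwise orthogonal D"
      using orth by (auto simp: pairwise_def orthogonal_def)
    show "0 \<notin> D"
      using unit[of 0] by auto
  qed
  ultimately have "card D = 26"
    using basis card_B by (metis dim_eq_card)
  then obtain e :: "26 \<Rightarrow> albert" where e: "bij_betw e UNIV D"
    using finite_same_card_bij[of "UNIV :: 26 set" D] card.infinite[of D] by fastforce
  have eD: "e i \<in> D" and inj: "e i = e j \<longleftrightarrow> i = j" for i j
    using e by (auto simp: bij_betw_def inj_eq)
  have "orthonormal_frame e"
  proof
    show "e i \<bullet> e j = (if i = j then 1 else 0)" for i j
      using unit[OF eD] orth[OF eD eD] inj by auto
    show "e i \<in> V_R" for i
      using eD \<open>span D = V_R\<close> span_base by blast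
    show "V_R \<subseteq> span (range e)"
      using e \<open>span D = V_R\<close> by (simp add: bij_betw_def)
  qed
  then show ?thesis by (intro exI)
qed

end

section \<open>Coordinates of tensors and of diagrams\<close>

locale T_functor_frame = T_functor \<Phi> B dual + orthonormal_frame e
  for \<Phi> B dual and e :: "26 \<Rightarrow> albert"
begin

definition E :: "26 \<Rightarrow> albert complexification" where "E i = cx_of (e i)"

definition \<phi> :: "26 \<Rightarrow> functional" where "\<phi> i v = Complex (e i \<bullet> cxRe v) (e i \<bullet> cxIm v)"

definition pe :: "26 list \<Rightarrow> tensor" where "pe c = pure (map E c)"

text \<open>The functionals \<open>\<phi>\<close> are dual to the frame, so these are the
  coordinates in the basis \<open>pe\<close>. By \<open>Vpow_eqI\<close> they determine an element
  of a tensor power.\<close>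

definition co :: "tensor \<Rightarrow> 26 list \<Rightarrow> complex" where "co x d = x (map \<phi> d)"

lemma E_V: "E i \<in> V"
  unfolding E_def by (rule cx_of_V[OF e_V])

lemma pe_Vpow: "length c = n \<Longrightarrow> pe c \<in> Vpow n"
  unfolding pe_def by (rule pure_in_Vpow) (auto simp: E_V)

lemma linear_\<phi>: "Vector_Spaces.linear scaleC (*) (\<phi> i)"
proof -
  have vs: "vector_space ((*) :: complex \<Rightarrow> complex \<Rightarrow> complex)"
    by unfold_locales (auto simp: algebra_simps)
  show ?thesis
    by (intro Vector_Spaces.linear.intro module_hom.intro module_hom_axioms.intro)
      (auto simp: \<phi>_def scaleC_def plus_complexification_def inner_simps complex_eq_iff algebra_simps
        intro: cx.vector_space_axioms cx.module_axioms vs vs[folded module_iff_vector_space])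
qed

lemma functionals_\<phi>: "functionals (map \<phi> d)"
  by (auto simp: functionals_def linear_\<phi>)

lemma \<phi>_E: "\<phi> i (E j) = (if i = j then 1 else 0)"
  by (simp add: \<phi>_def E_def orth complex_eq_iff)

lemma V_expand:
  assumes "v \<in> V" shows "v = (\<Sum>i\<in>UNIV. scaleC (\<phi> i v) (E i))"
proof -
  obtain a b where v: "v = Cx a b" "a \<in> V_R" "b \<in> V_R"
    using assms by (auto simp: V_def cx_set_def)
  have "(\<Sum>i\<in>UNIV. scaleC (\<phi> i v) (E i)) = Cx (\<Sum>i\<in>UNIV. (e i \<bullet> a) *\<^sub>R e i) (\<Sum>i\<in>UNIV. (e i \<bullet> b) *\<^sub>R e i)"
    by (simp add: v \<phi>_def E_def scaleC_def sum_Cx)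
  then show ?thesis
    using expand_V[OF v(2)] expand_V[OF v(3)] v(1) by simp
qed

lemma prod_list_expand:
  assumes "length \<psi>s = length vs" "functionals \<psi>s" "set vs \<subseteq> V"
  shows "prod_list (map2 (\<lambda>\<psi> v. \<psi> v) \<psi>s vs)
    = (\<Sum>c\<in>Ls (length vs). prod_list (map2 \<phi> c vs) * prod_list (map2 (\<lambda>\<psi> v. \<psi> v) \<psi>s (map E c)))"
  using assms
proof (induction \<psi>s vs rule: list_induct2)
  case (Cons \<psi> \<psi>s v vs)
  then have lin: "Vector_Spaces.linear scaleC (*) \<psi>" and fs: "functionals \<psi>s"
    by (auto simp: functionals_def)
  interpret l: Vector_Spaces.linear scaleC "(*)" \<psi> by (rule lin)
  have "\<psi> v = (\<Sum>i\<in>UNIV. \<phi> i v * \<psi> (E i))"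
    using arg_cong[OF V_expand[of v], of \<psi>] Cons.prems by (simp add: l.sum l.scale)
  then show ?case
    using Cons.IH[OF fs] Cons.prems by (simp add: sum_Ls_Suc sum_product mult_ac)
qed simp

lemma pure_expand:
  assumes "length vs = n" "set vs \<subseteq> V"
  shows "pure vs = (\<Sum>c\<in>Ls n. tscale (prod_list (map2 \<phi> c vs)) (pe c))"
proof
  fix \<psi>s
  show "pure vs \<psi>s = (\<Sum>c\<in>Ls n. tscale (prod_list (map2 \<phi> c vs)) (pe c)) \<psi>s"
    using prod_list_expand[of \<psi>s vs] assms
    by (auto simp: sum_fun_apply tscale_def pe_def pure_eq intro!: sum.cong)
qed

lemma co_pe: "length c = length d \<Longrightarrow> co (pe c) d = (if c = d then 1 else 0)"
proof -
  assume l: "length c = length d"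
  then have "prod_list (map2 (\<lambda>\<psi> v. \<psi> v) (map \<phi> d) (map E c)) = (if c = d then 1 else 0)"
    by (induction c d rule: list_induct2) (auto simp: \<phi>_E)
  then show ?thesis
    using l by (simp add: co_def pe_def pure_eq functionals_\<phi>)
qed

lemma co_add: "co (x + y) d = co x d + co y d"
  by (simp add: co_def plus_fun_def)

lemma co_scale: "co (tscale a x) d = a * co x d"
  by (simp add: co_def tscale_def)

lemma co_sum: "co (\<Sum>k\<in>K. x k) d = (\<Sum>k\<in>K. co (x k) d)"
  by (simp add: co_def sum_fun_apply)

lemma co_lincomb: "length d = n \<Longrightarrow> co (\<Sum>c\<in>Ls n. tscale (a c) (pe c)) d = a d"
proof -
  assume d: "length d = n"
  have "co (\<Sum>c\<in>Ls n. tscale (a c) (pe c)) d = (\<Sum>c\<in>Ls n. if c = d then a d else 0)"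
    unfolding co_sum co_scale by (intro sum.cong HOL.refl) (use d in \<open>auto simp: co_pe\<close>)
  then show ?thesis
    using d by simp
qed

lemma Vpow_expand:
  assumes "x \<in> Vpow n" shows "x = (\<Sum>c\<in>Ls n. tscale (co x c) (pe c))"
proof -
  have "\<exists>a. x = (\<Sum>c\<in>Ls n. tscale (a c) (pe c))"
    using assms unfolding Vpow_def
  proof (induction rule: tens.span_induct_alt)
    case base
    have "0 = (\<Sum>c\<in>Ls n. tscale 0 (pe c))"
      by simp
    then show ?case by (intro exI)
  next
    case (step r y x)
    then obtain a vs where "x = (\<Sum>c\<in>Ls n. tscale (a c) (pe c))" "y = pure vs" "length vs = n" "set vs \<subseteq> V"
      by auto
    then have "tscale r y + x = (\<Sum>c\<in>Ls n. tscale (r * prod_list (map2 \<phi> c vs) + a c) (pe c))"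
      by (simp only: pure_expand tens.scale_sum_right tens.scale_scale tens.scale_left_distrib sum.distrib)
    then show ?case by (intro exI)
  qed
  then obtain a where "x = (\<Sum>c\<in>Ls n. tscale (a c) (pe c))" ..
  moreover have "(\<Sum>c\<in>Ls n. tscale (a c) (pe c)) = (\<Sum>c\<in>Ls n. tscale (co (\<Sum>c\<in>Ls n. tscale (a c) (pe c)) c) (pe c))"
    by (rule sum.cong[OF HOL.refl]) (simp only: co_lincomb mem_Collect_eq)
  ultimately show ?thesis by simp
qed

lemma Vpow_eqI:
  assumes "x \<in> Vpow n" "y \<in> Vpow n" "\<And>d. length d = n \<Longrightarrow> co x d = co y d"
  shows "x = y"
  by (subst Vpow_expand[OF assms(1)], subst Vpow_expand[OF assms(2)])
    (intro sum.cong HOL.refl, simp add: assms(3))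

lemma co_tens:
  assumes "x \<in> Vpow m" "length d = m + n"
  shows "co (x \<otimes>\<^sub>T y) d = co x (take m d) * co y (drop m d)"
  using assms by (simp add: co_def tens_mult_Vpow[of x m _ n] take_map drop_map)

lemma pe_append: "pe (c @ d) = pe c \<otimes>\<^sub>T pe d"
  by (simp add: pe_def pure_append)

lemma g_Hom_co:
  assumes f: "f \<in> g_Hom (Vpow m) (Vpow n)" and x: "x \<in> Vpow m"
  shows "co (f x) d = (\<Sum>c\<in>Ls m. co x c * co (f (pe c)) d)"
proof -
  have "f x = (\<Sum>c\<in>Ls m. tscale (co x c) (f (pe c)))"
    by (subst Vpow_expand[OF x]) (intro g_Hom_sum[OF f], simp add: pe_Vpow)
  then show ?thesis
    by (simp only: co_sum co_scale)
qed

text \<open>Identity strands contribute Kronecker deltas, which leaves a sum over the middle indices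
  only. The closure of \<open>A\<close> under applying a generator rests on this formula.\<close>

lemma local_op:
  assumes t: "arr t k (m + p + n)" and s: "arr s p q" and x: "x \<in> Vpow k"
    and d: "length d1 = m" "length d2 = q" "length d3 = n"
  defines "u \<equiv> Comp (Tens (Tens (Id m) s) (Id n)) t"
  shows "arr u k (m + q + n)"
    and "co (F k (m + q + n) u x) (d1 @ d2 @ d3)
      = (\<Sum>c\<in>Ls p. co (F k (m + p + n) t x) (d1 @ c @ d3) * co (F p q s (pe c)) d2)"
proof -
  have L: "arr (Tens (Tens (Id m) s) (Id n)) (m + p + n) (m + q + n)"
    by (intro arr.intros s)
  show "arr u k (m + q + n)"
    unfolding u_def by (rule arr.intros(7)[OF L t])
  define y where "y = F k (m + p + n) t x"
  have y: "y \<in> Vpow (m + p + n)"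
    unfolding y_def by (rule g_HomD(1)[OF F_Hom[OF t] x])
  have ent: "co (F (m + p + n) (m + q + n) (Tens (Tens (Id m) s) (Id n)) (pe ((c1 @ c) @ c3))) (d1 @ d2 @ d3)
      = (if c1 = d1 \<and> c3 = d3 then co (F p q s (pe c)) d2 else 0)"
    if c: "length c1 = m" "length c = p" "length c3 = n" for c1 c c3
  proof -
    have pc: "pe c1 \<in> Vpow m" "pe c \<in> Vpow p" "pe c3 \<in> Vpow n" "pe (c1 @ c) \<in> Vpow (m + p)"
      using c by (simp_all add: pe_Vpow)
    have sc: "F p q s (pe c) \<in> Vpow q"
      by (rule g_HomD(1)[OF F_Hom[OF s] pc(2)])
    have 1: "F (m + p) (m + q) (Tens (Id m) s) (pe (c1 @ c)) = pe c1 \<otimes>\<^sub>T F p q s (pe c)"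
      unfolding pe_append[of c1 c] using F_Tens[OF arr.intros(1) s pc(1,2)] by (simp add: F_Id[OF pc(1)])
    have 2: "F (m + p + n) (m + q + n) (Tens (Tens (Id m) s) (Id n)) (pe ((c1 @ c) @ c3))
        = F (m + p) (m + q) (Tens (Id m) s) (pe (c1 @ c)) \<otimes>\<^sub>T pe c3"
      unfolding pe_append[of "c1 @ c" c3]
      using F_Tens[OF arr.intros(8)[OF arr.intros(1) s] arr.intros(1) pc(4,3)] by (simp add: F_Id[OF pc(3)])
    have 3: "F (m + p) (m + q) (Tens (Id m) s) (pe (c1 @ c)) \<in> Vpow (m + q)"
      by (rule g_HomD(1)[OF F_Hom[OF arr.intros(8)[OF arr.intros(1) s]] pc(4)])
    show ?thesis
      unfolding 2 co_tens[OF 3, of "d1 @ d2 @ d3" n, simplified d length_append add.assoc, OF HOL.refl]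
      using d c by (simp add: 1 co_tens[OF pc(1), of _ q] co_pe)
  qed
  have "co (F k (m + q + n) u x) (d1 @ d2 @ d3)
      = (\<Sum>w\<in>Ls (m + p + n). co y w * co (F (m + p + n) (m + q + n) (Tens (Tens (Id m) s) (Id n)) (pe w)) (d1 @ d2 @ d3))"
    unfolding u_def F_Comp[OF L t x] y_def[symmetric] by (rule g_Hom_co[OF F_Hom[OF L] y])
  also have "\<dots> = (\<Sum>c1\<in>Ls m. \<Sum>c\<in>Ls p. \<Sum>c3\<in>Ls n. co y ((c1 @ c) @ c3) *
      (if c1 = d1 \<and> c3 = d3 then co (F p q s (pe c)) d2 else 0))"
    unfolding sum_Ls_add by (intro sum.cong HOL.refl) (simp only: ent mem_Collect_eq)
  also have "\<dots> = (\<Sum>c1\<in>Ls m. if c1 = d1 then \<Sum>c\<in>Ls p. co y (d1 @ c @ d3) * co (F p q s (pe c)) d2 else 0)"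
  proof (intro sum.cong HOL.refl)
    fix c1 :: "26 list"
    show "(\<Sum>c\<in>Ls p. \<Sum>c3\<in>Ls n. co y ((c1 @ c) @ c3) * (if c1 = d1 \<and> c3 = d3 then co (F p q s (pe c)) d2 else 0))
      = (if c1 = d1 then \<Sum>c\<in>Ls p. co y (d1 @ c @ d3) * co (F p q s (pe c)) d2 else 0)"
    proof (cases "c1 = d1")
      case True
      have "(\<Sum>c3\<in>Ls n. co y ((c1 @ c) @ c3) * (if c1 = d1 \<and> c3 = d3 then z else 0)) = co y (d1 @ c @ d3) * z" for c z
        using d True by (simp add: if_distrib cong: if_cong)
      then show ?thesis
        using True by simp
    qed simp
  qed
  also have "\<dots> = (\<Sum>c\<in>Ls p. co y (d1 @ c @ d3) * co (F p q s (pe c)) d2)"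
    using d by simp
  finally show "co (F k (m + q + n) u x) (d1 @ d2 @ d3)
      = (\<Sum>c\<in>Ls p. co (F k (m + p + n) t x) (d1 @ c @ d3) * co (F p q s (pe c)) d2)"
    by (simp add: y_def)
qed

lemma co_Eps: "co (F 2 0 Eps (pe [i, j])) [] = (if i = j then 1 else 0)"
  using Eps[OF E_V[of i] E_V[of j]]
  by (simp add: pe_def F_def E_def trC_cx_of orth) (simp add: co_def tscale_def pure_def functionals_def)

lemma co_Chi: "length d = 2 \<Longrightarrow> co (F 2 2 Chi (pe [i, j])) d = (if d = [j, i] then 1 else 0)"
  using Chi[OF E_V[of i] E_V[of j]] co_pe[of "[j, i]" d] by (auto simp: pe_def F_def)

text \<open>The projection subtracts a multiple of 1, to which every frame vector is orthogonal; the
  coordinate is thus the plain cubic form.\<close>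

lemma co_Mu: "co (F 2 1 Mu (pe [i, j])) [k] = of_real (cubic_form [i, j, k])"
proof -
  have "F 2 1 Mu (pe [i, j]) = pure [projC (jordanC (E i) (E j))]"
    using Mu[OF E_V[of i] E_V[of j]] by (simp add: pe_def F_def)
  moreover have "\<phi> k (projC (jordanC (E i) (E j))) = of_real (cubic_form [i, j, k])"
    by (simp add: \<phi>_def projC_def jordanC_def cx_bilin_def E_def jordan_simps proj_def inner_simps complex_eq_iff
        cubic_form_def inner_commute numeral_2_eq_2 tr_eq_inner)
  ultimately show ?thesis
    using functionals_\<phi>[of "[k]"] by (simp add: co_def pure_eq)
qed

text \<open>Pairing with the dual basis returns the coefficients of \<open>e j\<close> in
  \<open>B\<close>, so the sum over \<open>B\<close> collapses to the inner product of two frame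
  vectors.\<close>

lemma co_Eta: "co (F 0 2 Eta (pure [])) [i, j] = (if i = j then 1 else 0)"
proof -
  have fin: "finite B"
    using card_B by (metis card.infinite zero_neq_numeral)
  obtain u where u: "e j = (\<Sum>b\<in>B. u b *\<^sub>R b)"
    using e_V[of j] basis(2) span_finite[OF fin] by auto
  have "dual b \<bullet> e j = u b" if b: "b \<in> B" for b
  proof -
    have "dual b \<bullet> e j = (\<Sum>a\<in>B. u a * (if b = a then 1 else 0))"
      unfolding u inner_sum_right by (intro sum.cong HOL.refl) (simp add: inner_albert_def[symmetric] dual(2)[OF b, folded inner_albert_def])
    then show ?thesis
      using fin b by (simp add: sum.delta' if_distrib cong: if_cong)
  qed
  then have "(\<Sum>b\<in>B. (e i \<bullet> b) * (e j \<bullet> dual b)) = e i \<bullet> e j"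
    by (subst (2) u) (auto simp: inner_sum_right inner_commute[of "e j"] mult.commute intro!: sum.cong)
  moreover have "co (F 0 2 Eta (pure [])) [i, j] = (\<Sum>b\<in>B. of_real ((e i \<bullet> b) * (e j \<bullet> dual b)))"
    using Eta functionals_\<phi>[of "[i, j]"]
    by (simp add: F_def co_sum) (simp add: co_def pure_eq \<phi>_def complex_eq_iff cong: sum.cong)
  ultimately show ?thesis
    by (simp only: of_real_sum[symmetric] orth) simp
qed

section \<open>The arrays of diagrams as a tensor family\<close>

text \<open>The coordinates are required to be real, although diagrams carry complex coefficients,
  because \<open>tensor_family\<close> works over the reals. Complex arrays are assembled from two
  real ones in \<open>full\<close>.\<close>

definition A :: "nat \<Rightarrow> (26 list \<Rightarrow> real) set" where
  "A n = {a. \<exists>t. arr t 0 n \<and> (\<forall>d. length d = n \<longrightarrow> co (F 0 n t (pure [])) d = of_real (a d))}"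

lemma unit_Vpow: "pure [] \<in> Vpow 0"
  by (rule pure_in_Vpow) auto

lemma length_2: "length c = 2 \<longleftrightarrow> (\<exists>i j. c = [i, j])"
  by (auto simp: numeral_2_eq_2 length_Suc_conv)

lemma A_cong: "a \<in> A n \<Longrightarrow> (\<And>i. length i = n \<Longrightarrow> a i = b i) \<Longrightarrow> b \<in> A n"
  by (auto simp: A_def)

lemma A_local_op:
  assumes a: "a \<in> A (m + p + n)" and s: "arr s p q"
    and g: "\<And>c d. length c = p \<Longrightarrow> length d = q \<Longrightarrow> co (F p q s (pe c)) d = of_real (g c d)"
  shows "(\<lambda>i. \<Sum>c\<in>Ls p. a (take m i @ c @ drop (m + q) i) * g c (take q (drop m i))) \<in> A (m + q + n)"
proof -
  obtain t where t: "arr t 0 (m + p + n)"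
    and ta: "\<And>d. length d = m + p + n \<Longrightarrow> co (F 0 (m + p + n) t (pure [])) d = of_real (a d)"
    using a by (auto simp: A_def)
  let ?u = "Comp (Tens (Tens (Id m) s) (Id n)) t"
  have "co (F 0 (m + q + n) ?u (pure [])) d
      = of_real (\<Sum>c\<in>Ls p. a (take m d @ c @ drop (m + q) d) * g c (take q (drop m d)))"
    if d: "length d = m + q + n" for d
  proof -
    have "d = take m d @ take q (drop m d) @ drop (m + q) d"
      by (metis append_take_drop_id drop_drop add.commute)
    then have "co (F 0 (m + q + n) ?u (pure [])) d
        = co (F 0 (m + q + n) ?u (pure [])) (take m d @ take q (drop m d) @ drop (m + q) d)"
      by simp
    also have "\<dots> = (\<Sum>c\<in>Ls p. co (F 0 (m + p + n) t (pure [])) (take m d @ c @ drop (m + q) d) * co (F p q s (pe c)) (take q (drop m d)))"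
      by (rule local_op(2)[OF t s unit_Vpow]) (use d in auto)
    also have "\<dots> = (\<Sum>c\<in>Ls p. of_real (a (take m d @ c @ drop (m + q) d) * g c (take q (drop m d))))"
      by (intro sum.cong HOL.refl) (use d in \<open>auto simp: ta g\<close>)
    finally show ?thesis by simp
  qed
  then show ?thesis
    unfolding A_def using local_op(1)[OF t s unit_Vpow, of "[]"] arr.intros(7)[OF arr.intros(8)[OF arr.intros(8)[OF arr.intros(1) s] arr.intros(1)] t]
    by blast
qed

lemma A_add: "a \<in> A n \<Longrightarrow> b \<in> A n \<Longrightarrow> (\<lambda>i. a i + b i) \<in> A n"
proof -
  assume "a \<in> A n" "b \<in> A n"
  then obtain s t where "arr s 0 n" "arr t 0 n"
    and "\<And>d. length d = n \<Longrightarrow> co (F 0 n s (pure [])) d = of_real (a d)"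
    and "\<And>d. length d = n \<Longrightarrow> co (F 0 n t (pure [])) d = of_real (b d)"
    by (auto simp: A_def)
  then show ?thesis
    unfolding A_def by (auto intro!: exI[of _ "Add s t"] arr.intros simp: F_Add unit_Vpow co_add)
qed

lemma A_scale: "a \<in> A n \<Longrightarrow> (\<lambda>i. r * a i) \<in> A n"
proof -
  assume "a \<in> A n"
  then obtain s where "arr s 0 n" "\<And>d. length d = n \<Longrightarrow> co (F 0 n s (pure [])) d = of_real (a d)"
    by (auto simp: A_def)
  then show ?thesis
    unfolding A_def by (auto intro!: exI[of _ "Scale (of_real r) s"] arr.intros simp: F_Scale unit_Vpow co_scale)
qed

lemma A_tensor:
  assumes "a \<in> A m" "b \<in> A n"
  shows "(\<lambda>i. a (take m i) * b (drop m i)) \<in> A (m + n)"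
proof -
  obtain s t where st: "arr s 0 m" "arr t 0 n"
    and sa: "\<And>d. length d = m \<Longrightarrow> co (F 0 m s (pure [])) d = of_real (a d)"
    and tb: "\<And>d. length d = n \<Longrightarrow> co (F 0 n t (pure [])) d = of_real (b d)"
    using assms by (auto simp: A_def)
  have "F 0 (m + n) (Tens s t) (pure []) = F 0 m s (pure []) \<otimes>\<^sub>T F 0 n t (pure [])"
    using F_Tens[OF st unit_Vpow unit_Vpow] by (simp add: pure_append)
  moreover have "F 0 m s (pure []) \<in> Vpow m"
    by (rule g_HomD(1)[OF F_Hom[OF st(1)] unit_Vpow])
  ultimately have "co (F 0 (m + n) (Tens s t) (pure [])) d = of_real (a (take m d) * b (drop m d))"
    if "length d = m + n" for d
    using that by (simp add: co_tens[of _ m d n] sa tb)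
  moreover have "arr (Tens s t) 0 (m + n)"
    using arr.intros(8)[OF st] by simp
  ultimately show ?thesis
    unfolding A_def by blast
qed

lemma A_one: "(\<lambda>_. 1) \<in> A 0"
  unfolding A_def using arr.intros(1)[of 0] functionals_\<phi>[of "[]"]
  by (auto intro!: exI[of _ "Id 0"] simp: F_Id unit_Vpow co_def pure_eq)

lemma A_delta: "(\<lambda>i. if i ! 0 = i ! 1 then 1 else 0) \<in> A 2"
  unfolding A_def using arr.intros(4) co_Eta
  by (auto intro!: exI[of _ Eta] simp: length_Suc_conv numeral_2_eq_2)

lemma A_contract:
  assumes "a \<in> A (m + 2 + n)"
  shows "(\<lambda>i. \<Sum>x\<in>UNIV. a (take m i @ [x, x] @ drop m i)) \<in> A (m + n)"
proof -
  define g :: "26 list \<Rightarrow> 26 list \<Rightarrow> real" where "g c d = (if c ! 0 = c ! 1 then 1 else 0)" for c d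
  have "(\<lambda>i. \<Sum>c\<in>Ls 2. a (take m i @ c @ drop (m + 0) i) * g c (take 0 (drop m i))) \<in> A (m + 0 + n)"
    by (rule A_local_op[OF assms arr.intros(5)]) (auto simp: co_Eps g_def length_2)
  moreover have "(\<Sum>c\<in>Ls 2. a (take m i @ c @ drop (m + 0) i) * g c (take 0 (drop m i)))
      = (\<Sum>x\<in>UNIV. a (take m i @ [x, x] @ drop m i))" for i
    by (simp add: sum_Ls_Suc numeral_2_eq_2 g_def if_distrib cong: if_cong)
  ultimately show ?thesis by simp
qed

lemma A_swap:
  assumes "a \<in> A (m + 2 + n)"
  shows "(\<lambda>i. a (take m i @ [i ! Suc m, i ! m] @ drop (m + 2) i)) \<in> A (m + 2 + n)"
proof -
  define g :: "26 list \<Rightarrow> 26 list \<Rightarrow> real" where "g c d = (if d = [c ! 1, c ! 0] then 1 else 0)" for c d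
  have "(\<lambda>i. \<Sum>c\<in>Ls 2. a (take m i @ c @ drop (m + 2) i) * g c (take 2 (drop m i))) \<in> A (m + 2 + n)"
    by (rule A_local_op[OF assms arr.intros(3)]) (auto simp: co_Chi g_def length_2 split: if_splits)
  then show ?thesis
    unfolding A_def mem_Collect_eq
  proof (elim exE conjE, intro exI conjI allI impI)
    fix t and d :: "26 list"
    assume t: "\<forall>d. length d = m + 2 + n \<longrightarrow> co (F 0 (m + 2 + n) t (pure [])) d
        = of_real (\<Sum>c\<in>Ls 2. a (take m d @ c @ drop (m + 2) d) * g c (take 2 (drop m d)))"
      and d: "length d = m + 2 + n"
    have "take 2 (drop m d) = [d ! m, d ! Suc m]"
      using d by (simp add: list_eq_iff_nth_eq All_less_Suc2 numeral_2_eq_2)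
    then have "(\<Sum>c\<in>Ls 2. a (take m d @ c @ drop (m + 2) d) * g c (take 2 (drop m d)))
        = (\<Sum>x\<in>UNIV. \<Sum>y\<in>UNIV. if d ! m = y \<and> d ! Suc m = x then a (take m d @ [x, y] @ drop (m + 2) d) else 0)"
      by (simp add: sum_Ls_Suc numeral_2_eq_2 g_def if_distrib cong: if_cong)
    also have "\<dots> = (\<Sum>x\<in>UNIV. if d ! Suc m = x then a (take m d @ [x, d ! m] @ drop (m + 2) d) else 0)"
      by (intro sum.cong HOL.refl) simp
    also have "\<dots> = a (take m d @ [d ! Suc m, d ! m] @ drop (m + 2) d)"
      by simp
    finally show "co (F 0 (m + 2 + n) t (pure [])) d = of_real (a (take m d @ [d ! Suc m, d ! m] @ drop (m + 2) d))"
      by (rule HOL.trans[OF t[rule_format, OF d] arg_cong[of _ _ of_real]])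
  qed
qed

text \<open>Two copies of \<open>Eta\<close> supply four legs; \<open>Mu\<close> consumes the last
  two, and its inputs reappear as the first two outputs.\<close>

lemma A_cubic: "cubic_form \<in> A 3"
proof -
  define g :: "26 list \<Rightarrow> 26 list \<Rightarrow> real" where "g c d = cubic_form [c ! 0, c ! 1, d ! 0]" for c d
  define a :: "26 list \<Rightarrow> real" where "a i = (if i ! 0 = i ! 2 then 1 else 0) * (if i ! 1 = i ! 3 then 1 else 0)" for i
  have n: "2 + 2 = 1 + 2 + (1 :: nat)" "1 + 2 + 1 = 2 + 2 + (0 :: nat)"
    by simp_all
  \<comment> \<open>A product of two deltas pairs 0 with 1 and 2 with 3; one swap in the middle
    pairs 0 with 2 and 1 with 3.\<close>
  have "a \<in> A (1 + 2 + 1)"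
    by (rule A_cong[OF A_swap[OF A_tensor[OF A_delta A_delta, unfolded n(1)]]])
      (auto simp: a_def length_Suc_conv numeral_eq_Suc)
  then have "a \<in> A (2 + 2 + 0)"
    unfolding n(2) .
  have "co (F 2 1 Mu (pe c)) d = of_real (g c d)" if "length c = 2" "length d = 1" for c d
  proof -
    from \<open>length c = 2\<close> obtain i j where "c = [i, j]"
      unfolding numeral_2_eq_2 length_Suc_conv by auto
    moreover from \<open>length d = 1\<close> obtain k where "d = [k]"
      unfolding One_nat_def length_Suc_conv by auto
    ultimately show ?thesis
      using co_Mu[of i j k] by (simp add: g_def)
  qed
  then have "(\<lambda>i. \<Sum>c\<in>Ls 2. a (take 2 i @ c @ drop (2 + 1) i) * g c (take 1 (drop 2 i))) \<in> A (2 + 1 + 0)"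
    by (rule A_local_op[OF \<open>a \<in> A (2 + 2 + 0)\<close> arr.intros(2)])
  then obtain t where t: "arr t 0 3" and
    td: "\<And>d. length d = 3 \<Longrightarrow> co (F 0 3 t (pure [])) d = of_real (\<Sum>c\<in>Ls 2. a (take 2 d @ c @ drop 3 d) * g c (take 1 (drop 2 d)))"
    unfolding A_def by auto
  have "co (F 0 3 t (pure [])) d = of_real (cubic_form d)" if d: "length d = 3" for d
  proof -
    obtain i j k where ijk: "d = [i, j, k]"
      using d by (auto simp: numeral_3_eq_3 length_Suc_conv)
    have "(\<Sum>c\<in>Ls 2. a (take 2 d @ c @ drop 3 d) * g c (take 1 (drop 2 d)))
        = (\<Sum>x\<in>UNIV. \<Sum>y\<in>UNIV. if i = x then if j = y then cubic_form [x, y, k] else 0 else 0)"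
      unfolding ijk by (auto simp: sum_Ls_Suc numeral_2_eq_2 numeral_3_eq_3 a_def g_def intro!: sum.cong)
    also have "\<dots> = (\<Sum>x\<in>UNIV. if i = x then cubic_form [x, j, k] else 0)"
      by (intro sum.cong HOL.refl) simp
    also have "\<dots> = cubic_form [i, j, k]"
      by simp
    finally show ?thesis
      using td[OF d] ijk by simp
  qed
  then show ?thesis
    using t by (auto simp: A_def)
qed

sublocale tensor_family A cubic_form
proof
  show "a \<in> A n \<Longrightarrow> (\<And>i. length i = n \<Longrightarrow> a i = b i) \<Longrightarrow> b \<in> A n" for a b n
    by (auto simp: A_def)
qed (fact A_add A_scale A_one A_tensor A_contract A_swap A_delta A_cubic)+

section \<open>Invariance under the Lie algebra\<close>

lemma killed_mem:
  assumes "\<And>\<gamma> D. one_param \<gamma> D \<Longrightarrow> killed N f D"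
  shows "f \<in> A N"
proof (rule invariant_mem)
  fix h :: "real^26^26" and c :: "26 list"
  assume "orthogonal_matrix h" "\<And>d. length d = 3 \<Longrightarrow> peval cubic_form h d = cubic_form d" "length c = N"
  then have "fixed N f (hat h)"
    by (intro autos_fixed[OF assms] hat_autos)
  then show "peval f h c = f c"
    using \<open>length c = N\<close> by (simp add: fixed_def mat_of_hat)
qed

text \<open>Both components of an element of the complexified Lie algebra must lie in
  \<open>Lie_G\<close>, so the elements \<open>Cx D 0\<close> need 0 there.\<close>

lemma zero_Lie_G: "0 \<in> Lie_G"
proof -
  have "id \<in> autos"
    by (rule autosI[of id id]) (auto intro: linearI)
  then have "one_param (\<lambda>_. id) (\<lambda>_. 0)"
    unfolding one_param_def by (auto intro!: exI[of _ 0] linearI)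
  then show ?thesis
    using one_param_Lie by (simp add: zero_fun_def)
qed

lemma pure_update:
  assumes "k < length vs"
  shows "pure (vs[k := v]) \<psi>s = (if length \<psi>s = length vs \<and> functionals \<psi>s
    then (\<psi>s ! k) v * (\<Prod>l\<in>{..<length vs} - {k}. (\<psi>s ! l) (vs ! l)) else 0)"
proof -
  have "(\<Prod>l<length vs. (\<psi>s ! l) (vs[k := v] ! l)) = (\<psi>s ! k) v * (\<Prod>l\<in>{..<length vs} - {k}. (\<psi>s ! l) (vs ! l))"
    using assms by (subst prod.remove[of _ k]) (auto intro!: arg_cong2[of _ _ _ _ "(*)"] prod.cong)
  then show ?thesis
    by (simp add: pure_def)
qed

lemma pure_update_sum:
  assumes "k < length vs"
  shows "pure (vs[k := \<Sum>i\<in>I. scaleC (a i) (v i)]) = (\<Sum>i\<in>I. tscale (a i) (pure (vs[k := v i])))"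
proof
  fix \<psi>s
  show "pure (vs[k := \<Sum>i\<in>I. scaleC (a i) (v i)]) \<psi>s = (\<Sum>i\<in>I. tscale (a i) (pure (vs[k := v i]))) \<psi>s"
  proof (cases "length \<psi>s = length vs \<and> functionals \<psi>s")
    case True
    then have "Vector_Spaces.linear scaleC (*) (\<psi>s ! k)"
      using assms by (auto simp: functionals_def)
    then interpret l: Vector_Spaces.linear scaleC "(*)" "\<psi>s ! k" .
    show ?thesis
      using True assms by (simp add: sum_fun_apply tscale_def pure_update l.sum l.scale sum_distrib_right mult.assoc)
  qed (auto simp: sum_fun_apply tscale_def pure_update assms)
qed

lemma one_param_V:
  assumes op: "one_param \<gamma> D"
  shows "D (e j) \<in> V_R"
  using one_paramD(2)[OF op, of 1 "e j"] by (simp add: V_R_def tr_eq_inner one_param_one[OF op])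

lemma Lie_G_act:
  assumes op: "one_param \<gamma> D" and c: "length c = n"
  shows "tens_act (Cx D 0) (pe c) = (\<Sum>k<n. \<Sum>i\<in>UNIV. tscale (of_real (mat_of D $ i $ (c ! k))) (pe (c[k := i])))"
    and "Cx D 0 \<in> \<g>"
proof -
  show X: "Cx D 0 \<in> \<g>"
    using one_param_Lie[OF op] zero_Lie_G by (auto simp: \<g>_def cx_set_def)
  have act: "g_act (Cx D 0) (E j) = (\<Sum>i\<in>UNIV. scaleC (of_real (mat_of D $ i $ j)) (E i))" for j
  proof -
    have "g_act (Cx D 0) (E j) = cx_of (D (e j))"
      using linear_0[OF one_paramD(1)[OF op]] by (simp add: g_act_def cx_bilin_def E_def zero_fun_def)
    also have "\<dots> = (\<Sum>i\<in>UNIV. scaleC (\<phi> i (cx_of (D (e j)))) (E i))"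
      by (rule V_expand[OF cx_of_V[OF one_param_V[OF op]]])
    also have "\<dots> = (\<Sum>i\<in>UNIV. scaleC (of_real (mat_of D $ i $ j)) (E i))"
      by (intro sum.cong HOL.refl arg_cong2[of _ _ _ _ scaleC]) (simp add: \<phi>_def mat_of_def complex_eq_iff)
    finally show ?thesis .
  qed
  show "tens_act (Cx D 0) (pe c) = (\<Sum>k<n. \<Sum>i\<in>UNIV. tscale (of_real (mat_of D $ i $ (c ! k))) (pe (c[k := i])))"
    unfolding pe_def tens_act_pure[OF X] using c
    by (auto simp: act pure_update_sum map_update intro!: sum.cong)
qed

lemma tens_act_lincomb:
  "tens_act X (\<Sum>k\<in>K. tscale (a k) (x k)) = (\<Sum>k\<in>K. tscale (a k) (tens_act X (x k)))"
proof
  fix \<psi>s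
  show "tens_act X (\<Sum>k\<in>K. tscale (a k) (x k)) \<psi>s = (\<Sum>k\<in>K. tscale (a k) (tens_act X (x k))) \<psi>s"
    by (simp add: tens_act_def sum_fun_apply tscale_def sum_distrib_left) (rule impI, rule sum.swap)
qed

text \<open>Both sums carry the same sign because \<open>D\<close> is skew: on the output side the
  equivariance relation produces the transposed matrix, which is the negative.\<close>

lemma killed_g_Hom:
  assumes h: "h \<in> g_Hom (Vpow m) (Vpow n)" and op: "one_param \<gamma> D" and cd: "length c = m" "length d = n"
  shows "(\<Sum>k<m. \<Sum>j\<in>UNIV. of_real (mat_of D $ j $ (c ! k)) * co (h (pe (c[k := j]))) d)
    + (\<Sum>k<n. \<Sum>j\<in>UNIV. of_real (mat_of D $ j $ (d ! k)) * co (h (pe c)) (d[k := j])) = 0"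
proof -
  define X where "X = Cx D 0"
  define M where "M = mat_of D"
  note act = Lie_G_act(1)[OF op, folded X_def M_def]
  have X: "X \<in> \<g>"
    unfolding X_def by (rule Lie_G_act(2)[OF op cd(1)])
  have skew: "M $ i $ j = - M $ j $ i" for i j
    using one_paramD(2)[OF op, of "e i" "e j"] by (simp add: M_def mat_of_def inner_commute)
  have pc: "pe c \<in> Vpow m"
    by (rule pe_Vpow[OF cd(1)])
  have "h (tens_act X (pe c)) = (\<Sum>(k, i)\<in>{..<m} \<times> UNIV. tscale (of_real (M $ i $ (c ! k))) (h (pe (c[k := i]))))"
    unfolding act[OF cd(1)] sum.cartesian_product split_def
    by (rule g_Hom_sum[OF h]) (simp add: pe_Vpow cd)
  then have 1: "co (h (tens_act X (pe c))) d = (\<Sum>k<m. \<Sum>j\<in>UNIV. of_real (M $ j $ (c ! k)) * co (h (pe (c[k := j]))) d)"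
    by (simp only: sum.cartesian_product split_def co_sum co_scale)
  have "tens_act X (h (pe c)) = (\<Sum>d'\<in>Ls n. tscale (co (h (pe c)) d') (tens_act X (pe d')))"
    by (subst Vpow_expand[OF g_HomD(1)[OF h pc]]) (rule tens_act_lincomb)
  then have "co (tens_act X (h (pe c))) d = (\<Sum>d'\<in>Ls n. co (h (pe c)) d' * co (tens_act X (pe d')) d)"
    by (simp only: co_sum co_scale)
  also have "\<dots> = (\<Sum>d'\<in>Ls n. \<Sum>k<n. \<Sum>i\<in>UNIV. co (h (pe c)) d' * (of_real (M $ i $ (d' ! k)) * co (pe (d'[k := i])) d))"
    by (intro sum.cong HOL.refl) (simp only: act mem_Collect_eq co_sum co_scale sum_distrib_left)
  also have "\<dots> = (\<Sum>k<n. \<Sum>(d', i)\<in>Ls n \<times> UNIV. co (h (pe c)) d' * (of_real (M $ i $ (d' ! k)) * co (pe (d'[k := i])) d))"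
    by (subst sum.swap) (simp only: sum.cartesian_product)
  also have "\<dots> = (\<Sum>k<n. \<Sum>(d', j)\<in>Ls n \<times> UNIV. co (h (pe c)) (d'[k := j]) * (of_real (M $ (d' ! k) $ j) * co (pe d') d))"
  proof (rule sum.cong[OF HOL.refl])
    fix k assume "k \<in> {..<n}"
    then show "(\<Sum>(d', i)\<in>Ls n \<times> UNIV. co (h (pe c)) d' * (of_real (M $ i $ (d' ! k)) * co (pe (d'[k := i])) d))
        = (\<Sum>(d', j)\<in>Ls n \<times> UNIV. co (h (pe c)) (d'[k := j]) * (of_real (M $ (d' ! k) $ j) * co (pe d') d))"
      by (intro sum.reindex_bij_witness[of _ "\<lambda>(i, l). (i[k := l], i ! k)" "\<lambda>(i, l). (i[k := l], i ! k)"]) auto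
  qed
  also have "\<dots> = (\<Sum>k<n. \<Sum>d'\<in>Ls n. if d' = d then \<Sum>j\<in>UNIV. co (h (pe c)) (d[k := j]) * of_real (M $ (d ! k) $ j) else 0)"
    unfolding sum.cartesian_product[symmetric] by (intro sum.cong HOL.refl) (use cd in \<open>auto simp: co_pe\<close>)
  also have "\<dots> = (\<Sum>k<n. \<Sum>j\<in>UNIV. co (h (pe c)) (d[k := j]) * of_real (M $ (d ! k) $ j))"
    using cd by simp
  also have "\<dots> = - (\<Sum>k<n. \<Sum>j\<in>UNIV. of_real (M $ j $ (d ! k)) * co (h (pe c)) (d[k := j]))"
    unfolding sum_negf[symmetric] by (intro sum.cong HOL.refl) (simp add: skew[of "d ! _"] mult.commute)
  finally have 2: "co (tens_act X (h (pe c))) d = - (\<Sum>k<n. \<Sum>j\<in>UNIV. of_real (M $ j $ (d ! k)) * co (h (pe c)) (d[k := j]))" .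
  show ?thesis
    unfolding M_def[symmetric] 1[symmetric] g_HomD(5)[OF h X pc] 2 by simp
qed

lemma sum_lessThan_add: "(\<Sum>k<m + n. g k) = (\<Sum>k<m. g k) + (\<Sum>k<n. g (m + k))" for g :: "nat \<Rightarrow> 'b::comm_monoid_add"
  by (induction n) (simp_all add: add.assoc)

text \<open>Bending puts the inputs, reversed, in front of the outputs. With equal signs in
  \<open>killed_g_Hom\<close>, input and output positions merge into one sum over all
  \<open>m + n\<close> positions.\<close>

lemma bent_killed:
  assumes h: "h \<in> g_Hom (Vpow m) (Vpow n)" and op: "one_param \<gamma> D" and w: "length w = m + n"
  defines "f \<equiv> \<lambda>w. co (h (pe (rev (take m w)))) (drop m w)"
  shows "(\<Sum>k<m + n. \<Sum>j\<in>UNIV. of_real (mat_of D $ j $ (w ! k)) * f (w[k := j])) = 0"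
proof -
  define c d where "c = rev (take m w)" and "d = drop m w"
  have cd: "length c = m" "length d = n"
    using w by (simp_all add: c_def d_def)
  have "(\<Sum>k<m. \<Sum>j\<in>UNIV. of_real (mat_of D $ j $ (w ! k)) * f (w[k := j]))
      = (\<Sum>k<m. \<Sum>j\<in>UNIV. of_real (mat_of D $ j $ (c ! (m - Suc k))) * co (h (pe (c[m - Suc k := j]))) d)"
  proof (intro sum.cong HOL.refl)
    fix k j assume "k \<in> {..<m}"
    then have "w ! k = c ! (m - Suc k)" "rev (take m (w[k := j])) = c[m - Suc k := j]" "drop m (w[k := j]) = d"
      using w by (simp_all add: c_def d_def rev_nth take_update_swap rev_update)
    then show "of_real (mat_of D $ j $ (w ! k)) * f (w[k := j])
        = of_real (mat_of D $ j $ (c ! (m - Suc k))) * co (h (pe (c[m - Suc k := j]))) d"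
      by (simp add: f_def)
  qed
  also have "\<dots> = (\<Sum>k<m. \<Sum>j\<in>UNIV. of_real (mat_of D $ j $ (c ! k)) * co (h (pe (c[k := j]))) d)"
    by (rule sum.nat_diff_reindex)
  moreover have "(\<Sum>k<n. \<Sum>j\<in>UNIV. of_real (mat_of D $ j $ (w ! (m + k))) * f (w[m + k := j]))
      = (\<Sum>k<n. \<Sum>j\<in>UNIV. of_real (mat_of D $ j $ (d ! k)) * co (h (pe c)) (d[k := j]))"
    using w by (intro sum.cong HOL.refl) (simp add: f_def c_def d_def drop_update_swap)
  ultimately show ?thesis
    unfolding sum_lessThan_add using killed_g_Hom[OF h op cd] by simp
qed

section \<open>Bending arrays back into homomorphisms\<close>

primrec nested_caps :: "nat \<Rightarrow> complex diag" where
  "nested_caps 0 = Id 0"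
| "nested_caps (Suc m) = Comp (nested_caps m) (Tens (Tens (Id m) Eps) (Id m))"

lemma arr_nested_caps: "arr (nested_caps m) (m + m) 0"
proof (induction m)
  case (Suc m)
  have "arr (Tens (Tens (Id m) Eps) (Id m)) (m + 2 + m) (m + 0 + m)"
    by (intro arr.intros)
  then show ?case
    using arr.intros(7)[OF Suc] by simp
qed (simp add: arr.intros)

text \<open>The innermost cap joins the last entry of \<open>c\<close> to the first entry of
  \<open>c'\<close>; removing this pair leaves the same situation with one strand less on either
  side.\<close>

lemma co_nested_caps:
  "length c = m \<Longrightarrow> length c' = m \<Longrightarrow> co (F (m + m) 0 (nested_caps m) (pe (c @ c'))) [] = (if c' = rev c then 1 else 0)"
proof (induction m arbitrary: c c')
  case 0
  have "pe ([] @ []) = pure []" "co (pure []) [] = 1"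
    by (simp_all add: pe_def co_def pure_eq functionals_def)
  then show ?case
    using 0 F_Id[OF unit_Vpow] by simp
next
  case (Suc m)
  obtain c0 x where c: "c = c0 @ [x]" "length c0 = m"
    using Suc.prems(1) by (metis length_Suc_conv_rev)
  obtain y c0' where c': "c' = y # c0'" "length c0' = m"
    using Suc.prems(2) by (auto simp: length_Suc_conv)
  let ?T = "Tens (Tens (Id m) Eps) (Id m) :: complex diag"
  have T: "arr (Tens (Id m) Eps) (m + 2) (m + 0)" "arr ?T (m + 2 + m) (m + 0 + m)"
    by (intro arr.intros)+
  have p: "pe c0 \<in> Vpow m" "pe [x, y] \<in> Vpow 2" "pe c0' \<in> Vpow m" "pe (c0 @ [x, y]) \<in> Vpow (m + 2)"
    using c c' by (simp_all add: pe_Vpow)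
  have eps: "F 2 0 Eps (pe [x, y]) = tscale (if x = y then 1 else 0) (pure [])"
  proof (rule Vpow_eqI)
    show "F 2 0 Eps (pe [x, y]) \<in> Vpow 0"
      by (rule g_HomD(1)[OF F_Hom[OF arr.intros(5)] p(2)])
    show "tscale (if x = y then 1 else 0) (pure []) \<in> Vpow 0"
      using unit_Vpow unfolding Vpow_def by (rule tens.span_scale)
    show "co (F 2 0 Eps (pe [x, y])) d = co (tscale (if x = y then 1 else 0) (pure [])) d" if "length d = 0" for d
      using that functionals_\<phi>[of "[]"] by (simp add: co_Eps co_scale) (simp add: co_def pure_eq)
  qed
  have ts: "x' \<otimes>\<^sub>T tscale r y' = tscale r (x' \<otimes>\<^sub>T y')" "tscale r x' \<otimes>\<^sub>T y' = tscale r (x' \<otimes>\<^sub>T y')" for x' y' r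
    by (auto simp: tens_mult_def tscale_def sum_distrib_left mult_ac fun_eq_iff)
  have "F (m + 2 + m) (m + 0 + m) ?T (pe ((c0 @ [x, y]) @ c0'))
      = F (m + 2) (m + 0) (Tens (Id m) Eps) (pe (c0 @ [x, y])) \<otimes>\<^sub>T pe c0'"
    unfolding pe_append[of "c0 @ [x, y]"] using F_Tens[OF T(1) arr.intros(1) p(4,3)] by (simp add: F_Id[OF p(3)])
  also have "F (m + 2) (m + 0) (Tens (Id m) Eps) (pe (c0 @ [x, y])) = pe c0 \<otimes>\<^sub>T F 2 0 Eps (pe [x, y])"
    unfolding pe_append using F_Tens[OF arr.intros(1) arr.intros(5) p(1,2)] by (simp add: F_Id[OF p(1)])
  also have "\<dots> = tscale (if x = y then 1 else 0) (pe c0)"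
    unfolding eps ts by (simp add: pe_def pure_append)
  finally have FT: "F (m + 2 + m) (m + m) ?T (pe (c @ c')) = tscale (if x = y then 1 else 0) (pe (c0 @ c0'))"
    unfolding ts by (simp add: c c' pe_append)
  have "pe (c @ c') \<in> Vpow (m + 2 + m)"
    using c c' by (simp add: pe_Vpow)
  from F_Comp[OF arr_nested_caps[of m] _ this, of ?T] T(2)
  have "F (Suc m + Suc m) 0 (nested_caps (Suc m)) (pe (c @ c'))
      = F (m + m) 0 (nested_caps m) (tscale (if x = y then 1 else 0) (pe (c0 @ c0')))"
    by (simp add: FT[simplified])
  also have "\<dots> = tscale (if x = y then 1 else 0) (F (m + m) 0 (nested_caps m) (pe (c0 @ c0')))"
    using c c' by (intro g_HomD(4)[OF F_Hom[OF arr_nested_caps]]) (simp add: pe_Vpow)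
  finally show ?case
    using Suc.IH[OF c(2) c'(2)] by (auto simp: co_scale c c')
qed

text \<open>The bent array of \<open>h\<close> has real and imaginary parts that satisfy
  \<open>killed\<close> separately, since the matrices of the generators are real. Two homomorphisms
  agree once they agree on the basis tensors \<open>pe c\<close>.\<close>

theorem full: "full_functor (7 / 3) 26 \<Phi>"
  unfolding full_functor_def
proof (intro allI ballI)
  fix m n h assume h: "h \<in> g_Hom (Vpow m) (Vpow n)"
  \<comment> \<open>The input indices are reversed because nested caps meet them in that
    order.\<close>
  define f where "f = (\<lambda>w. co (h (pe (rev (take m w)))) (drop m w))"
  have re: "(\<lambda>w. Re (f w)) \<in> A (m + n)"
  proof (rule killed_mem)
    fix \<gamma> D assume op: "one_param \<gamma> D"
    show "killed (m + n) (\<lambda>w. Re (f w)) D"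
      unfolding killed_def
      using arg_cong[OF bent_killed[OF h op], of _ Re] by (simp add: f_def)
  qed
  have im: "(\<lambda>w. Im (f w)) \<in> A (m + n)"
  proof (rule killed_mem)
    fix \<gamma> D assume op: "one_param \<gamma> D"
    show "killed (m + n) (\<lambda>w. Im (f w)) D"
      unfolding killed_def
      using arg_cong[OF bent_killed[OF h op], of _ Im] by (simp add: f_def)
  qed
  obtain s where s: "arr s 0 (m + n)" "\<And>w. length w = m + n \<Longrightarrow> co (F 0 (m + n) s (pure [])) w = of_real (Re (f w))"
    using re by (auto simp: A_def)
  obtain s' where s': "arr s' 0 (m + n)" "\<And>w. length w = m + n \<Longrightarrow> co (F 0 (m + n) s' (pure [])) w = of_real (Im (f w))"
    using im by (auto simp: A_def)
  define t0 where "t0 = Add s (Scale \<i> s')"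
  have t0: "arr t0 0 (m + n)"
    unfolding t0_def by (intro arr.intros s s')
  define y where "y = F 0 (m + n) t0 (pure [])"
  have y: "y \<in> Vpow (m + n)"
    unfolding y_def by (rule g_HomD(1)[OF F_Hom[OF t0] unit_Vpow])
  have yf: "co y w = f w" if "length w = m + n" for w
    using that unfolding y_def t0_def F_Add[OF s(1) arr.intros(10)[OF s'(1)] unit_Vpow] F_Scale[OF s'(1) unit_Vpow]
    by (simp add: co_add co_scale s s' complex_eq_iff)
  \<comment> \<open>The input strands are placed to the left of \<open>t0\<close>, and nested caps
    join them to its first \<open>m\<close> outputs; the other \<open>n\<close> outputs pass
    through.\<close>
  define t where "t = Comp (Tens (nested_caps m) (Id n)) (Tens (Id m) t0)"
  have T1: "arr (Tens (Id m) t0) m (m + (m + n))"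
    using arr.intros(8)[OF arr.intros(1) t0] by simp
  have T2: "arr (Tens (nested_caps m) (Id n)) (m + m + n) n"
    using arr.intros(8)[OF arr_nested_caps arr.intros(1)] by simp
  have t: "arr t m n"
    unfolding t_def using arr.intros(7)[OF T2] T1 by (simp add: add.assoc)
  have "F m n t (pe c) = h (pe c)" if c: "length c = m" for c
  proof (rule Vpow_eqI)
    have pc: "pe c \<in> Vpow m"
      by (rule pe_Vpow[OF c])
    show "F m n t (pe c) \<in> Vpow n" "h (pe c) \<in> Vpow n"
      using g_HomD(1)[OF F_Hom[OF t] pc] g_HomD(1)[OF h pc] .
    fix d :: "26 list" assume d: "length d = n"
    have "F m (m + (m + n)) (Tens (Id m) t0) (pe c) = pe c \<otimes>\<^sub>T y"
    proof -
      have "pe c \<otimes>\<^sub>T pure [] = pe c"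
        by (simp add: pe_def pure_append)
      then show ?thesis
        using F_Tens[OF arr.intros(1) t0 pc unit_Vpow] by (simp add: F_Id[OF pc] y_def)
    qed
    moreover have mem: "F m (m + (m + n)) (Tens (Id m) t0) (pe c) \<in> Vpow (m + m + n)"
      using g_HomD(1)[OF F_Hom[OF T1] pc] by (simp add: add.assoc)
    ultimately have z: "pe c \<otimes>\<^sub>T y \<in> Vpow (m + m + n)"
      by simp
    have "F m n t (pe c) = F (m + m + n) n (Tens (nested_caps m) (Id n)) (pe c \<otimes>\<^sub>T y)"
      unfolding t_def using F_Comp[OF T2 _ pc, of "Tens (Id m) t0"] T1 \<open>F m (m + (m + n)) (Tens (Id m) t0) (pe c) = pe c \<otimes>\<^sub>T y\<close>
      by (simp add: add.assoc)
    then have "co (F m n t (pe c)) d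
        = (\<Sum>w\<in>Ls (m + m + n). co (pe c \<otimes>\<^sub>T y) w * co (F (m + m + n) n (Tens (nested_caps m) (Id n)) (pe w)) d)"
      using g_Hom_co[OF F_Hom[OF T2] z] by simp
    also have "\<dots> = (\<Sum>c1\<in>Ls m. \<Sum>c2\<in>Ls m. \<Sum>c3\<in>Ls n.
        (if c1 = c then f (c2 @ c3) else 0) * ((if c2 = rev c1 then 1 else 0) * (if c3 = d then 1 else 0)))"
      unfolding sum_Ls_add
    proof (intro sum.cong HOL.refl)
      fix c1 c2 c3 :: "26 list" assume "c1 \<in> Ls m" "c2 \<in> Ls m" "c3 \<in> Ls n"
      then have l: "length c1 = m" "length c2 = m" "length c3 = n"
        by simp_all
      have 1: "co (pe c \<otimes>\<^sub>T y) ((c1 @ c2) @ c3) = (if c1 = c then f (c2 @ c3) else 0)"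
        using co_tens[OF pc, of "(c1 @ c2) @ c3" "m + n" y] l c by (auto simp: co_pe yf)
      have p: "pe (c1 @ c2) \<in> Vpow (m + m)" "pe c3 \<in> Vpow n"
        using l by (simp_all add: pe_Vpow)
      have cap: "F (m + m) 0 (nested_caps m) (pe (c1 @ c2)) \<in> Vpow 0"
        by (rule g_HomD(1)[OF F_Hom[OF arr_nested_caps] p(1)])
      have "F (m + m + n) n (Tens (nested_caps m) (Id n)) (pe ((c1 @ c2) @ c3))
          = F (m + m) 0 (nested_caps m) (pe (c1 @ c2)) \<otimes>\<^sub>T pe c3"
        unfolding pe_append[of "c1 @ c2"] using F_Tens[OF arr_nested_caps arr.intros(1) p] by (simp add: F_Id[OF p(2)])
      then have 2: "co (F (m + m + n) n (Tens (nested_caps m) (Id n)) (pe ((c1 @ c2) @ c3))) d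
          = (if c2 = rev c1 then 1 else 0) * (if c3 = d then 1 else 0)"
        using co_tens[OF cap, of d n "pe c3"] l d by (simp add: co_nested_caps co_pe)
      show "co (pe c \<otimes>\<^sub>T y) ((c1 @ c2) @ c3) * co (F (m + m + n) n (Tens (nested_caps m) (Id n)) (pe ((c1 @ c2) @ c3))) d
          = (if c1 = c then f (c2 @ c3) else 0) * ((if c2 = rev c1 then 1 else 0) * (if c3 = d then 1 else 0))"
        unfolding 1 2 ..
    qed
    also have "\<dots> = (\<Sum>c1\<in>Ls m. if c1 = c then f (rev c @ d) else 0)"
    proof (intro sum.cong HOL.refl)
      fix c1 :: "26 list" assume "c1 \<in> Ls m"
      have "(\<Sum>c2\<in>Ls m. \<Sum>c3\<in>Ls n. (if c1 = c then f (c2 @ c3) else 0) * ((if c2 = rev c1 then 1 else 0) * (if c3 = d then 1 else 0)))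
          = (\<Sum>c2\<in>Ls m. \<Sum>c3\<in>Ls n. if c3 = d then if c2 = rev c1 then if c1 = c then f (c2 @ c3) else 0 else 0 else 0)"
        by (intro sum.cong HOL.refl) simp
      also have "\<dots> = (\<Sum>c2\<in>Ls m. if c2 = rev c1 then if c1 = c then f (c2 @ d) else 0 else 0)"
        using d by simp
      also have "\<dots> = (if c1 = c then f (rev c @ d) else 0)"
        using \<open>c1 \<in> Ls m\<close> by simp
      finally show "(\<Sum>c2\<in>Ls m. \<Sum>c3\<in>Ls n. (if c1 = c then f (c2 @ c3) else 0) * ((if c2 = rev c1 then 1 else 0) * (if c3 = d then 1 else 0)))
          = (if c1 = c then f (rev c @ d) else 0)" .
    qed
    also have "\<dots> = co (h (pe c)) d"
      using c by (simp add: f_def)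
    finally show "co (F m n t (pe c)) d = co (h (pe c)) d" .
  qed
  then have pe_eq: "F m n t (pe c) = h (pe c)" if "length c = m" for c
    using that .
  have "F m n t x = h x" for x
  proof (cases "x \<in> Vpow m")
    case True
    have "g x = (\<Sum>c\<in>Ls m. tscale (co x c) (g (pe c)))" if g: "g \<in> g_Hom (Vpow m) (Vpow n)" for g
      by (subst Vpow_expand[OF True]) (rule g_Hom_sum[OF g], simp add: pe_Vpow)
    from this[OF F_Hom[OF t]] this[OF h]
    have "F m n t x = (\<Sum>c\<in>Ls m. tscale (co x c) (F m n t (pe c)))" "h x = (\<Sum>c\<in>Ls m. tscale (co x c) (h (pe c)))" .
    moreover have "(\<Sum>c\<in>Ls m. tscale (co x c) (F m n t (pe c))) = (\<Sum>c\<in>Ls m. tscale (co x c) (h (pe c)))"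
      by (intro sum.cong HOL.refl) (simp add: pe_eq)
    ultimately show ?thesis by simp
  next
    case False
    then show ?thesis
      using g_HomD(2)[OF F_Hom[OF t]] g_HomD(2)[OF h] by simp
  qed
  then have "\<Phi> m n (T_mor (7 / 3) 26 m n t) = h"
    by (auto simp: F_def)
  moreover have "T_mor (7 / 3) 26 m n t \<in> T_Hom (7 / 3) 26 m n"
    using t by (auto simp: T_Hom_def)
  ultimately show "\<exists>f\<in>T_Hom (7 / 3) 26 m n. \<Phi> m n f = h"
    by blast
qed

end

theorem proposition5p2:
  fixes \<Phi> :: "nat \<Rightarrow> nat \<Rightarrow> complex diag set \<Rightarrow> tensor \<Rightarrow> tensor"
    and B :: "albert set" and dual :: "albert \<Rightarrow> albert"
  assumes basis: "independent B" "span B = V_R"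
    and dual: "\<And>a. a \<in> B \<Longrightarrow> dual a \<in> V_R"
      "\<And>a b. a \<in> B \<Longrightarrow> b \<in> B \<Longrightarrow> tr (dual a \<circ>\<^sub>J b) = (if a = b then 1 else 0)"
    and monoidal: "monoidal_functor (7 / 3) 26 \<Phi>"
    and Mu: "\<And>a b. a \<in> V \<Longrightarrow> b \<in> V \<Longrightarrow>
      \<Phi> 2 1 (T_mor (7 / 3) 26 2 1 Mu) (pure [a, b]) = pure [projC (jordanC a b)]"
    and Chi: "\<And>a b. a \<in> V \<Longrightarrow> b \<in> V \<Longrightarrow>
      \<Phi> 2 2 (T_mor (7 / 3) 26 2 2 Chi) (pure [a, b]) = pure [b, a]"
    and Eta: "\<Phi> 0 2 (T_mor (7 / 3) 26 0 2 Eta) (pure [])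
      = (\<Sum>b\<in>B. pure [cx_of b, cx_of (dual b)])"
    and Eps: "\<And>a b. a \<in> V \<Longrightarrow> b \<in> V \<Longrightarrow>
      \<Phi> 2 0 (T_mor (7 / 3) 26 2 0 Eps) (pure [a, b]) = tscale (trC (jordanC a b)) (pure [])"
  shows "full_functor (7 / 3) 26 \<Phi>"
proof -
  interpret T_functor \<Phi> B dual
    by unfold_locales (fact basis dual monoidal Mu Chi Eta Eps)+
  obtain e :: "26 \<Rightarrow> albert" where "orthonormal_frame e"
    using frame_exists by blast
  then interpret T_functor_frame \<Phi> B dual e
    by (intro T_functor_frame.intro T_functor_axioms)
  show ?thesis
    by (rule full)
qed

end
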